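(* Let $P$ be a finite product of finite total orders, $\mathbb{F}$ a field, and $F \colon P \to \mathsf{Vec}_{\mathbb{F}}$ a pointwise finite-dimensional bidegree $1$ functor. Then $F$ is interval decomposable.
   Context: $\mathsf{Vec}_{\mathbb{F}}$ is the category of $\mathbb{F}$-vector spaces. Products of posets carry the product partial order; posets are regarded as categories. Pointwise finite-dimensional means $F(x)$ is finite-dimensional for all $x\in P$. A functor from a distributive lattice $P$ is codegree $1$ (resp. degree $1$) if it sends every bicartesian square of $P$ (a square that is both a pushout and a pullback in $P$, i.e. one with corners $x\wedge y,x,y,x\vee y$ for some $x,y\in P$) to a pushout (resp. pullback) square; it is bidegree $1$ if it is both degree $1$ and codegree $1$. An interval in $P$ is a subset $I\subset P$ such that (a) $x,y\in I$ and $x\le z\le y$ imply $z\in I$, and (b) any $x,y\in I$ are connected by a zigzag $x=a_0\le b_0\ge a_1\le\dots\le b_n=y$ of relations in $I$. The interval module $\mathbb{F}_I$ has $\mathbb{F}_I(x)=\mathbb{F}$ if $x\in I$ and $0$ otherwise, with $\mathbb{F}_I(x\le y)=\mathrm{id}_{\mathbb{F}}$ if $x,y\in I$ and $0$ otherwise. $F$ is interval decomposable if it is isomorphic to a direct sum of interval modules. *)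

theory Defs
  imports "Jordan_Normal_Form.VS_Connect"
begin

section \<open>Posets\<close>

text \<open>The factors share one element type but each has its own carrier and relation; finitely many
  orders on different types can be placed in a common sum type.\<close>

definition prod_order :: "'i set \<Rightarrow> ('i \<Rightarrow> 'a gorder) \<Rightarrow> ('i \<Rightarrow> 'a) gorder" where
  "prod_order I T =
    \<lparr>carrier = (\<Pi>\<^sub>E i\<in>I. carrier (T i)), eq = (=), le = (\<lambda>x y. \<forall>i\<in>I. x i \<sqsubseteq>\<^bsub>T i\<^esub> y i)\<rparr>"

definition poset_interval :: "'p gorder \<Rightarrow> 'p set \<Rightarrow> bool" where
  "poset_interval P S \<longleftrightarrow>
    S \<subseteq> carrier P \<and>
    (\<forall>x\<in>S. \<forall>y\<in>S. \<forall>z\<in>carrier P. x \<sqsubseteq>\<^bsub>P\<^esub> z \<and> z \<sqsubseteq>\<^bsub>P\<^esub> y \<longrightarrow> z \<in> S) \<and>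
    (\<forall>x\<in>S. \<forall>y\<in>S. \<exists>(n::nat) a b. a 0 = x \<and> b n = y \<and>
        (\<forall>k\<le>n. a k \<in> S \<and> b k \<in> S \<and> a k \<sqsubseteq>\<^bsub>P\<^esub> b k) \<and>
        (\<forall>k<n. a (Suc k) \<sqsubseteq>\<^bsub>P\<^esub> b k))"


section \<open>Functors from a poset to vector spaces\<close>

abbreviation vspace :: "('k::field, 'v) module \<Rightarrow> bool" where
  "vspace V \<equiv> vectorspace class_ring V"

abbreviation vlin :: "('k::field, 'v) module \<Rightarrow> ('k, 'w) module \<Rightarrow> ('v \<Rightarrow> 'w) \<Rightarrow> bool" where
  "vlin V W f \<equiv> linear_map class_ring V W f"

text \<open>A functor is given by its values \<open>F x\<close> on objects and \<open>\<phi> x y\<close> on relations \<open>x \<le> y\<close>.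
  Only the restriction of \<open>\<phi> x y\<close> to the carrier of \<open>F x\<close> is meaningful, so all equations between
  maps are required on carriers only.\<close>

definition vec_functor ::
  "'p gorder \<Rightarrow> ('p \<Rightarrow> ('k::field, 'v) module) \<Rightarrow> ('p \<Rightarrow> 'p \<Rightarrow> 'v \<Rightarrow> 'v) \<Rightarrow> bool" where
  "vec_functor P F \<phi> \<longleftrightarrow>
    (\<forall>x\<in>carrier P. vspace (F x)) \<and>
    (\<forall>x\<in>carrier P. \<forall>y\<in>carrier P. x \<sqsubseteq>\<^bsub>P\<^esub> y \<longrightarrow> vlin (F x) (F y) (\<phi> x y)) \<and>
    (\<forall>x\<in>carrier P. \<forall>v\<in>carrier (F x). \<phi> x x v = v) \<and>
    (\<forall>x\<in>carrier P. \<forall>y\<in>carrier P. \<forall>z\<in>carrier P. x \<sqsubseteq>\<^bsub>P\<^esub> y \<and> y \<sqsubseteq>\<^bsub>P\<^esub> z \<longrightarrow>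
        (\<forall>v\<in>carrier (F x). \<phi> y z (\<phi> x y v) = \<phi> x z v))"

definition pointwise_fin_dim :: "'p gorder \<Rightarrow> ('p \<Rightarrow> ('k::field, 'v) module) \<Rightarrow> bool" where
  "pointwise_fin_dim P F \<longleftrightarrow> (\<forall>x\<in>carrier P. vectorspace.fin_dim class_ring (F x))"

definition vec_functor_iso ::
  "'p gorder \<Rightarrow> ('p \<Rightarrow> ('k::field, 'v) module) \<Rightarrow> ('p \<Rightarrow> 'p \<Rightarrow> 'v \<Rightarrow> 'v) \<Rightarrow>
   ('p \<Rightarrow> ('k, 'w) module) \<Rightarrow> ('p \<Rightarrow> 'p \<Rightarrow> 'w \<Rightarrow> 'w) \<Rightarrow> bool" where
  "vec_functor_iso P F \<phi> G \<gamma> \<longleftrightarrow>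
    (\<exists>\<eta>. (\<forall>x\<in>carrier P. vlin (F x) (G x) (\<eta> x) \<and> bij_betw (\<eta> x) (carrier (F x)) (carrier (G x))) \<and>
         (\<forall>x\<in>carrier P. \<forall>y\<in>carrier P. x \<sqsubseteq>\<^bsub>P\<^esub> y \<longrightarrow>
            (\<forall>v\<in>carrier (F x). \<eta> y (\<phi> x y v) = \<gamma> x y (\<eta> x v))))"


section \<open>Pullback and pushout squares of vector spaces\<close>

definition comm_square ::
  "('k::field, 'v) module \<Rightarrow> ('k, 'v) module \<Rightarrow> ('k, 'v) module \<Rightarrow> ('k, 'v) module \<Rightarrow>
   ('v \<Rightarrow> 'v) \<Rightarrow> ('v \<Rightarrow> 'v) \<Rightarrow> ('v \<Rightarrow> 'v) \<Rightarrow> ('v \<Rightarrow> 'v) \<Rightarrow> bool" where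
  "comm_square A B C D f g h k \<longleftrightarrow>
    vlin A B f \<and> vlin A C g \<and> vlin B D h \<and> vlin C D k \<and> (\<forall>a\<in>carrier A. h (f a) = k (g a))"

text \<open>The universal properties are tested on the vector spaces with carrier in a given type \<open>'w\<close>.
  They are used below with \<open>'w = 'v \<times> 'v\<close>, which already contains a pullback and a pushout of any
  diagram of vector spaces with carriers in \<open>'v\<close>; the lemmas \<open>pullback_square_univ\<close> and
  \<open>pushout_square_univ\<close> show that the universal properties then hold for every type \<open>'w\<close>.\<close>

definition pullback_square ::
  "'w itself \<Rightarrow>
   ('k::field, 'v) module \<Rightarrow> ('k, 'v) module \<Rightarrow> ('k, 'v) module \<Rightarrow> ('k, 'v) module \<Rightarrow>
   ('v \<Rightarrow> 'v) \<Rightarrow> ('v \<Rightarrow> 'v) \<Rightarrow> ('v \<Rightarrow> 'v) \<Rightarrow> ('v \<Rightarrow> 'v) \<Rightarrow> bool" where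
  "pullback_square _ A B C D f g h k \<longleftrightarrow>
    comm_square A B C D f g h k \<and>
    (\<forall>(W :: ('k, 'w) module) p q.
       vlin W B p \<and> vlin W C q \<and> (\<forall>w\<in>carrier W. h (p w) = k (q w)) \<longrightarrow>
       (\<exists>!u. u \<in> extensional (carrier W) \<and> vlin W A u \<and>
             (\<forall>w\<in>carrier W. f (u w) = p w \<and> g (u w) = q w)))"

definition pushout_square ::
  "'w itself \<Rightarrow>
   ('k::field, 'v) module \<Rightarrow> ('k, 'v) module \<Rightarrow> ('k, 'v) module \<Rightarrow> ('k, 'v) module \<Rightarrow>
   ('v \<Rightarrow> 'v) \<Rightarrow> ('v \<Rightarrow> 'v) \<Rightarrow> ('v \<Rightarrow> 'v) \<Rightarrow> ('v \<Rightarrow> 'v) \<Rightarrow> bool" where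
  "pushout_square _ A B C D f g h k \<longleftrightarrow>
    comm_square A B C D f g h k \<and>
    (\<forall>(W :: ('k, 'w) module) p q.
       vlin B W p \<and> vlin C W q \<and> (\<forall>a\<in>carrier A. p (f a) = q (g a)) \<longrightarrow>
       (\<exists>!u. u \<in> extensional (carrier D) \<and> vlin D W u \<and>
             (\<forall>b\<in>carrier B. u (h b) = p b) \<and> (\<forall>c\<in>carrier C. u (k c) = q c)))"

section \<open>Degree one\<close>

definition degree_one ::
  "'p gorder \<Rightarrow> ('p \<Rightarrow> ('k::field, 'v) module) \<Rightarrow> ('p \<Rightarrow> 'p \<Rightarrow> 'v \<Rightarrow> 'v) \<Rightarrow> bool" where
  "degree_one P F \<phi> \<longleftrightarrow>
    (\<forall>x\<in>carrier P. \<forall>y\<in>carrier P.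
      pullback_square TYPE('v \<times> 'v) (F (x \<sqinter>\<^bsub>P\<^esub> y)) (F x) (F y) (F (x \<squnion>\<^bsub>P\<^esub> y))
        (\<phi> (x \<sqinter>\<^bsub>P\<^esub> y) x) (\<phi> (x \<sqinter>\<^bsub>P\<^esub> y) y) (\<phi> x (x \<squnion>\<^bsub>P\<^esub> y)) (\<phi> y (x \<squnion>\<^bsub>P\<^esub> y)))"

definition codegree_one ::
  "'p gorder \<Rightarrow> ('p \<Rightarrow> ('k::field, 'v) module) \<Rightarrow> ('p \<Rightarrow> 'p \<Rightarrow> 'v \<Rightarrow> 'v) \<Rightarrow> bool" where
  "codegree_one P F \<phi> \<longleftrightarrow>
    (\<forall>x\<in>carrier P. \<forall>y\<in>carrier P.
      pushout_square TYPE('v \<times> 'v) (F (x \<sqinter>\<^bsub>P\<^esub> y)) (F x) (F y) (F (x \<squnion>\<^bsub>P\<^esub> y))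
        (\<phi> (x \<sqinter>\<^bsub>P\<^esub> y) x) (\<phi> (x \<sqinter>\<^bsub>P\<^esub> y) y) (\<phi> x (x \<squnion>\<^bsub>P\<^esub> y)) (\<phi> y (x \<squnion>\<^bsub>P\<^esub> y)))"

definition bidegree_one ::
  "'p gorder \<Rightarrow> ('p \<Rightarrow> ('k::field, 'v) module) \<Rightarrow> ('p \<Rightarrow> 'p \<Rightarrow> 'v \<Rightarrow> 'v) \<Rightarrow> bool" where
  "bidegree_one P F \<phi> \<longleftrightarrow> degree_one P F \<phi> \<and> codegree_one P F \<phi>"


section \<open>Interval decomposability\<close>

text \<open>The \<open>mult\<close> and \<open>one\<close> fields that a \<open>module\<close> record inherits from \<open>ring\<close> play no role for
  vector spaces.\<close>

definition interval_module :: "'p set \<Rightarrow> 'p \<Rightarrow> ('k::field, 'k) module" where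
  "interval_module S x =
    \<lparr>carrier = (if x \<in> S then UNIV else {0}), mult = (*), one = 1, zero = 0, add = (+),
     smult = (*)\<rparr>"

definition interval_map :: "'p set \<Rightarrow> 'p \<Rightarrow> 'p \<Rightarrow> 'k::field \<Rightarrow> 'k" where
  "interval_map S x y = (if x \<in> S \<and> y \<in> S then (\<lambda>v. v) else (\<lambda>v. 0))"

definition module_dsum :: "'j set \<Rightarrow> ('j \<Rightarrow> ('k, 'v) module) \<Rightarrow> ('k, 'j \<Rightarrow> 'v) module" where
  "module_dsum J M =
    \<lparr>carrier = {h \<in> (\<Pi>\<^sub>E j\<in>J. carrier (M j)). finite {j \<in> J. h j \<noteq> \<zero>\<^bsub>M j\<^esub>}},
     mult = undefined, one = undefined,
     zero = (\<lambda>j\<in>J. \<zero>\<^bsub>M j\<^esub>),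
     add = (\<lambda>h h'. \<lambda>j\<in>J. h j \<oplus>\<^bsub>M j\<^esub> h' j),
     smult = (\<lambda>c h. \<lambda>j\<in>J. c \<odot>\<^bsub>M j\<^esub> h j)\<rparr>"

definition map_dsum :: "'j set \<Rightarrow> ('j \<Rightarrow> 'v \<Rightarrow> 'w) \<Rightarrow> ('j \<Rightarrow> 'v) \<Rightarrow> 'j \<Rightarrow> 'w" where
  "map_dsum J f h = (\<lambda>j\<in>J. f j (h j))"

text \<open>Indexing by a set of natural numbers is no restriction for the pointwise finite-dimensional
  functors on a finite poset considered here: each nonempty interval contributes one dimension to
  some \<open>F x\<close>, so a decomposition has finitely many nonzero summands.\<close>

definition interval_decomposable ::
  "'p gorder \<Rightarrow> ('p \<Rightarrow> ('k::field, 'v) module) \<Rightarrow> ('p \<Rightarrow> 'p \<Rightarrow> 'v \<Rightarrow> 'v) \<Rightarrow> bool" where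
  "interval_decomposable P F \<phi> \<longleftrightarrow>
    (\<exists>(J :: nat set) S. (\<forall>j\<in>J. poset_interval P (S j)) \<and>
       vec_functor_iso P F \<phi>
         (\<lambda>x. module_dsum J (\<lambda>j. interval_module (S j) x))
         (\<lambda>x y. map_dsum J (\<lambda>j. interval_map (S j) x y)))"


section \<open>Independence of the universal properties from the test type\<close>

lemma vlin_iff:
  "vlin V W f \<longleftrightarrow> vspace V \<and> vspace W \<and> f \<in> carrier V \<rightarrow> carrier W \<and>
    (\<forall>x\<in>carrier V. \<forall>y\<in>carrier V. f (x \<oplus>\<^bsub>V\<^esub> y) = f x \<oplus>\<^bsub>W\<^esub> f y) \<and>
    (\<forall>c. \<forall>x\<in>carrier V. f (c \<odot>\<^bsub>V\<^esub> x) = c \<odot>\<^bsub>W\<^esub> f x)"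
  by (auto simp: linear_map_def mod_hom_def mod_hom_axioms_def LinearCombinations.module_hom_def vectorspace_def)

lemma vspaceI:
  fixes V :: "('k::field, 'v) module"
  assumes "abelian_group V"
    and "\<And>a x. x \<in> carrier V \<Longrightarrow> a \<odot>\<^bsub>V\<^esub> x \<in> carrier V"
    and "\<And>a b x. x \<in> carrier V \<Longrightarrow> (a + b) \<odot>\<^bsub>V\<^esub> x = a \<odot>\<^bsub>V\<^esub> x \<oplus>\<^bsub>V\<^esub> b \<odot>\<^bsub>V\<^esub> x"
    and "\<And>a x y. x \<in> carrier V \<Longrightarrow> y \<in> carrier V \<Longrightarrow>
           a \<odot>\<^bsub>V\<^esub> (x \<oplus>\<^bsub>V\<^esub> y) = a \<odot>\<^bsub>V\<^esub> x \<oplus>\<^bsub>V\<^esub> a \<odot>\<^bsub>V\<^esub> y"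
    and "\<And>a b x. x \<in> carrier V \<Longrightarrow> (a * b) \<odot>\<^bsub>V\<^esub> x = a \<odot>\<^bsub>V\<^esub> (b \<odot>\<^bsub>V\<^esub> x)"
    and "\<And>x. x \<in> carrier V \<Longrightarrow> 1 \<odot>\<^bsub>V\<^esub> x = x"
  shows "vspace V"
proof -
  have "field (class_ring :: 'k ring)" by (rule class_field)
  moreover have "module (class_ring :: 'k ring) V"
    by (rule moduleI) (use assms calculation in \<open>auto simp: field_def domain_def\<close>)
  ultimately show ?thesis by (simp add: vectorspace_def)
qed

lemma vspace_direct_sum:
  "vspace V \<Longrightarrow> vspace W \<Longrightarrow> vspace (direct_sum V W)"
  by (simp add: vectorspace_def direct_sum_is_module)

lemma vspace_submodule:
  "vspace V \<Longrightarrow> submodule class_ring S V \<Longrightarrow> vspace (V\<lparr>carrier := S\<rparr>)"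
  by (simp add: vectorspace_def module.submodule_is_module)

lemma vlin_zero: 
  assumes "vlin V W f" shows "f \<zero>\<^bsub>V\<^esub> = \<zero>\<^bsub>W\<^esub>"
proof -
  interpret linear_map class_ring V W f by (rule assms)
  show ?thesis by simp
qed

lemma vspace_quotient:
  fixes V :: "('k::field, 'v) module"
  assumes V: "vspace V" and S: "submodule class_ring S V"
  shows "\<exists>(Q :: ('k, 'v) module) r. vlin V Q r \<and> (\<forall>v\<in>carrier V. r v = \<zero>\<^bsub>Q\<^esub> \<longrightarrow> v \<in> S) \<and>
           (\<forall>v\<in>S. r v = \<zero>\<^bsub>Q\<^esub>)"
proof -
  interpret V: vectorspace class_ring V by (rule V)
  interpret S: submodule class_ring S V by (rule S)
  define r where "r v = (SOME u. u \<in> carrier V \<and> (\<exists>s\<in>S. v = u \<oplus>\<^bsub>V\<^esub> s))" for v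
  have SV: "s \<in> S \<Longrightarrow> s \<in> carrier V" for s using S.subset by auto
  have neg: "\<ominus>\<^bsub>V\<^esub> s \<in> S" if "s \<in> S" for s
  proof -
    have "(-1) \<odot>\<^bsub>V\<^esub> s \<in> S" using S.smult_closed[of "-1" s] that by simp
    moreover have "(-1) \<odot>\<^bsub>V\<^esub> s = \<ominus>\<^bsub>V\<^esub> s"
      using V.smult_minus_1[OF SV[OF that]] by (simp add: class_ring_simps)
    ultimately show ?thesis by simp
  qed
  have r: "r v \<in> carrier V \<and> (\<exists>s\<in>S. v = r v \<oplus>\<^bsub>V\<^esub> s)" if "v \<in> carrier V" for v
    unfolding r_def
    by (rule someI[of "\<lambda>u. u \<in> carrier V \<and> (\<exists>s\<in>S. v = u \<oplus>\<^bsub>V\<^esub> s)" v])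
       (use that in \<open>auto intro!: bexI[of _ "\<zero>\<^bsub>V\<^esub>"]\<close>)
  have r_cong: "r (v \<oplus>\<^bsub>V\<^esub> s) = r v" if "v \<in> carrier V" "s \<in> S" for v s
  proof -
    have "(\<exists>t\<in>S. v \<oplus>\<^bsub>V\<^esub> s = u \<oplus>\<^bsub>V\<^esub> t) \<longleftrightarrow> (\<exists>t\<in>S. v = u \<oplus>\<^bsub>V\<^esub> t)" if "u \<in> carrier V" for u
    proof safe
      fix t assume t: "t \<in> S" "v \<oplus>\<^bsub>V\<^esub> s = u \<oplus>\<^bsub>V\<^esub> t"
      have "v = (v \<oplus>\<^bsub>V\<^esub> s) \<oplus>\<^bsub>V\<^esub> \<ominus>\<^bsub>V\<^esub> s"
        using \<open>v \<in> carrier V\<close> SV[OF \<open>s \<in> S\<close>] by (simp add: V.a_assoc V.r_neg)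
      also have "\<dots> = u \<oplus>\<^bsub>V\<^esub> (t \<oplus>\<^bsub>V\<^esub> \<ominus>\<^bsub>V\<^esub> s)"
        using t that SV[OF t(1)] SV[OF \<open>s \<in> S\<close>] by (simp add: V.a_assoc)
      finally show "\<exists>t\<in>S. v = u \<oplus>\<^bsub>V\<^esub> t" using t neg[OF \<open>s \<in> S\<close>] by blast
    next
      fix t assume "t \<in> S" "v = u \<oplus>\<^bsub>V\<^esub> t"
      then show "\<exists>ta\<in>S. u \<oplus>\<^bsub>V\<^esub> t \<oplus>\<^bsub>V\<^esub> s = u \<oplus>\<^bsub>V\<^esub> ta"
        using that \<open>s \<in> S\<close> SV by (intro bexI[of _ "t \<oplus>\<^bsub>V\<^esub> s"]) (auto simp: V.a_assoc)
    qed
    then show ?thesis unfolding r_def by (intro arg_cong[of _ _ Eps] ext) auto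
  qed
  define Q :: "('k, 'v) module" where
    "Q = \<lparr>carrier = r ` carrier V, mult = undefined, one = undefined, zero = r \<zero>\<^bsub>V\<^esub>,
          add = (\<lambda>x y. r (x \<oplus>\<^bsub>V\<^esub> y)), smult = (\<lambda>c x. r (c \<odot>\<^bsub>V\<^esub> x))\<rparr>"
  have r_in: "v \<in> carrier V \<Longrightarrow> r v \<in> carrier V" for v using r by blast
  have r_add1: "r (r x \<oplus>\<^bsub>V\<^esub> y) = r (x \<oplus>\<^bsub>V\<^esub> y)" if "x \<in> carrier V" "y \<in> carrier V" for x y
  proof -
    from r[OF that(1)] obtain s where s: "s \<in> S" "x = r x \<oplus>\<^bsub>V\<^esub> s" by blast
    have "x \<oplus>\<^bsub>V\<^esub> y = (r x \<oplus>\<^bsub>V\<^esub> s) \<oplus>\<^bsub>V\<^esub> y" using s(2) by simp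
    also have "\<dots> = (r x \<oplus>\<^bsub>V\<^esub> y) \<oplus>\<^bsub>V\<^esub> s"
      using r_in[OF that(1)] that(2) SV[OF s(1)] by (simp add: V.a_ac)
    finally show ?thesis using r_cong[of "r x \<oplus>\<^bsub>V\<^esub> y" s] r_in[OF that(1)] that(2) s(1) by simp
  qed
  have r_add2: "r (x \<oplus>\<^bsub>V\<^esub> r y) = r (x \<oplus>\<^bsub>V\<^esub> y)" if "x \<in> carrier V" "y \<in> carrier V" for x y
    using r_add1[OF that(2) that(1)] that r_in by (simp add: V.a_comm)
  have r_smult: "r (c \<odot>\<^bsub>V\<^esub> r x) = r (c \<odot>\<^bsub>V\<^esub> x)" if "x \<in> carrier V" for c x
  proof -
    from r[OF that] obtain s where s: "s \<in> S" "x = r x \<oplus>\<^bsub>V\<^esub> s" by blast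
    have "c \<odot>\<^bsub>V\<^esub> x = c \<odot>\<^bsub>V\<^esub> (r x \<oplus>\<^bsub>V\<^esub> s)" using s(2) by simp
    also have "\<dots> = c \<odot>\<^bsub>V\<^esub> r x \<oplus>\<^bsub>V\<^esub> c \<odot>\<^bsub>V\<^esub> s"
      using r_in[OF that] SV[OF s(1)] by (simp add: V.smult_r_distr)
    finally show ?thesis using r_cong[of "c \<odot>\<^bsub>V\<^esub> r x" "c \<odot>\<^bsub>V\<^esub> s"] r_in[OF that] s(1)
      by (simp add: V.smult_closed)
  qed
  have r_idem: "r (r x) = r x" if "x \<in> carrier V" for x
    using r_add1[OF that, of "\<zero>\<^bsub>V\<^esub>"] that r_in by simp
  have smult_in: "c \<odot>\<^bsub>V\<^esub> x \<in> carrier V" if "x \<in> carrier V" for c x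
    using V.smult_closed that by simp
  have "abelian_group Q"
  proof (rule abelian_groupI)
    fix x assume "x \<in> carrier Q"
    then obtain v where v: "v \<in> carrier V" "x = r v" by (auto simp: Q_def)
    have "r (r (\<ominus>\<^bsub>V\<^esub> v) \<oplus>\<^bsub>V\<^esub> r v) = r \<zero>\<^bsub>V\<^esub>"
      using v by (simp add: r_add1 r_add2 r_in V.l_neg)
    then show "\<exists>y\<in>carrier Q. y \<oplus>\<^bsub>Q\<^esub> x = \<zero>\<^bsub>Q\<^esub>"
      using v by (intro bexI[of _ "r (\<ominus>\<^bsub>V\<^esub> v)"]) (simp_all add: Q_def)
  next
    fix x y z assume "x \<in> carrier Q" "y \<in> carrier Q" "z \<in> carrier Q"
    then obtain u v w where "u \<in> carrier V" "x = r u" "v \<in> carrier V" "y = r v"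
      "w \<in> carrier V" "z = r w" by (auto simp: Q_def)
    then show "x \<oplus>\<^bsub>Q\<^esub> y \<oplus>\<^bsub>Q\<^esub> z = x \<oplus>\<^bsub>Q\<^esub> (y \<oplus>\<^bsub>Q\<^esub> z)"
      by (simp add: Q_def r_add1 r_add2 r_in V.a_assoc)
  qed (auto simp: Q_def r_add1 r_add2 r_in r_idem V.a_comm)
  then have "vspace Q"
  proof (rule vspaceI)
    fix a b x assume "x \<in> carrier Q"
    then obtain v where v: "v \<in> carrier V" "x = r v" by (auto simp: Q_def)
    show "(a + b) \<odot>\<^bsub>Q\<^esub> x = a \<odot>\<^bsub>Q\<^esub> x \<oplus>\<^bsub>Q\<^esub> b \<odot>\<^bsub>Q\<^esub> x"
      using v V.smult_l_distr[of a b v]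
      by (simp add: Q_def r_add1 r_add2 r_in r_smult smult_in)
    show "(a * b) \<odot>\<^bsub>Q\<^esub> x = a \<odot>\<^bsub>Q\<^esub> (b \<odot>\<^bsub>Q\<^esub> x)"
      using v V.smult_assoc1[of a b v] by (simp add: Q_def r_in r_smult smult_in)
    show "1 \<odot>\<^bsub>Q\<^esub> x = x"
      using v V.smult_one[of v] by (simp add: Q_def r_smult)
  next
    fix a x y assume "x \<in> carrier Q" "y \<in> carrier Q"
    then obtain v w where v: "v \<in> carrier V" "x = r v" "w \<in> carrier V" "y = r w"
      by (auto simp: Q_def)
    show "a \<odot>\<^bsub>Q\<^esub> (x \<oplus>\<^bsub>Q\<^esub> y) = a \<odot>\<^bsub>Q\<^esub> x \<oplus>\<^bsub>Q\<^esub> a \<odot>\<^bsub>Q\<^esub> y"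
      using v V.smult_r_distr[of a v w]
      by (simp add: Q_def r_add1 r_add2 r_in r_smult smult_in)
  qed (auto simp: Q_def r_in smult_in)
  then have "vlin V Q r"
    using V by (auto simp: vlin_iff Q_def r_add1 r_add2 r_in r_smult)
  moreover have "v \<in> S" if v: "v \<in> carrier V" and "r v = \<zero>\<^bsub>Q\<^esub>" for v
  proof -
    have eq: "r v = r \<zero>\<^bsub>V\<^esub>" using that by (simp add: Q_def)
    obtain s where s: "s \<in> S" "v = r v \<oplus>\<^bsub>V\<^esub> s" using r[OF v] by blast
    obtain t where t: "t \<in> S" "\<zero>\<^bsub>V\<^esub> = r \<zero>\<^bsub>V\<^esub> \<oplus>\<^bsub>V\<^esub> t" using r[of "\<zero>\<^bsub>V\<^esub>"] by auto
    have "r \<zero>\<^bsub>V\<^esub> = \<ominus>\<^bsub>V\<^esub> t"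
      using t r_in[of "\<zero>\<^bsub>V\<^esub>"] SV[OF t(1)] V.minus_equality[of "r \<zero>\<^bsub>V\<^esub>" t] by simp
    then show ?thesis using s eq neg[OF t(1)] S.m_closed by metis
  qed
  moreover have "r v = \<zero>\<^bsub>Q\<^esub>" if "v \<in> S" for v
    using r_cong[of "\<zero>\<^bsub>V\<^esub>" v] that SV by (simp add: Q_def)
  ultimately show ?thesis by blast
qed

lemma vlinD:
  assumes "vlin V W f"
  shows "vspace V" "vspace W" "\<And>x. x \<in> carrier V \<Longrightarrow> f x \<in> carrier W"
    "\<And>x y. x \<in> carrier V \<Longrightarrow> y \<in> carrier V \<Longrightarrow> f (x \<oplus>\<^bsub>V\<^esub> y) = f x \<oplus>\<^bsub>W\<^esub> f y"
    "\<And>c x. x \<in> carrier V \<Longrightarrow> f (c \<odot>\<^bsub>V\<^esub> x) = c \<odot>\<^bsub>W\<^esub> f x"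
    "f \<zero>\<^bsub>V\<^esub> = \<zero>\<^bsub>W\<^esub>"
  using assms vlin_zero[OF assms] by (auto simp: vlin_iff)

lemma vspaceD:
  assumes "vspace V"
  shows "\<zero>\<^bsub>V\<^esub> \<in> carrier V" "\<And>x y. x \<in> carrier V \<Longrightarrow> y \<in> carrier V \<Longrightarrow> x \<oplus>\<^bsub>V\<^esub> y \<in> carrier V"
    "\<And>c x. x \<in> carrier V \<Longrightarrow> c \<odot>\<^bsub>V\<^esub> x \<in> carrier V"
proof -
  interpret vectorspace class_ring V by (rule assms)
  show "\<zero>\<^bsub>V\<^esub> \<in> carrier V" "\<And>x y. x \<in> carrier V \<Longrightarrow> y \<in> carrier V \<Longrightarrow> x \<oplus>\<^bsub>V\<^esub> y \<in> carrier V"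
    "\<And>c x. x \<in> carrier V \<Longrightarrow> c \<odot>\<^bsub>V\<^esub> x \<in> carrier V" by (auto intro: smult_closed)
qed

lemma subspaceI:
  fixes V :: "('k::field, 'v) module"
  assumes "vspace V" "S \<subseteq> carrier V" "\<zero>\<^bsub>V\<^esub> \<in> S"
    "\<And>x y. x \<in> S \<Longrightarrow> y \<in> S \<Longrightarrow> x \<oplus>\<^bsub>V\<^esub> y \<in> S" "\<And>c x. x \<in> S \<Longrightarrow> c \<odot>\<^bsub>V\<^esub> x \<in> S"
  shows "submodule (class_ring :: 'k ring) S V"
  using assms by (auto simp: vectorspace_def intro!: submodule.intro)

lemma pullback_square_elementwise:
  fixes A :: "('k::field, 'v) module"
  assumes "pullback_square TYPE('v \<times> 'v) A B C D f g h k"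
    and b: "b \<in> carrier B" and c: "c \<in> carrier C" and eq: "h b = k c"
  shows "\<exists>!a. a \<in> carrier A \<and> f a = b \<and> g a = c"
proof -
  have sq: "vlin A B f" "vlin A C g" "vlin B D h" "vlin C D k"
    and univ: "\<And>(W :: ('k, 'v \<times> 'v) module) p q. vlin W B p \<Longrightarrow> vlin W C q \<Longrightarrow>
       \<forall>w\<in>carrier W. h (p w) = k (q w) \<Longrightarrow>
       (\<exists>!u. u \<in> extensional (carrier W) \<and> vlin W A u \<and>
             (\<forall>w\<in>carrier W. f (u w) = p w \<and> g (u w) = q w))"
    and comm: "\<And>a. a \<in> carrier A \<Longrightarrow> h (f a) = k (g a)"
    using assms(1) unfolding pullback_square_def comm_square_def by blast+
  note lins = vlinD[OF sq(1)] vlinD[OF sq(2)] vlinD[OF sq(3)] vlinD[OF sq(4)]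
  note vs = vspaceD[OF lins(1)] vspaceD[OF lins(2)] vspaceD[OF lins(8)]
  define X where "X = {(b, c). b \<in> carrier B \<and> c \<in> carrier C \<and> h b = k c}"
  let ?X = "(direct_sum B C)\<lparr>carrier := X\<rparr>"
  have "submodule class_ring X (direct_sum B C)"
    by (rule subspaceI)
       (use lins vs in \<open>auto simp: X_def direct_sum_def vspace_direct_sum[unfolded direct_sum_def]\<close>)
  then have X: "vspace ?X" using lins by (blast intro: vspace_submodule vspace_direct_sum)
  have "vlin ?X B fst" "vlin ?X C snd"
    using lins X by (auto simp: vlin_iff X_def direct_sum_def)
  from univ[OF this] obtain u
    where u: "vlin ?X A u" "\<forall>w\<in>X. f (u w) = fst w \<and> g (u w) = snd w"
    by (auto simp: X_def)
  have "(b, c) \<in> X" using b c eq by (simp add: X_def)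
  with u(2) vlinD(3)[OF u(1), of "(b, c)"]
  have ex: "u (b, c) \<in> carrier A \<and> f (u (b, c)) = b \<and> g (u (b, c)) = c" by auto
  define Y where "Y = {(a, a'). a \<in> carrier A \<and> a' \<in> carrier A \<and> f a = f a' \<and> g a = g a'}"
  let ?Y = "(direct_sum A A)\<lparr>carrier := Y\<rparr>"
  have "submodule class_ring Y (direct_sum A A)"
    by (rule subspaceI)
       (use lins vs in \<open>auto simp: Y_def direct_sum_def vspace_direct_sum[unfolded direct_sum_def]\<close>)
  then have Y: "vspace ?Y" using lins by (blast intro: vspace_submodule vspace_direct_sum)
  have "vlin ?Y B (\<lambda>w. f (fst w))" "vlin ?Y C (\<lambda>w. g (fst w))"
    using lins Y by (auto simp: vlin_iff Y_def direct_sum_def)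
  from univ[OF this] comm have uniq: "u = u'"
    if "u \<in> extensional Y" "vlin ?Y A u" "\<forall>w\<in>Y. f (u w) = f (fst w) \<and> g (u w) = g (fst w)"
       "u' \<in> extensional Y" "vlin ?Y A u'" "\<forall>w\<in>Y. f (u' w) = f (fst w) \<and> g (u' w) = g (fst w)"
    for u u' using that by (auto simp: Y_def)
  have lin1: "vlin ?Y A (restrict fst Y)" "vlin ?Y A (restrict snd Y)"
    using lins vs Y by (auto simp: vlin_iff Y_def direct_sum_def)
  have "restrict fst Y = restrict snd Y"
    by (rule uniq) (use lin1 in \<open>auto simp: Y_def\<close>)
  then have inj: "a = a'" if "(a, a') \<in> Y" for a a'
    using that by (auto dest: fun_cong[of _ _ "(a, a')"])
  show ?thesis
  proof (rule ex1I[of _ "u (b, c)"])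
    fix a assume "a \<in> carrier A \<and> f a = b \<and> g a = c"
    then show "a = u (b, c)" by (intro inj) (simp add: Y_def ex)
  qed (rule ex)
qed

lemma pullback_square_univ:
  fixes A :: "('k::field, 'v) module"
  assumes PB: "pullback_square TYPE('v \<times> 'v) A B C D f g h k"
  shows "pullback_square TYPE('w) A B C D f g h k"
  unfolding pullback_square_def
proof (intro conjI allI impI)
  show sq: "comm_square A B C D f g h k" using PB by (simp add: pullback_square_def)
  fix W :: "('k, 'w) module" and p q
  assume pq: "vlin W B p \<and> vlin W C q \<and> (\<forall>w\<in>carrier W. h (p w) = k (q w))"
  have sq': "vlin A B f" "vlin A C g" using sq by (auto simp: comm_square_def)
  note lins = vlinD[OF sq'(1)] vlinD[OF sq'(2)] vlinD[OF pq[THEN conjunct1]]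
    vlinD[OF pq[THEN conjunct2, THEN conjunct1]]
  define P where "P w a \<longleftrightarrow> a \<in> carrier A \<and> f a = p w \<and> g a = q w" for w a
  have ex1: "\<exists>!a. P w a" if "w \<in> carrier W" for w
    unfolding P_def
    by (rule pullback_square_elementwise[OF PB]) (use lins(15,21)[OF that] pq that in auto)
  define u where "u = (\<lambda>w\<in>carrier W. THE a. P w a)"
  have u: "P w (u w)" if "w \<in> carrier W" for w
    using theI'[OF ex1[OF that]] that by (simp add: u_def)
  have u_eq: "u w = a" if "w \<in> carrier W" "P w a" for w a
    using ex1[OF that(1)] u[OF that(1)] that(2) by blast
  have lin: "vlin W A u"
    unfolding vlin_iff
  proof (intro conjI ballI allI)
    show "vspace W" "vspace A" using lins by blast+
    show "u \<in> carrier W \<rightarrow> carrier A" using u by (auto simp: P_def)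
  next
    fix x y assume "x \<in> carrier W" "y \<in> carrier W"
    then show "u (x \<oplus>\<^bsub>W\<^esub> y) = u x \<oplus>\<^bsub>A\<^esub> u y"
      using u[of x] u[of y] lins vspaceD[OF lins(1)] vspaceD[OF lins(13)]
      by (intro u_eq) (auto simp: P_def)
  next
    fix c x assume "x \<in> carrier W"
    then show "u (c \<odot>\<^bsub>W\<^esub> x) = c \<odot>\<^bsub>A\<^esub> u x"
      using u[of x] lins vspaceD[OF lins(1)] vspaceD[OF lins(13)]
      by (intro u_eq) (auto simp: P_def)
  qed
  show "\<exists>!u. u \<in> extensional (carrier W) \<and> vlin W A u \<and>
          (\<forall>w\<in>carrier W. f (u w) = p w \<and> g (u w) = q w)"
  proof (rule ex1I[of _ u])
    show "u \<in> extensional (carrier W) \<and> vlin W A u \<and>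
          (\<forall>w\<in>carrier W. f (u w) = p w \<and> g (u w) = q w)"
      using lin u by (auto simp: P_def u_def)
  next
    fix u' assume u': "u' \<in> extensional (carrier W) \<and> vlin W A u' \<and>
          (\<forall>w\<in>carrier W. f (u' w) = p w \<and> g (u' w) = q w)"
    show "u' = u"
    proof (rule extensionalityI[of _ "carrier W"])
      fix w assume "w \<in> carrier W"
      then show "u' w = u w" using u' by (intro u_eq[symmetric]) (auto simp: P_def vlin_iff)
    qed (use u' in \<open>auto simp: u_def\<close>)
  qed
qed

lemma pushout_square_elementwise:
  fixes A :: "('k::field, 'v) module"
  assumes "pushout_square TYPE('v \<times> 'v) A B C D f g h k"
  shows "\<And>d. d \<in> carrier D \<Longrightarrow> \<exists>b\<in>carrier B. \<exists>c\<in>carrier C. d = h b \<oplus>\<^bsub>D\<^esub> k c"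
    and "\<And>b c. b \<in> carrier B \<Longrightarrow> c \<in> carrier C \<Longrightarrow> h b \<oplus>\<^bsub>D\<^esub> k c = \<zero>\<^bsub>D\<^esub> \<Longrightarrow>
           \<exists>a\<in>carrier A. b = f a \<and> c = (-1) \<odot>\<^bsub>C\<^esub> g a"
proof -
  have sq: "vlin A B f" "vlin A C g" "vlin B D h" "vlin C D k"
    and univ: "\<And>(W :: ('k, 'v \<times> 'v) module) p q. vlin B W p \<Longrightarrow> vlin C W q \<Longrightarrow>
       \<forall>a\<in>carrier A. p (f a) = q (g a) \<Longrightarrow>
       (\<exists>!u. u \<in> extensional (carrier D) \<and> vlin D W u \<and>
             (\<forall>b\<in>carrier B. u (h b) = p b) \<and> (\<forall>c\<in>carrier C. u (k c) = q c))"
    and comm: "\<And>a. a \<in> carrier A \<Longrightarrow> h (f a) = k (g a)"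
    using assms(1) unfolding pushout_square_def comm_square_def by blast+
  note lins = vlinD[OF sq(1)] vlinD[OF sq(2)] vlinD[OF sq(3)] vlinD[OF sq(4)]
  note vs = vspaceD[OF lins(1)] vspaceD[OF lins(2)] vspaceD[OF lins(8)] vspaceD[OF lins(14)]
  interpret A: vectorspace class_ring A by (rule lins)
  interpret B: vectorspace class_ring B by (rule lins)
  interpret C: vectorspace class_ring C by (rule lins)
  interpret D: vectorspace class_ring D by (rule lins)
  have neg: "(-1) \<odot>\<^bsub>C\<^esub> c = \<ominus>\<^bsub>C\<^esub> c" if "c \<in> carrier C" for c
    using C.smult_minus_1[OF that] by (simp add: class_ring_simps)
  {
    fix d assume d: "d \<in> carrier D"
    define M where "M = {m. \<exists>b\<in>carrier B. \<exists>c\<in>carrier C. m = h b \<oplus>\<^bsub>D\<^esub> k c}"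
    have MD: "M \<subseteq> carrier D" using lins vs by (auto simp: M_def)
    have M0: "\<zero>\<^bsub>D\<^esub> \<in> M" 
    proof -
      have "\<zero>\<^bsub>D\<^esub> = h \<zero>\<^bsub>B\<^esub> \<oplus>\<^bsub>D\<^esub> k \<zero>\<^bsub>C\<^esub>" using lins(18,24) by simp
      then show ?thesis using vs(4,7) unfolding M_def by blast
    qed
    have M1: "x \<oplus>\<^bsub>D\<^esub> y \<in> M" if "x \<in> M" "y \<in> M" for x y
    proof -
      from that obtain b c b' c' where *: "b \<in> carrier B" "c \<in> carrier C" "x = h b \<oplus>\<^bsub>D\<^esub> k c"
        "b' \<in> carrier B" "c' \<in> carrier C" "y = h b' \<oplus>\<^bsub>D\<^esub> k c'" by (auto simp: M_def)
      then have "x \<oplus>\<^bsub>D\<^esub> y = h (b \<oplus>\<^bsub>B\<^esub> b') \<oplus>\<^bsub>D\<^esub> k (c \<oplus>\<^bsub>C\<^esub> c')"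
        using lins by (simp add: D.a_ac)
      then show ?thesis using * vs(5,8) unfolding M_def by blast
    qed
    have M2: "c \<odot>\<^bsub>D\<^esub> x \<in> M" if "x \<in> M" for c x
    proof -
      from that obtain b c' where *: "b \<in> carrier B" "c' \<in> carrier C" "x = h b \<oplus>\<^bsub>D\<^esub> k c'"
        by (auto simp: M_def)
      then have "c \<odot>\<^bsub>D\<^esub> x = h (c \<odot>\<^bsub>B\<^esub> b) \<oplus>\<^bsub>D\<^esub> k (c \<odot>\<^bsub>C\<^esub> c')"
        using lins by (simp add: D.smult_r_distr)
      then show ?thesis using * vs(6,9) unfolding M_def by blast
    qed
    have sub: "submodule class_ring (M \<times> carrier D) (direct_sum D D)"
      by (rule subspaceI)
         (use vspace_direct_sum[OF lins(14) lins(14)] vs(10-12) MD M0 M1 M2 in \<open>auto simp: direct_sum_def\<close>)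
    obtain Q :: "('k, 'v \<times> 'v) module" and r
      where Q: "vlin (direct_sum D D) Q r"
        "\<forall>v\<in>carrier (direct_sum D D). r v = \<zero>\<^bsub>Q\<^esub> \<longrightarrow> v \<in> M \<times> carrier D"
        "\<forall>v\<in>M \<times> carrier D. r v = \<zero>\<^bsub>Q\<^esub>"
      using vspace_quotient[OF vspace_direct_sum[OF lins(14) lins(14)] sub] by blast
    note Ql = vlinD[OF Q(1)] and Qv = vspaceD[OF vlinD(2)[OF Q(1)]]
    interpret Q: vectorspace class_ring Q by (rule Ql(2))
    have z0: "vlin V Q (\<lambda>x. \<zero>\<^bsub>Q\<^esub>)" if "vspace V" for V :: "('k, 'v) module"
      using that Ql(2) Qv Q.smult_r_null by (auto simp: vlin_iff)
    have r_lin: "vlin D Q (\<lambda>d. r (d, \<zero>\<^bsub>D\<^esub>))"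
      unfolding vlin_iff
    proof (intro conjI ballI allI)
      fix x y assume "x \<in> carrier D" "y \<in> carrier D"
      then show "r (x \<oplus>\<^bsub>D\<^esub> y, \<zero>\<^bsub>D\<^esub>) = r (x, \<zero>\<^bsub>D\<^esub>) \<oplus>\<^bsub>Q\<^esub> r (y, \<zero>\<^bsub>D\<^esub>)"
        using Ql(4)[of "(x, \<zero>\<^bsub>D\<^esub>)" "(y, \<zero>\<^bsub>D\<^esub>)"] by (simp add: direct_sum_def)
    next
      fix c x assume "x \<in> carrier D"
      then show "r (c \<odot>\<^bsub>D\<^esub> x, \<zero>\<^bsub>D\<^esub>) = c \<odot>\<^bsub>Q\<^esub> r (x, \<zero>\<^bsub>D\<^esub>)"
        using Ql(5)[of "(x, \<zero>\<^bsub>D\<^esub>)" c] D.smult_r_null[of c] by (simp add: direct_sum_def)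
    qed (use lins Ql in \<open>auto simp: direct_sum_def\<close>)
    from univ[OF z0[OF lins(13)] z0[OF lins(8)]]
    have uniq: "u = u'"
      if "u \<in> extensional (carrier D)" "vlin D Q u" "\<forall>b\<in>carrier B. u (h b) = \<zero>\<^bsub>Q\<^esub>"
         "\<forall>c\<in>carrier C. u (k c) = \<zero>\<^bsub>Q\<^esub>"
         "u' \<in> extensional (carrier D)" "vlin D Q u'" "\<forall>b\<in>carrier B. u' (h b) = \<zero>\<^bsub>Q\<^esub>"
         "\<forall>c\<in>carrier C. u' (k c) = \<zero>\<^bsub>Q\<^esub>" for u u'
      using that by blast
    have restr: "vlin D Q (restrict u (carrier D))" if "vlin D Q u" for u
      using that vs by (auto simp: vlin_iff)
    have inM: "h b \<in> M" if "b \<in> carrier B" for b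
    proof -
      have "h b = h b \<oplus>\<^bsub>D\<^esub> k \<zero>\<^bsub>C\<^esub>" using that lins(15,24) by simp
      then show ?thesis using that vs(7) unfolding M_def by blast
    qed
    have inM': "k c \<in> M" if "c \<in> carrier C" for c
    proof -
      have "k c = h \<zero>\<^bsub>B\<^esub> \<oplus>\<^bsub>D\<^esub> k c" using that lins(18,21) by simp
      then show ?thesis using that vs(4) unfolding M_def by blast
    qed
    have "restrict (\<lambda>d. r (d, \<zero>\<^bsub>D\<^esub>)) (carrier D) = restrict (\<lambda>x. \<zero>\<^bsub>Q\<^esub>) (carrier D)"
      by (rule uniq) (use restr[OF r_lin] restr[OF z0[OF lins(14)]] lins(15,21) vs(10) inM inM' Q(3) in auto)
    from fun_cong[OF this, of d] have "r (d, \<zero>\<^bsub>D\<^esub>) = \<zero>\<^bsub>Q\<^esub>" using d by simp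
    then have "d \<in> M" using Q(2) d vs(10) by (auto simp: direct_sum_def)
    then show "\<exists>b\<in>carrier B. \<exists>c\<in>carrier C. d = h b \<oplus>\<^bsub>D\<^esub> k c" by (simp add: M_def)
  next
    fix b c assume b: "b \<in> carrier B" and c: "c \<in> carrier C" and bc: "h b \<oplus>\<^bsub>D\<^esub> k c = \<zero>\<^bsub>D\<^esub>"
    define S where "S = (\<lambda>a. (f a, (-1) \<odot>\<^bsub>C\<^esub> g a)) ` carrier A"
    have sub: "submodule class_ring S (direct_sum B C)"
    proof (rule subspaceI)
      show "vspace (direct_sum B C)" by (rule vspace_direct_sum[OF lins(2) lins(8)])
      show "S \<subseteq> carrier (direct_sum B C)" using lins vs by (auto simp: S_def direct_sum_def)
      have "(f \<zero>\<^bsub>A\<^esub>, (-1) \<odot>\<^bsub>C\<^esub> g \<zero>\<^bsub>A\<^esub>) = \<zero>\<^bsub>direct_sum B C\<^esub>"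
        using lins(6,12) C.smult_r_null[of "-1"] by (simp add: direct_sum_def)
      then show "\<zero>\<^bsub>direct_sum B C\<^esub> \<in> S" unfolding S_def by (intro image_eqI[OF _ vs(1)]) simp
    next
      fix x y assume "x \<in> S" "y \<in> S"
      then obtain a a' where *: "a \<in> carrier A" "x = (f a, (-1) \<odot>\<^bsub>C\<^esub> g a)"
        "a' \<in> carrier A" "y = (f a', (-1) \<odot>\<^bsub>C\<^esub> g a')" by (auto simp: S_def)
      then have "x \<oplus>\<^bsub>direct_sum B C\<^esub> y = (f (a \<oplus>\<^bsub>A\<^esub> a'), (-1) \<odot>\<^bsub>C\<^esub> g (a \<oplus>\<^bsub>A\<^esub> a'))"
        using lins C.smult_r_distr[of "-1" "g a" "g a'"] by (simp add: direct_sum_def)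
      then show "x \<oplus>\<^bsub>direct_sum B C\<^esub> y \<in> S" unfolding S_def by (intro image_eqI[OF _ vs(2)[OF *(1) *(3)]]) simp
    next
      fix e x assume "x \<in> S"
      then obtain a where *: "a \<in> carrier A" "x = (f a, (-1) \<odot>\<^bsub>C\<^esub> g a)" by (auto simp: S_def)
      then have "e \<odot>\<^bsub>direct_sum B C\<^esub> x = (f (e \<odot>\<^bsub>A\<^esub> a), (-1) \<odot>\<^bsub>C\<^esub> g (e \<odot>\<^bsub>A\<^esub> a))"
        using lins C.smult_assoc1[of e "-1" "g a"] C.smult_assoc1[of "-1" e "g a"]
        by (simp add: direct_sum_def)
      then show "e \<odot>\<^bsub>direct_sum B C\<^esub> x \<in> S" unfolding S_def by (intro image_eqI[OF _ vs(3)[OF *(1)]]) simp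
    qed
    obtain Q :: "('k, 'v \<times> 'v) module" and r
      where Q: "vlin (direct_sum B C) Q r"
        "\<forall>v\<in>carrier (direct_sum B C). r v = \<zero>\<^bsub>Q\<^esub> \<longrightarrow> v \<in> S" "\<forall>v\<in>S. r v = \<zero>\<^bsub>Q\<^esub>"
      using vspace_quotient[OF vspace_direct_sum[OF lins(2) lins(8)] sub] by blast
    note Ql = vlinD[OF Q(1)] and Qv = vspaceD[OF vlinD(2)[OF Q(1)]]
    interpret Q: vectorspace class_ring Q by (rule Ql(2))
    have r_add: "r (b \<oplus>\<^bsub>B\<^esub> b', c \<oplus>\<^bsub>C\<^esub> c') = r (b, c) \<oplus>\<^bsub>Q\<^esub> r (b', c')"
      if "b \<in> carrier B" "c \<in> carrier C" "b' \<in> carrier B" "c' \<in> carrier C" for b c b' c'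
      using Ql(4)[of "(b, c)" "(b', c')"] that by (simp add: direct_sum_def)
    have r_smult: "r (e \<odot>\<^bsub>B\<^esub> b, e \<odot>\<^bsub>C\<^esub> c) = e \<odot>\<^bsub>Q\<^esub> r (b, c)"
      if "b \<in> carrier B" "c \<in> carrier C" for e b c
      using Ql(5)[of "(b, c)" e] that by (simp add: direct_sum_def)
    have r_in: "r (b, c) \<in> carrier Q" if "b \<in> carrier B" "c \<in> carrier C" for b c
      using Ql(3)[of "(b, c)"] that by (simp add: direct_sum_def)
    have p: "vlin B Q (\<lambda>b. r (b, \<zero>\<^bsub>C\<^esub>))"
      unfolding vlin_iff
    proof (intro conjI ballI allI)
      fix x y assume "x \<in> carrier B" "y \<in> carrier B"
      then show "r (x \<oplus>\<^bsub>B\<^esub> y, \<zero>\<^bsub>C\<^esub>) = r (x, \<zero>\<^bsub>C\<^esub>) \<oplus>\<^bsub>Q\<^esub> r (y, \<zero>\<^bsub>C\<^esub>)"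
        using r_add[of x "\<zero>\<^bsub>C\<^esub>" y "\<zero>\<^bsub>C\<^esub>"] by simp
    next
      fix e x assume "x \<in> carrier B"
      then show "r (e \<odot>\<^bsub>B\<^esub> x, \<zero>\<^bsub>C\<^esub>) = e \<odot>\<^bsub>Q\<^esub> r (x, \<zero>\<^bsub>C\<^esub>)"
        using r_smult[of x "\<zero>\<^bsub>C\<^esub>" e] C.smult_r_null[of e] by simp
    qed (use lins vs Ql r_in in auto)
    have q: "vlin C Q (\<lambda>c. r (\<zero>\<^bsub>B\<^esub>, c))"
      unfolding vlin_iff
    proof (intro conjI ballI allI)
      fix x y assume "x \<in> carrier C" "y \<in> carrier C"
      then show "r (\<zero>\<^bsub>B\<^esub>, x \<oplus>\<^bsub>C\<^esub> y) = r (\<zero>\<^bsub>B\<^esub>, x) \<oplus>\<^bsub>Q\<^esub> r (\<zero>\<^bsub>B\<^esub>, y)"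
        using r_add[of "\<zero>\<^bsub>B\<^esub>" x "\<zero>\<^bsub>B\<^esub>" y] by simp
    next
      fix e x assume "x \<in> carrier C"
      then show "r (\<zero>\<^bsub>B\<^esub>, e \<odot>\<^bsub>C\<^esub> x) = e \<odot>\<^bsub>Q\<^esub> r (\<zero>\<^bsub>B\<^esub>, x)"
        using r_smult[of "\<zero>\<^bsub>B\<^esub>" x e] B.smult_r_null[of e] by simp
    qed (use lins vs Ql r_in in auto)
    have "r (f a, \<zero>\<^bsub>C\<^esub>) = r (\<zero>\<^bsub>B\<^esub>, g a)" if a: "a \<in> carrier A" for a
    proof -
      have "r (f a, (-1) \<odot>\<^bsub>C\<^esub> g a) = \<zero>\<^bsub>Q\<^esub>" using Q(3) a by (auto simp: S_def)
      then have "r (\<zero>\<^bsub>B\<^esub>, g a) = r (f a, (-1) \<odot>\<^bsub>C\<^esub> g a) \<oplus>\<^bsub>Q\<^esub> r (\<zero>\<^bsub>B\<^esub>, g a)"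
        using r_in lins vs a by simp
      also have "\<dots> = r (f a \<oplus>\<^bsub>B\<^esub> \<zero>\<^bsub>B\<^esub>, (-1) \<odot>\<^bsub>C\<^esub> g a \<oplus>\<^bsub>C\<^esub> g a)"
        using r_add[of "f a" "(-1) \<odot>\<^bsub>C\<^esub> g a" "\<zero>\<^bsub>B\<^esub>" "g a"] lins vs a by simp
      also have "\<dots> = r (f a, \<zero>\<^bsub>C\<^esub>)" using neg[of "g a"] lins a by (simp add: C.l_neg)
      finally show ?thesis by simp
    qed
    with univ[OF p q] obtain u where u: "vlin D Q u"
      "\<forall>b\<in>carrier B. u (h b) = r (b, \<zero>\<^bsub>C\<^esub>)" "\<forall>c\<in>carrier C. u (k c) = r (\<zero>\<^bsub>B\<^esub>, c)" by blast
    have "\<zero>\<^bsub>Q\<^esub> = u (h b \<oplus>\<^bsub>D\<^esub> k c)" using bc vlinD(6)[OF u(1)] by simp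
    also have "\<dots> = r (b, \<zero>\<^bsub>C\<^esub>) \<oplus>\<^bsub>Q\<^esub> r (\<zero>\<^bsub>B\<^esub>, c)" using vlinD(4)[OF u(1)] u lins b c by simp
    also have "\<dots> = r (b, c)" using r_add[of b "\<zero>\<^bsub>C\<^esub>" "\<zero>\<^bsub>B\<^esub>" c] b c by simp
    finally have "(b, c) \<in> S" using Q(2) b c by (auto simp: direct_sum_def)
    then show "\<exists>a\<in>carrier A. b = f a \<and> c = (-1) \<odot>\<^bsub>C\<^esub> g a" by (auto simp: S_def)
  }
qed

lemma pushout_square_univ:
  fixes A :: "('k::field, 'v) module"
  assumes PO: "pushout_square TYPE('v \<times> 'v) A B C D f g h k"
  shows "pushout_square TYPE('w) A B C D f g h k"
  unfolding pushout_square_def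
proof (intro conjI allI impI)
  show sq: "comm_square A B C D f g h k" using PO by (simp add: pushout_square_def)
  fix W :: "('k, 'w) module" and p q
  assume pq: "vlin B W p \<and> vlin C W q \<and> (\<forall>a\<in>carrier A. p (f a) = q (g a))"
  have sq': "vlin A B f" "vlin A C g" "vlin B D h" "vlin C D k"
    using sq by (auto simp: comm_square_def)
  note lins = vlinD[OF sq'(1)] vlinD[OF sq'(2)] vlinD[OF sq'(3)] vlinD[OF sq'(4)]
    vlinD[OF pq[THEN conjunct1]] vlinD[OF pq[THEN conjunct2, THEN conjunct1]]
  note vs = vspaceD[OF lins(1)] vspaceD[OF lins(2)] vspaceD[OF lins(8)] vspaceD[OF lins(14)]
    vspaceD[OF lins(26)]
  interpret B: vectorspace class_ring B by (rule lins)
  interpret C: vectorspace class_ring C by (rule lins)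
  interpret D: vectorspace class_ring D by (rule lins)
  interpret W: vectorspace class_ring W by (rule lins)
  have neg: "(-1) \<odot>\<^bsub>B\<^esub> x = \<ominus>\<^bsub>B\<^esub> x" if "x \<in> carrier B" for x
    using B.smult_minus_1[OF that] by (simp add: class_ring_simps)
  have negC: "(-1) \<odot>\<^bsub>C\<^esub> x = \<ominus>\<^bsub>C\<^esub> x" if "x \<in> carrier C" for x
    using C.smult_minus_1[OF that] by (simp add: class_ring_simps)
  have negD: "(-1) \<odot>\<^bsub>D\<^esub> x = \<ominus>\<^bsub>D\<^esub> x" if "x \<in> carrier D" for x
    using D.smult_minus_1[OF that] by (simp add: class_ring_simps)
  have negW: "(-1) \<odot>\<^bsub>W\<^esub> x = \<ominus>\<^bsub>W\<^esub> x" if "x \<in> carrier W" for x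
    using W.smult_minus_1[OF that] by (simp add: class_ring_simps)
  have lin_combo: "p b \<oplus>\<^bsub>W\<^esub> q c = p b' \<oplus>\<^bsub>W\<^esub> q c'"
    if bc: "b \<in> carrier B" "c \<in> carrier C" "b' \<in> carrier B" "c' \<in> carrier C"
      and eq: "h b \<oplus>\<^bsub>D\<^esub> k c = h b' \<oplus>\<^bsub>D\<^esub> k c'" for b c b' c'
  proof -
    let ?b = "b \<oplus>\<^bsub>B\<^esub> (-1) \<odot>\<^bsub>B\<^esub> b'" and ?c = "c \<oplus>\<^bsub>C\<^esub> (-1) \<odot>\<^bsub>C\<^esub> c'"
    have hb: "h ?b = h b \<oplus>\<^bsub>D\<^esub> \<ominus>\<^bsub>D\<^esub> h b'" "k ?c = k c \<oplus>\<^bsub>D\<^esub> \<ominus>\<^bsub>D\<^esub> k c'"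
      "p ?b = p b \<oplus>\<^bsub>W\<^esub> \<ominus>\<^bsub>W\<^esub> p b'" "q ?c = q c \<oplus>\<^bsub>W\<^esub> \<ominus>\<^bsub>W\<^esub> q c'"
      using bc lins vs by (simp_all add: negD negW)
    have "h ?b \<oplus>\<^bsub>D\<^esub> k ?c = (h b \<oplus>\<^bsub>D\<^esub> k c) \<oplus>\<^bsub>D\<^esub> \<ominus>\<^bsub>D\<^esub> (h b' \<oplus>\<^bsub>D\<^esub> k c')"
      using bc lins by (simp add: hb D.a_ac D.minus_add)
    also have "\<dots> = \<zero>\<^bsub>D\<^esub>" using bc lins by (simp add: eq D.r_neg)
    finally have "h ?b \<oplus>\<^bsub>D\<^esub> k ?c = \<zero>\<^bsub>D\<^esub>" .
    with pushout_square_elementwise(2)[OF PO, of ?b ?c] bc vs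
    obtain a where a: "a \<in> carrier A" "?b = f a" "?c = (-1) \<odot>\<^bsub>C\<^esub> g a" by auto
    have "p ?b \<oplus>\<^bsub>W\<^esub> q ?c = p (f a) \<oplus>\<^bsub>W\<^esub> \<ominus>\<^bsub>W\<^esub> q (g a)"
      unfolding a using a(1) lins by (simp add: negW)
    also have "\<dots> = \<zero>\<^bsub>W\<^esub>" using pq a lins by (simp add: W.r_neg)
    finally have "(p b \<oplus>\<^bsub>W\<^esub> q c) \<oplus>\<^bsub>W\<^esub> \<ominus>\<^bsub>W\<^esub> (p b' \<oplus>\<^bsub>W\<^esub> q c') = \<zero>\<^bsub>W\<^esub>"
      using bc lins by (simp add: hb W.a_ac W.minus_add)
    from W.minus_equality[OF this] show ?thesis using bc lins(27,33) by simp
  qed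
  define P where "P d w \<longleftrightarrow> (\<exists>b\<in>carrier B. \<exists>c\<in>carrier C. d = h b \<oplus>\<^bsub>D\<^esub> k c \<and> w = p b \<oplus>\<^bsub>W\<^esub> q c)"
    for d w
  have ex1: "\<exists>!w. P d w" if "d \<in> carrier D" for d
  proof (rule ex_ex1I)
    show "\<exists>w. P d w" using pushout_square_elementwise(1)[OF PO that] unfolding P_def by blast
    show "w = w'" if "P d w" "P d w'" for w w'
      using that unfolding P_def by (auto intro: lin_combo)
  qed
  define u where "u = (\<lambda>d\<in>carrier D. THE w. P d w)"
  have u: "P d (u d)" if "d \<in> carrier D" for d
    using theI'[OF ex1[OF that]] that by (simp add: u_def)
  have u_eq: "u (h b \<oplus>\<^bsub>D\<^esub> k c) = p b \<oplus>\<^bsub>W\<^esub> q c" if "b \<in> carrier B" "c \<in> carrier C" for b c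
  proof -
    have d: "h b \<oplus>\<^bsub>D\<^esub> k c \<in> carrier D" using that lins(15,21) by simp
    moreover have "P (h b \<oplus>\<^bsub>D\<^esub> k c) (p b \<oplus>\<^bsub>W\<^esub> q c)" using that unfolding P_def by blast
    ultimately show ?thesis using ex1[OF d] u[OF d] by blast
  qed
  have ex: "\<exists>b\<in>carrier B. \<exists>c\<in>carrier C. d = h b \<oplus>\<^bsub>D\<^esub> k c \<and> u d = p b \<oplus>\<^bsub>W\<^esub> q c"
    if "d \<in> carrier D" for d using u[OF that] by (auto simp: P_def)
  have lin: "vlin D W u"
    unfolding vlin_iff
  proof (intro conjI ballI allI)
    show "vspace D" "vspace W" by (rule lins)+
    show "u \<in> carrier D \<rightarrow> carrier W" 
    proof
      fix d assume "d \<in> carrier D"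
      then show "u d \<in> carrier W" using ex[of d] lins(27,33) by auto
    qed
  next
    fix x y assume "x \<in> carrier D" "y \<in> carrier D"
    then obtain b c b' c' where *: "b \<in> carrier B" "c \<in> carrier C" "x = h b \<oplus>\<^bsub>D\<^esub> k c"
      "u x = p b \<oplus>\<^bsub>W\<^esub> q c" "b' \<in> carrier B" "c' \<in> carrier C" "y = h b' \<oplus>\<^bsub>D\<^esub> k c'"
      "u y = p b' \<oplus>\<^bsub>W\<^esub> q c'" using ex by metis
    have "x \<oplus>\<^bsub>D\<^esub> y = h (b \<oplus>\<^bsub>B\<^esub> b') \<oplus>\<^bsub>D\<^esub> k (c \<oplus>\<^bsub>C\<^esub> c')" using * lins by (simp add: D.a_ac)
    then have "u (x \<oplus>\<^bsub>D\<^esub> y) = p (b \<oplus>\<^bsub>B\<^esub> b') \<oplus>\<^bsub>W\<^esub> q (c \<oplus>\<^bsub>C\<^esub> c')" using * vs u_eq by simp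
    also have "\<dots> = u x \<oplus>\<^bsub>W\<^esub> u y" using * lins by (simp add: W.a_ac)
    finally show "u (x \<oplus>\<^bsub>D\<^esub> y) = u x \<oplus>\<^bsub>W\<^esub> u y" .
  next
    fix e x assume "x \<in> carrier D"
    then obtain b c where *: "b \<in> carrier B" "c \<in> carrier C" "x = h b \<oplus>\<^bsub>D\<^esub> k c"
      "u x = p b \<oplus>\<^bsub>W\<^esub> q c" using ex by metis
    have "e \<odot>\<^bsub>D\<^esub> x = h (e \<odot>\<^bsub>B\<^esub> b) \<oplus>\<^bsub>D\<^esub> k (e \<odot>\<^bsub>C\<^esub> c)" using * lins by (simp add: D.smult_r_distr)
    then have "u (e \<odot>\<^bsub>D\<^esub> x) = p (e \<odot>\<^bsub>B\<^esub> b) \<oplus>\<^bsub>W\<^esub> q (e \<odot>\<^bsub>C\<^esub> c)" using * vs u_eq by simp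
    also have "\<dots> = e \<odot>\<^bsub>W\<^esub> u x" using * lins by (simp add: W.smult_r_distr)
    finally show "u (e \<odot>\<^bsub>D\<^esub> x) = e \<odot>\<^bsub>W\<^esub> u x" .
  qed
  have uh: "u (h b) = p b" if "b \<in> carrier B" for b
    using u_eq[of b "\<zero>\<^bsub>C\<^esub>"] that lins vs by simp
  have uk: "u (k c) = q c" if "c \<in> carrier C" for c
    using u_eq[of "\<zero>\<^bsub>B\<^esub>" c] that lins vs by simp
  show "\<exists>!u. u \<in> extensional (carrier D) \<and> vlin D W u \<and>
          (\<forall>b\<in>carrier B. u (h b) = p b) \<and> (\<forall>c\<in>carrier C. u (k c) = q c)"
  proof (rule ex1I[of _ u])
    show "u \<in> extensional (carrier D) \<and> vlin D W u \<and>
          (\<forall>b\<in>carrier B. u (h b) = p b) \<and> (\<forall>c\<in>carrier C. u (k c) = q c)"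
      using lin uh uk by (auto simp: u_def)
  next
    fix u' assume u': "u' \<in> extensional (carrier D) \<and> vlin D W u' \<and>
          (\<forall>b\<in>carrier B. u' (h b) = p b) \<and> (\<forall>c\<in>carrier C. u' (k c) = q c)"
    then have lin': "vlin D W u'" by blast
    show "u' = u"
    proof (rule extensionalityI[of _ "carrier D"])
      fix d assume "d \<in> carrier D"
      then obtain b c where "b \<in> carrier B" "c \<in> carrier C" "d = h b \<oplus>\<^bsub>D\<^esub> k c"
        "u d = p b \<oplus>\<^bsub>W\<^esub> q c" using ex by metis
      then show "u' d = u d" using u' vlinD(4)[OF lin'] lins by simp
    qed (use u' in \<open>auto simp: u_def\<close>)
  qed
qed

end

(* Let b be the bottom of the grid P and e_i(t) the point t on the i-th axis through b. Pushout squares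
   show that F x is the colimit of the values of F on the axes below x: it is generated by the images
   of the F(e_i(x_i)), and all relations come from F b. Pullback squares show that the subspaces
   K_i of vectors of F b dying along the i-th axis are independent. Let C be a complement of their sum in
   F b, N_i a complement of the image of F b at the end of the i-th axis, and M_i(t) the preimage of
   N_i in F(e_i(t)). Then K_i = M_i(b_i), and F is the direct sum of the constant functor C and of the
   pullbacks of the M_i along the projections P -> T_i. Each M_i is a persistence module on a finite
   chain, so it is a direct sum of interval modules, and preimages of intervals of T_i are
   intervals of P. *)

theory Submission
  imports Defs "HOL-Library.Function_Algebras"
begin

section \<open>Finite bases of subspaces\<close>

text \<open>The delicate point is to cut the image of \<open>F b\<close> out of every axis
  compatibly with the maps: complements chosen separately at each \<open>t\<close> need not be
  mapped into one another. Pulling back the single complement \<open>N_i\<close> from the end of the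
  axis gives a subfunctor by functoriality, and still \<open>M_i(t)\<close> together with the image
  of \<open>F b\<close> generates \<open>F(e_i(t))\<close>. The two overlap exactly in the image of
  \<open>K_i\<close>, so a vector of \<open>K_i\<close> could be counted at the bottom or on its
  axis; taking \<open>C\<close> complementary to the sum of all the \<open>K_i\<close> assigns it to
  the axis, once. This needs the sum of the \<open>K_i\<close> to be direct, which for three or more
  subspaces does not follow from their meeting pairwise in 0. The pullback squares provide it by
  comparing one axis with the whole face spanned by others.

  The linear algebra takes place in subspaces of one ambient space, where spans, bases and
  dimensions need no carriers; the values of \<open>F\<close> are brought there by choosing a basis
  of each.\<close>

text \<open>A locale of its own, since definitions made in \<open>vector_space\<close> itself are also instantiated by
  the interpretation \<open>real_vector\<close>, which then captures their names.\<close>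

locale ambient_space = vector_space scale
  for scale :: "'a::field \<Rightarrow> 'b::ab_group_add \<Rightarrow> 'b"
begin

text \<open>An indexed family instead of a set, because the same label has to name a vector in many
  spaces at once. The last clause forces \<open>m\<close> to be injective on
  \<open>J\<close>.\<close>

definition family_basis :: "'j set \<Rightarrow> ('j \<Rightarrow> 'b) \<Rightarrow> 'b set \<Rightarrow> bool" where
  "family_basis J m W \<longleftrightarrow> finite J \<and> m ` J \<subseteq> W \<and>
     (\<forall>w\<in>W. \<exists>c. w = (\<Sum>j\<in>J. scale (c j) (m j))) \<and>
     (\<forall>c. (\<Sum>j\<in>J. scale (c j) (m j)) = 0 \<longrightarrow> (\<forall>j\<in>J. c j = 0))"

lemma family_basisD:
  assumes "family_basis J m W"
  shows "finite J" "\<And>j. j \<in> J \<Longrightarrow> m j \<in> W"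
    "\<And>w. w \<in> W \<Longrightarrow> \<exists>c. w = (\<Sum>j\<in>J. scale (c j) (m j))"
    "\<And>c j. (\<Sum>j\<in>J. scale (c j) (m j)) = 0 \<Longrightarrow> j \<in> J \<Longrightarrow> c j = 0"
  using assms unfolding family_basis_def by blast+

lemma family_basis_cong:
  assumes "\<And>j. j \<in> J \<Longrightarrow> m j = m' j"
  shows "family_basis J m W \<longleftrightarrow> family_basis J m' W"
  using assms by (simp add: family_basis_def cong: image_cong sum.cong)

lemma family_basis_reindex:
  assumes "bij_betw h J' J" "family_basis J m W"
  shows "family_basis J' (\<lambda>j. m (h j)) W"
proof -
  have inj: "inj_on h J'" and im: "h ` J' = J" using assms(1) by (auto simp: bij_betw_def)
  have re: "(\<Sum>j\<in>J. scale (c j) (m j)) = (\<Sum>j\<in>J'. scale (c (h j)) (m (h j)))" for c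
    using sum.reindex[OF inj, of "\<lambda>j. scale (c j) (m j)"] im by simp
  have re': "(\<Sum>j\<in>J'. scale (c j) (m (h j))) = (\<Sum>j\<in>J. scale (c (inv_into J' h j)) (m j))" for c
    unfolding re by (rule sum.cong) (simp_all add: inv_into_f_f[OF inj])
  show ?thesis
    unfolding family_basis_def
  proof (intro conjI ballI allI impI)
    show "finite J'" using assms bij_betw_finite by (auto simp: family_basis_def)
    show "(\<lambda>j. m (h j)) ` J' \<subseteq> W" using assms im by (auto simp: family_basis_def)
  next
    fix w assume "w \<in> W"
    then obtain c where "w = (\<Sum>j\<in>J. scale (c j) (m j))" using family_basisD(3)[OF assms(2)] by blast
    then show "\<exists>c. w = (\<Sum>j\<in>J'. scale (c j) (m (h j)))" by (auto simp: re)
  next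
    fix c j assume "(\<Sum>j\<in>J'. scale (c j) (m (h j))) = 0" and j: "j \<in> J'"
    then have "(\<Sum>i\<in>J. scale (c (inv_into J' h i)) (m i)) = 0" unfolding re' by blast
    from family_basisD(4)[OF assms(2) this, of "h j"] show "c j = 0"
      using j im inv_into_f_f[OF inj j] by auto
  qed
qed

text \<open>\<open>indep\<close> and \<open>gen\<close> express that \<open>W\<close> is the direct
  sum of \<open>N\<close> and the line through \<open>q\<close>, which is the situation at each
  point of a bar that is being split off.\<close>

lemma family_basis_insert:
  assumes N: "family_basis J m N" and n: "n \<notin> J" and W: "N \<subseteq> W" "q \<in> W"
    and indep: "\<And>c. scale c q \<in> N \<Longrightarrow> c = 0"
    and gen: "\<And>w. w \<in> W \<Longrightarrow> \<exists>c. w - scale c q \<in> N"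
    and N_sub: "local.subspace N"
  shows "family_basis (insert n J) (m(n := q)) W"
proof -
  have fin: "finite J" and mN: "m ` J \<subseteq> N" using N by (auto simp: family_basis_def)
  have eq: "(\<Sum>j\<in>insert n J. scale (c j) ((m(n := q)) j)) = scale (c n) q + (\<Sum>j\<in>J. scale (c j) (m j))"
    for c
  proof -
    have "(\<Sum>j\<in>J. scale (c j) ((m(n := q)) j)) = (\<Sum>j\<in>J. scale (c j) (m j))"
      using n by (intro sum.cong) auto
    then show ?thesis using fin n by simp
  qed
  have inN: "(\<Sum>j\<in>J. scale (c j) (m j)) \<in> N" for c
    using mN by (intro subspace_sum[OF N_sub] subspace_scale[OF N_sub]) auto
  show ?thesis
    unfolding family_basis_def
  proof (intro conjI ballI allI impI)
    show "finite (insert n J)" using fin by simp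
    show "(m(n := q)) ` insert n J \<subseteq> W" using mN W by auto
  next
    fix w assume "w \<in> W"
    with gen obtain d where "w - scale d q \<in> N" by blast
    with N obtain c where c: "w - scale d q = (\<Sum>j\<in>J. scale (c j) (m j))"
      unfolding family_basis_def by blast
    have "(\<Sum>j\<in>J. scale ((c(n := d)) j) (m j)) = (\<Sum>j\<in>J. scale (c j) (m j))"
      using n by (intro sum.cong) auto
    then have "w = (\<Sum>j\<in>insert n J. scale ((c(n := d)) j) ((m(n := q)) j))"
      unfolding eq using c by (simp add: algebra_simps)
    then show "\<exists>c. w = (\<Sum>j\<in>insert n J. scale (c j) ((m(n := q)) j))" by blast
  next
    fix c j assume z: "(\<Sum>j\<in>insert n J. scale (c j) ((m(n := q)) j)) = 0" and j: "j \<in> insert n J"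
    then have "scale (c n) q = - (\<Sum>j\<in>J. scale (c j) (m j))"
      unfolding eq eq_neg_iff_add_eq_0 by blast
    then have "scale (c n) q \<in> N" using inN subspace_neg[OF N_sub] by simp
    then have "c n = 0" by (rule indep)
    moreover from this have "\<forall>j\<in>J. c j = 0" using family_basisD(4)[OF N] z unfolding eq by auto
    ultimately show "c j = 0" using j by auto
  qed
qed

text \<open>\<open>gen\<close> and \<open>indep\<close> say that the sum map from the external
  direct sum of the \<open>W k\<close> to \<open>V\<close> is bijective. The summands come with maps
  \<open>g k\<close> rather than as subspaces of \<open>V\<close>, since they will sit at other
  points of the grid; injectivity of each \<open>g k\<close> on \<open>W k\<close> is contained in
  \<open>indep\<close>.\<close>

lemma family_basis_Sigma:
  assumes K: "finite K" and basis: "\<And>k. k \<in> K \<Longrightarrow> family_basis (J k) (m k) (W k)"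
    and lin: "\<And>k. k \<in> K \<Longrightarrow> Vector_Spaces.linear scale scale (g k)"
    and sub: "\<And>k. k \<in> K \<Longrightarrow> local.subspace (W k)"
    and into: "\<And>k. k \<in> K \<Longrightarrow> g k ` W k \<subseteq> V"
    and gen: "\<And>v. v \<in> V \<Longrightarrow> \<exists>u. (\<forall>k\<in>K. u k \<in> W k) \<and> v = (\<Sum>k\<in>K. g k (u k))"
    and indep: "\<And>u. \<forall>k\<in>K. u k \<in> W k \<Longrightarrow> (\<Sum>k\<in>K. g k (u k)) = 0 \<Longrightarrow> \<forall>k\<in>K. u k = 0"
  shows "family_basis (Sigma K J) (\<lambda>(k, j). g k (m k j)) V"
proof -
  have finJ: "\<forall>k\<in>K. finite (J k)" and mW: "k \<in> K \<Longrightarrow> j \<in> J k \<Longrightarrow> m k j \<in> W k" for k j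
    using family_basisD(1,2)[OF basis] by simp_all
  have eq: "(\<Sum>p\<in>Sigma K J. scale (c p) (case p of (k, j) \<Rightarrow> g k (m k j))) =
      (\<Sum>k\<in>K. g k (\<Sum>j\<in>J k. scale (c (k, j)) (m k j)))" for c
  proof -
    have "(\<Sum>p\<in>Sigma K J. scale (c p) (case p of (k, j) \<Rightarrow> g k (m k j))) =
      (\<Sum>k\<in>K. \<Sum>j\<in>J k. scale (c (k, j)) (g k (m k j)))"
      by (subst sum.Sigma[OF K finJ]) (rule sum.cong, auto)
    also have "\<dots> = (\<Sum>k\<in>K. g k (\<Sum>j\<in>J k. scale (c (k, j)) (m k j)))"
    proof (rule sum.cong)
      fix k assume "k \<in> K"
      then interpret gk: Vector_Spaces.linear scale scale "g k" by (rule lin)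
      show "(\<Sum>j\<in>J k. scale (c (k, j)) (g k (m k j))) = g k (\<Sum>j\<in>J k. scale (c (k, j)) (m k j))"
        by (simp add: gk.sum gk.scale)
    qed simp
    finally show ?thesis .
  qed
  show ?thesis
    unfolding family_basis_def
  proof (intro conjI ballI allI impI)
    show "finite (Sigma K J)" using K finJ by simp
    show "(\<lambda>(k, j). g k (m k j)) ` Sigma K J \<subseteq> V" by (auto intro!: subsetD[OF into] imageI mW)
  next
    fix v assume "v \<in> V"
    with gen obtain u where u: "\<forall>k\<in>K. u k \<in> W k" "v = (\<Sum>k\<in>K. g k (u k))" by blast
    have "\<forall>k\<in>K. \<exists>c. u k = (\<Sum>j\<in>J k. scale (c j) (m k j))"
      using family_basisD(3)[OF basis] u(1) by blast
    then obtain c where "\<forall>k\<in>K. u k = (\<Sum>j\<in>J k. scale (c k j) (m k j))" by metis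
    then have "v = (\<Sum>p\<in>Sigma K J. scale (case_prod c p) (case p of (k, j) \<Rightarrow> g k (m k j)))"
      using u(2) by (simp add: eq)
    then show "\<exists>c. v = (\<Sum>p\<in>Sigma K J. scale (c p) (case p of (k, j) \<Rightarrow> g k (m k j)))" by blast
  next
    fix c p assume z: "(\<Sum>p\<in>Sigma K J. scale (c p) (case p of (k, j) \<Rightarrow> g k (m k j))) = 0"
      and p: "p \<in> Sigma K J"
    have "\<forall>k\<in>K. (\<Sum>j\<in>J k. scale (c (k, j)) (m k j)) \<in> W k"
      using mW by (auto intro!: subspace_sum subspace_scale sub)
    from indep[OF this] z have z: "\<forall>k\<in>K. (\<Sum>j\<in>J k. scale (c (k, j)) (m k j)) = 0" by (simp add: eq)
    obtain k j where kj: "p = (k, j)" "k \<in> K" "j \<in> J k" using p by blast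
    have "\<forall>j\<in>J k. c (k, j) = 0"
      using family_basisD(4)[OF basis[OF kj(2)] bspec[OF z kj(2)]] by blast
    then show "c p = 0" using kj by simp
  qed
qed

section \<open>Dimensions, hyperplanes and complements of subspaces of a possibly
  infinite-dimensional space\<close>

lemma finite_basis_extends:
  assumes "independent B" "B \<subseteq> W" "W \<subseteq> span S" "finite S"
  obtains B' where "B \<subseteq> B'" "B' \<subseteq> W" "independent B'" "W \<subseteq> span B'" "finite B'" "card B' = dim W"
proof -
  obtain B' where B': "B \<subseteq> B'" "B' \<subseteq> W" "independent B'" "W \<subseteq> span B'"
    using maximal_independent_subset_extend[OF assms(2,1)] by blast
  then have "finite B'" using independent_span_bound[of S B'] assms by blast
  then show thesis using that B' basis_card_eq_dim by blast
qed

text \<open>The finite set \<open>S\<close> need not lie in \<open>W\<close>: it certifies that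
  \<open>W\<close> is finite-dimensional. For infinite-dimensional spaces \<open>dim\<close> takes a
  default value and is not monotone.\<close>

lemma dim_mono_finite:
  assumes "V \<subseteq> W" "W \<subseteq> span S" "finite S"
  shows "dim V \<le> dim W"
proof -
  obtain B where B: "B \<subseteq> V" "independent B" "V \<subseteq> span B" "card B = dim V"
    using basis_exists by blast
  obtain B' where "B \<subseteq> B'" "finite B'" "card B' = dim W"
    by (rule finite_basis_extends[OF B(2) order_trans[OF B(1) assms(1)] assms(2,3)])
  then show ?thesis using B card_mono by metis
qed

lemma dim_strict_mono_finite:
  assumes V: "local.subspace V" "V \<subseteq> W" and "W \<subseteq> span S" "finite S" and v: "v \<in> W" "v \<notin> V"
  shows "dim V < dim W"
proof -
  obtain B where B: "B \<subseteq> V" "independent B" "V \<subseteq> span B" "card B = dim V"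
    using basis_exists by blast
  have span: "span B \<subseteq> V" using B(1) V(1) by (rule span_minimal)
  obtain B' where B': "B \<subseteq> B'" "W \<subseteq> span B'" "finite B'" "card B' = dim W"
    by (rule finite_basis_extends[OF B(2) order_trans[OF B(1) V(2)] assms(3,4)])
  have "B \<noteq> B'" using B' v span by blast
  then show ?thesis using B B' psubset_card_mono[of B' B] by auto
qed

text \<open>A basis of \<open>W\<close> that contains \<open>p\<close>, with \<open>p\<close>
  removed, spans the hyperplane; the coefficient \<open>c\<close> is the coordinate of
  \<open>w\<close> along \<open>p\<close>.\<close>

lemma subspace_hyperplane:
  assumes W: "local.subspace W" and p: "p \<in> W" "p \<noteq> 0"
  obtains N where "local.subspace N" "N \<subseteq> W" "p \<notin> N" "\<And>w. w \<in> W \<Longrightarrow> \<exists>c. w - scale c p \<in> N"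
proof -
  obtain B where B: "{p} \<subseteq> B" "B \<subseteq> W" "independent B" "W \<subseteq> span B"
    by (rule maximal_independent_subset_extend[of "{p}" W]) (use p in simp_all)
  show thesis
  proof
    show "local.subspace (span (B - {p}))" by simp
    show "span (B - {p}) \<subseteq> W" using B(2) by (intro span_minimal W) auto
    show "p \<notin> span (B - {p})" using B by (auto simp: dependent_def)
    fix w assume "w \<in> W"
    then show "\<exists>c. w - scale c p \<in> span (B - {p})" using B span_breakdown[of p B w] by auto
  qed
qed

lemma subspace_complement:
  assumes W: "local.subspace W" and U: "local.subspace U" "U \<subseteq> W"
  obtains N where "local.subspace N" "N \<subseteq> W" "N \<inter> U = {0}"
    "\<And>w. w \<in> W \<Longrightarrow> \<exists>n\<in>N. \<exists>u\<in>U. w = n + u"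
proof -
  obtain A where A: "A \<subseteq> U" "independent A" "U \<subseteq> span A"
    by (rule basis_exists[of U])
  obtain B where B: "A \<subseteq> B" "B \<subseteq> W" "independent B" "W \<subseteq> span B"
    by (rule maximal_independent_subset_extend[OF order_trans[OF A(1) U(2)] A(2)])
  have UA: "span A = U" using A span_minimal[OF A(1) U(1)] by auto
  show thesis
  proof
    show "local.subspace (span (B - A))" by simp
    show "span (B - A) \<subseteq> W" using B(2) by (intro span_minimal W) auto
    show "\<exists>n\<in>span (B - A). \<exists>u\<in>U. w = n + u" if "w \<in> W" for w
    proof -
      have "(B - A) \<union> A = B" using B(1) by auto
      then have "w \<in> span ((B - A) \<union> A)" using B(4) that by auto
      then show ?thesis unfolding span_Un UA by blast
    qed
    show "span (B - A) \<inter> U = {0}"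
    proof -
      have "x = 0" if "x \<in> span (B - A)" "x \<in> span A" for x
      proof (rule ccontr)
        assume "x \<noteq> 0"
        \<comment> \<open>The coordinates of \<open>x\<close> with respect to \<open>B\<close> are
          supported both in \<open>B - A\<close> and in \<open>A\<close>, hence all vanish.\<close>
        have r: "representation B x = representation (B - A) x" "representation B x = representation A x"
          using that B by (auto intro!: representation_extend)
        have "representation B x b = 0" for b
          using representation_ne_zero[of "B - A" x b] representation_ne_zero[of A x b] r by auto
        then have "x = 0"
          using sum_nonzero_representation_eq[OF B(3), of x] span_mono[OF B(1)] that by auto
        with \<open>x \<noteq> 0\<close> show False by simp
      qed
      then show ?thesis using local.span_zero U(1) subspace_0 by (auto simp: UA)
    qed
  qed
qed

lemma family_basis_exists:
  assumes W: "W \<subseteq> span S" "finite S"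
  shows "\<exists>(J :: nat set) m. family_basis J m W"
proof -
  obtain B where B: "B \<subseteq> W" "independent B" "W \<subseteq> span B" "finite B"
    by (rule finite_basis_extends[OF independent_empty empty_subsetI assms])
  have "family_basis B (\<lambda>b. b) W"
    unfolding family_basis_def
  proof (intro conjI ballI allI impI)
    fix w assume "w \<in> W"
    then show "\<exists>c. w = (\<Sum>b\<in>B. scale (c b) b)" using B span_finite[OF B(4)] by auto
  next
    fix c b assume "(\<Sum>b\<in>B. scale (c b) b) = 0" "b \<in> B"
    then show "c b = 0" using independentD[OF B(2) B(4) subset_refl] by blast
  qed (use B in auto)
  then show ?thesis using family_basis_reindex ex_bij_betw_nat_finite[OF B(4)] by blast
qed

end

section \<open>Interval bases and functors on a chain\<close>

lemma total_order_finite_least: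
  assumes "total_order T" "finite A" "A \<noteq> {}" "A \<subseteq> carrier T"
  shows "\<exists>s\<in>A. \<forall>t\<in>A. s \<sqsubseteq>\<^bsub>T\<^esub> t"
  using assms(2-4)
proof (induction A rule: finite_ne_induct)
  case (singleton x)
  interpret total_order T by (rule assms)
  show ?case using singleton by simp
next
  case (insert x A)
  interpret total_order T by (rule assms)
  obtain s where s: "s \<in> A" "\<forall>t\<in>A. s \<sqsubseteq>\<^bsub>T\<^esub> t" using insert by auto
  show ?case
  proof (cases "s \<sqsubseteq>\<^bsub>T\<^esub> x")
    case False
    then have "x \<sqsubseteq>\<^bsub>T\<^esub> s" using total_order_total[of s x] insert.prems s by blast
    then have "\<forall>t\<in>insert x A. x \<sqsubseteq>\<^bsub>T\<^esub> t" using s insert.prems by (auto intro: le_trans)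
    then show ?thesis by blast
  qed (use s in auto)
qed

lemma total_order_finite_greatest:
  assumes "total_order T" "finite A" "A \<noteq> {}" "A \<subseteq> carrier T"
  shows "\<exists>s\<in>A. \<forall>t\<in>A. t \<sqsubseteq>\<^bsub>T\<^esub> s"
  using assms(2-4)
proof (induction A rule: finite_ne_induct)
  case (singleton x)
  interpret total_order T by (rule assms)
  show ?case using singleton by simp
next
  case (insert x A)
  interpret total_order T by (rule assms)
  obtain s where s: "s \<in> A" "\<forall>t\<in>A. t \<sqsubseteq>\<^bsub>T\<^esub> s" using insert by auto
  show ?case
  proof (cases "x \<sqsubseteq>\<^bsub>T\<^esub> s")
    case False
    then have "s \<sqsubseteq>\<^bsub>T\<^esub> x" using total_order_total[of s x] insert.prems s by blast
    then have "\<forall>t\<in>insert x A. t \<sqsubseteq>\<^bsub>T\<^esub> x" using s insert.prems by (auto intro: le_trans)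
    then show ?thesis by blast
  qed (use s in auto)
qed

text \<open>Two points with a common upper bound \<open>z\<close> in \<open>S\<close> are joined by
  the zigzag \<open>x <= z >= y <= y\<close>; the trivial last step is there because a zigzag has to
  end with an upper point. All the intervals constructed below are upward directed.\<close>

lemma poset_interval_directedI:
  assumes "S \<subseteq> carrier P"
    and "\<And>x y z. x \<in> S \<Longrightarrow> y \<in> S \<Longrightarrow> z \<in> carrier P \<Longrightarrow> x \<sqsubseteq>\<^bsub>P\<^esub> z \<Longrightarrow> z \<sqsubseteq>\<^bsub>P\<^esub> y \<Longrightarrow> z \<in> S"
    and "\<And>x y. x \<in> S \<Longrightarrow> y \<in> S \<Longrightarrow> \<exists>z\<in>S. x \<sqsubseteq>\<^bsub>P\<^esub> z \<and> y \<sqsubseteq>\<^bsub>P\<^esub> z"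
    and "\<And>x. x \<in> S \<Longrightarrow> x \<sqsubseteq>\<^bsub>P\<^esub> x"
  shows "poset_interval P S"
  unfolding poset_interval_def
proof (intro conjI ballI impI)
  fix x y assume "x \<in> S" "y \<in> S"
  with assms(3) obtain z where z: "z \<in> S" "x \<sqsubseteq>\<^bsub>P\<^esub> z" "y \<sqsubseteq>\<^bsub>P\<^esub> z" by blast
  let ?a = "\<lambda>k::nat. if k = 0 then x else y" and ?b = "\<lambda>k::nat. if k = 0 then z else y"
  have "?a 0 = x \<and> ?b 1 = y \<and> (\<forall>k\<le>1. ?a k \<in> S \<and> ?b k \<in> S \<and> ?a k \<sqsubseteq>\<^bsub>P\<^esub> ?b k) \<and>
      (\<forall>k<1. ?a (Suc k) \<sqsubseteq>\<^bsub>P\<^esub> ?b k)"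
    using z \<open>x \<in> S\<close> \<open>y \<in> S\<close> assms(4) by auto
  then show "\<exists>(n::nat) a b. a 0 = x \<and> b n = y \<and>
      (\<forall>k\<le>n. a k \<in> S \<and> b k \<in> S \<and> a k \<sqsubseteq>\<^bsub>P\<^esub> b k) \<and> (\<forall>k<n. a (Suc k) \<sqsubseteq>\<^bsub>P\<^esub> b k)"
    by (intro exI)
next
  fix x y z assume "x \<in> S" "y \<in> S" "z \<in> carrier P" "x \<sqsubseteq>\<^bsub>P\<^esub> z \<and> z \<sqsubseteq>\<^bsub>P\<^esub> y"
  then show "z \<in> S" using assms(2) by blast
qed (rule assms(1))

section \<open>Functors with values in subspaces, and their decomposition over a finite
  chain\<close>

context ambient_space
begin

text \<open>The maps are linear on the whole ambient space, although only their restrictions to the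
  subspaces matter; sums and multiples can then be moved through them without membership conditions.
  Finite dimension is built in.\<close>

definition subspace_functor :: "'p gorder \<Rightarrow> ('p \<Rightarrow> 'b set) \<Rightarrow> ('p \<Rightarrow> 'p \<Rightarrow> 'b \<Rightarrow> 'b) \<Rightarrow> bool" where
  "subspace_functor P G \<gamma> \<longleftrightarrow>
    (\<forall>x\<in>carrier P. local.subspace (G x) \<and> (\<exists>S. finite S \<and> G x \<subseteq> span S)) \<and>
    (\<forall>x\<in>carrier P. \<forall>y\<in>carrier P. x \<sqsubseteq>\<^bsub>P\<^esub> y \<longrightarrow>
       Vector_Spaces.linear scale scale (\<gamma> x y) \<and> \<gamma> x y ` G x \<subseteq> G y) \<and>
    (\<forall>x\<in>carrier P. \<forall>v\<in>G x. \<gamma> x x v = v) \<and>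
    (\<forall>x\<in>carrier P. \<forall>y\<in>carrier P. \<forall>z\<in>carrier P. x \<sqsubseteq>\<^bsub>P\<^esub> y \<and> y \<sqsubseteq>\<^bsub>P\<^esub> z \<longrightarrow>
       (\<forall>v\<in>G x. \<gamma> y z (\<gamma> x y v) = \<gamma> x z v))"

lemma subspace_functorD:
  assumes "subspace_functor P G \<gamma>" "x \<in> carrier P"
  shows "local.subspace (G x)" "\<exists>S. finite S \<and> G x \<subseteq> span S"
    "\<And>y. y \<in> carrier P \<Longrightarrow> x \<sqsubseteq>\<^bsub>P\<^esub> y \<Longrightarrow> Vector_Spaces.linear scale scale (\<gamma> x y)"
    "\<And>y v. y \<in> carrier P \<Longrightarrow> x \<sqsubseteq>\<^bsub>P\<^esub> y \<Longrightarrow> v \<in> G x \<Longrightarrow> \<gamma> x y v \<in> G y"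
    "\<And>v. v \<in> G x \<Longrightarrow> \<gamma> x x v = v"
    "\<And>y z v. y \<in> carrier P \<Longrightarrow> z \<in> carrier P \<Longrightarrow> x \<sqsubseteq>\<^bsub>P\<^esub> y \<Longrightarrow> y \<sqsubseteq>\<^bsub>P\<^esub> z \<Longrightarrow> v \<in> G x \<Longrightarrow>
       \<gamma> y z (\<gamma> x y v) = \<gamma> x z v"
proof -
  note F = assms(1)[unfolded subspace_functor_def]
  show "local.subspace (G x)" "\<exists>S. finite S \<and> G x \<subseteq> span S" using F assms(2) by simp_all
  show "Vector_Spaces.linear scale scale (\<gamma> x y)" if "y \<in> carrier P" "x \<sqsubseteq>\<^bsub>P\<^esub> y" for y
    using F assms(2) that by simp
  show "\<gamma> x y v \<in> G y" if "y \<in> carrier P" "x \<sqsubseteq>\<^bsub>P\<^esub> y" "v \<in> G x" for y v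
    using F assms(2) that by (simp add: image_subset_iff)
  show "\<gamma> x x v = v" if "v \<in> G x" for v using F assms(2) that by simp
  show "\<gamma> y z (\<gamma> x y v) = \<gamma> x z v"
    if "y \<in> carrier P" "z \<in> carrier P" "x \<sqsubseteq>\<^bsub>P\<^esub> y" "y \<sqsubseteq>\<^bsub>P\<^esub> z" "v \<in> G x" for y z v
    using F assms(2) that by simp
qed

text \<open>The vectors \<open>m j x\<close> with \<open>x \<in> A j\<close> are the images of the units of the interval modules on
  the sets \<open>A j\<close> under an isomorphism from their direct sum; \<open>m j x\<close> is irrelevant for \<open>x \<notin> A j\<close>.\<close>

definition interval_basis ::
  "'p gorder \<Rightarrow> ('p \<Rightarrow> 'b set) \<Rightarrow> ('p \<Rightarrow> 'p \<Rightarrow> 'b \<Rightarrow> 'b) \<Rightarrow>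
   'j set \<Rightarrow> ('j \<Rightarrow> 'p set) \<Rightarrow> ('j \<Rightarrow> 'p \<Rightarrow> 'b) \<Rightarrow> bool" where
  "interval_basis P G \<gamma> J A m \<longleftrightarrow> finite J \<and> (\<forall>j\<in>J. poset_interval P (A j)) \<and>
    (\<forall>x\<in>carrier P. family_basis {j\<in>J. x \<in> A j} (\<lambda>j. m j x) (G x)) \<and>
    (\<forall>j\<in>J. \<forall>x\<in>A j. \<forall>y\<in>carrier P. x \<sqsubseteq>\<^bsub>P\<^esub> y \<longrightarrow> \<gamma> x y (m j x) = (if y \<in> A j then m j y else 0))"

text \<open>Index sets arise as dependent sums over the axes, whereas a decomposition has to be
  labelled by natural numbers.\<close>

lemma interval_basis_reindex:
  assumes h: "bij_betw h J' J" and basis: "interval_basis P G \<gamma> J A m"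
  shows "interval_basis P G \<gamma> J' (\<lambda>j. A (h j)) (\<lambda>j. m (h j))"
proof -
  have hJ: "\<And>j. j \<in> J' \<Longrightarrow> h j \<in> J" using h by (auto simp: bij_betw_def)
  have "finite J'" using h basis bij_betw_finite unfolding interval_basis_def by blast
  moreover have "family_basis {j\<in>J'. x \<in> A (h j)} (\<lambda>j. m (h j) x) (G x)" if "x \<in> carrier P" for x
  proof -
    have "bij_betw h {j\<in>J'. x \<in> A (h j)} {j\<in>J. x \<in> A j}"
      using h by (auto simp: bij_betw_def inj_on_def image_iff)
    moreover have "family_basis {j\<in>J. x \<in> A j} (\<lambda>j. m j x) (G x)"
      using basis that unfolding interval_basis_def by blast
    ultimately show ?thesis by (rule family_basis_reindex)
  qed
  ultimately show ?thesis using basis hJ unfolding interval_basis_def by blast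
qed

text \<open>A bar is split off from its least element \<open>s\<close>, a bottom element of the support, to the greatest
  \<open>t\<close> with \<open>f s t \<noteq> 0\<close>. By these choices the preimages of a hyperplane of \<open>M t\<close> form a
  complementary subfunctor.\<close>

lemma chain_interval_basis:
  assumes T: "total_order T" and fin: "finite (carrier T)"
  shows "subspace_functor T M f \<Longrightarrow> \<exists>(J :: nat set) A m. interval_basis T M f J A m"
\<comment> \<open>The total dimension drops with each bar split off. Only the subspaces vary in the
  induction, since a subfunctor keeps the maps \<open>f\<close>.\<close>
proof (induction "\<Sum>t\<in>carrier T. dim (M t)" arbitrary: M rule: less_induct)
  case less
  interpret total_order T by (rule T)
  note F = subspace_functorD[OF less.prems]
  show ?case
  proof (cases "\<forall>t\<in>carrier T. M t = {0}")
    case True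
    then have "interval_basis T M f ({} :: nat set) A m" for A m
      by (simp add: interval_basis_def family_basis_def)
    then show ?thesis by blast
  next
    case False
    have zero: "0 \<in> M t" if "t \<in> carrier T" for t using F(1)[OF that] subspace_0 by blast
    have "\<exists>s\<in>{t \<in> carrier T. M t \<noteq> {0}}. \<forall>t\<in>{t \<in> carrier T. M t \<noteq> {0}}. s \<sqsubseteq>\<^bsub>T\<^esub> t"
      by (rule total_order_finite_least[OF T]) (use fin False in auto)
    then obtain s where s: "s \<in> carrier T" "M s \<noteq> {0}"
      and s_least: "\<And>t. t \<in> carrier T \<Longrightarrow> M t \<noteq> {0} \<Longrightarrow> s \<sqsubseteq>\<^bsub>T\<^esub> t" by blast
    obtain v0 where v0: "v0 \<in> M s" "v0 \<noteq> 0" using s zero by blast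
    \<comment> \<open>\<open>U\<close> refers to all vectors of \<open>M s\<close>, so past its
      greatest element \<open>t\<close> every one of them is dead, in particular the one that
      survives up to \<open>t\<close>.\<close>
    define U where "U = {t \<in> carrier T. s \<sqsubseteq>\<^bsub>T\<^esub> t \<and> (\<exists>v\<in>M s. f s t v \<noteq> 0)}"
    have "s \<in> U" using s v0 F(5)[OF s(1)] by (auto simp: U_def)
    then have "\<exists>t\<in>U. \<forall>u\<in>U. u \<sqsubseteq>\<^bsub>T\<^esub> t"
      by (intro total_order_finite_greatest[OF T]) (use fin in \<open>auto simp: U_def\<close>)
    then obtain t where t: "t \<in> U" "\<And>u. u \<in> U \<Longrightarrow> u \<sqsubseteq>\<^bsub>T\<^esub> t" by blast
    then obtain v where tT: "t \<in> carrier T" and st: "s \<sqsubseteq>\<^bsub>T\<^esub> t" and v: "v \<in> M s" "f s t v \<noteq> 0"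
      by (auto simp: U_def)
    have p: "f s t v \<in> M t" by (rule F(4)[OF s(1) tT st v(1)])
    obtain N where N: "local.subspace N" "N \<subseteq> M t" "f s t v \<notin> N"
      "\<And>w. w \<in> M t \<Longrightarrow> \<exists>c. w - scale c (f s t v) \<in> N"
      using subspace_hyperplane[OF F(1)[OF tT] p v(2)] by blast
    define B where "B = {u \<in> carrier T. s \<sqsubseteq>\<^bsub>T\<^esub> u \<and> u \<sqsubseteq>\<^bsub>T\<^esub> t}"
    define M' where "M' u = (if u \<in> B then {w \<in> M u. f u t w \<in> N} else M u)" for u
    have M'M: "M' u \<subseteq> M u" for u by (auto simp: M'_def)
    have sub': "local.subspace (M' u)" if u: "u \<in> carrier T" for u
    proof (cases "u \<in> B")
      case True
      then interpret fut: Vector_Spaces.linear scale scale "f u t"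
        using F(3)[OF u tT] by (simp add: B_def)
      show ?thesis
        using True F(1)[OF u] N(1)
        by (auto simp: M'_def local.subspace_def fut.add fut.scale)
    qed (simp add: M'_def F(1)[OF u])
    have maps': "f u u' w \<in> M' u'"
      if u: "u \<in> carrier T" "u' \<in> carrier T" "u \<sqsubseteq>\<^bsub>T\<^esub> u'" "w \<in> M' u" for u u' w
    proof -
      have wM: "w \<in> M u" using u(4) M'M by blast
      have fw: "f u u' w \<in> M u'" by (rule F(4)[OF u(1-3) wM])
      show ?thesis
      proof (cases "u' \<in> B")
        case True
        then have u't: "u' \<sqsubseteq>\<^bsub>T\<^esub> t" by (simp add: B_def)
        have ut: "u \<sqsubseteq>\<^bsub>T\<^esub> t" using le_trans[OF u(3) u't u(1,2) tT] .
        show ?thesis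
        proof (cases "u \<in> B")
          case True
          then have "f u t w \<in> N" using u(4) by (simp add: M'_def)
          then have "f u' t (f u u' w) \<in> N" using F(6)[OF u(1,2) tT u(3) u't wM] by simp
          then show ?thesis using fw \<open>u' \<in> B\<close> by (simp add: M'_def)
        next
          \<comment> \<open>Here \<open>u\<close> is below \<open>t\<close> but not in the bar,
            hence not above \<open>s\<close>, and the choice of \<open>s\<close> makes
            \<open>M u\<close> zero. Otherwise a vector born before the bar could enter it outside
            \<open>M'\<close>.\<close>
          case False
          then have "M u = {0}" using s_least[OF u(1)] u(1) ut by (auto simp: B_def)
          then have "w = 0" using wM by simp
          interpret fuu: Vector_Spaces.linear scale scale "f u u'" by (rule F(3)[OF u(1-3)])
          show ?thesis using \<open>w = 0\<close> sub'[OF u(2)] subspace_0 by (simp add: fuu.zero)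
        qed
      qed (use fw in \<open>simp add: M'_def\<close>)
    qed
    have functor': "subspace_functor T M' f"
      unfolding subspace_functor_def
    proof (intro conjI ballI impI)
      fix u assume u: "u \<in> carrier T"
      show "\<exists>S. finite S \<and> M' u \<subseteq> span S" using F(2)[OF u] M'M[of u] by blast
      show "local.subspace (M' u)" by (rule sub'[OF u])
      show "f u u w = w" if "w \<in> M' u" for w using F(5)[OF u] that M'M by blast
    next
      fix u u' assume u: "u \<in> carrier T" "u' \<in> carrier T" "u \<sqsubseteq>\<^bsub>T\<^esub> u'"
      show "Vector_Spaces.linear scale scale (f u u')" by (rule F(3)[OF u])
      show "f u u' ` M' u \<subseteq> M' u'" using maps'[OF u] by blast
    next
      fix x y z w assume "x \<in> carrier T" "y \<in> carrier T" "z \<in> carrier T" "x \<sqsubseteq>\<^bsub>T\<^esub> y \<and> y \<sqsubseteq>\<^bsub>T\<^esub> z" "w \<in> M' x"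
      then show "f y z (f x y w) = f x z w" using F(6)[of x y z w] M'M by blast
    qed
    have sB: "s \<in> B" using s st by (simp add: B_def)
    \<comment> \<open>The descent happens at \<open>s\<close>, where \<open>v\<close> itself is
      lost: its image at \<open>t\<close> is outside \<open>N\<close>.\<close>
    have "dim (M' s) < dim (M s)"
    proof -
      obtain S where "finite S" "M s \<subseteq> span S" using F(2)[OF s(1)] by blast
      moreover have "v \<notin> M' s" using N(3) sB by (simp add: M'_def)
      ultimately show ?thesis using dim_strict_mono_finite[OF sub'[OF s(1)] M'M] v(1) by blast
    qed
    moreover have "dim (M' u) \<le> dim (M u)" if "u \<in> carrier T" for u
      using F(2)[OF that] dim_mono_finite[OF M'M] by blast
    ultimately have "(\<Sum>t\<in>carrier T. dim (M' t)) < (\<Sum>t\<in>carrier T. dim (M t))"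
      using s(1) by (intro sum_strict_mono_ex1[OF fin]) auto
    from less.hyps[OF this functor'] obtain J :: "nat set" and A m
      where IH: "interval_basis T M' f J A m" by blast
    then have finJ: "finite J" by (simp add: interval_basis_def)
    obtain n where n: "n \<notin> J" using ex_new_if_finite[OF infinite_UNIV_nat finJ] by blast
    have "interval_basis T M f (insert n J) (A(n := B)) (m(n := \<lambda>u. f s u v))"
      unfolding interval_basis_def
    proof (intro conjI ballI impI)
      show "finite (insert n J)" using finJ by simp
    next
      fix j assume j: "j \<in> insert n J"
      have "poset_interval T B"
      proof (rule poset_interval_directedI)
        fix x y z assume "x \<in> B" "y \<in> B" "z \<in> carrier T" "x \<sqsubseteq>\<^bsub>T\<^esub> z" "z \<sqsubseteq>\<^bsub>T\<^esub> y"
        then show "z \<in> B" using le_trans[of s x z] le_trans[of z y t] s(1) tT by (simp add: B_def)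
      next
        fix x y assume "x \<in> B" "y \<in> B"
        then show "\<exists>z\<in>B. x \<sqsubseteq>\<^bsub>T\<^esub> z \<and> y \<sqsubseteq>\<^bsub>T\<^esub> z" using tT st by (auto simp: B_def intro!: bexI[of _ t])
      qed (auto simp: B_def)
      then show "poset_interval T ((A(n := B)) j)" using IH j by (auto simp: interval_basis_def)
    next
      fix u assume u: "u \<in> carrier T"
      let ?J = "{j \<in> J. u \<in> A j}"
      have bas: "family_basis ?J (\<lambda>j. m j u) (M' u)" using IH u by (simp add: interval_basis_def)
      have fm: "(\<lambda>j. (m(n := \<lambda>u. f s u v)) j u) = (\<lambda>j. m j u)(n := f s u v)" by auto
      show "family_basis {j \<in> insert n J. u \<in> (A(n := B)) j} (\<lambda>j. (m(n := \<lambda>u. f s u v)) j u) (M u)"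
      proof (cases "u \<in> B")
        case True
        then have su: "s \<sqsubseteq>\<^bsub>T\<^esub> u" and ut: "u \<sqsubseteq>\<^bsub>T\<^esub> t" by (auto simp: B_def)
        interpret fut: Vector_Spaces.linear scale scale "f u t" by (rule F(3)[OF u tT ut])
        have q: "f s u v \<in> M u" by (rule F(4)[OF s(1) u su v(1)])
        have futq: "f u t (f s u v) = f s t v" by (rule F(6)[OF s(1) u tT su ut v(1)])
        \<comment> \<open>Both conditions on the new vector are tested at \<open>t\<close>: the map
          \<open>f u t\<close> carries it to \<open>f s t v\<close>, and \<open>M' u\<close> is the
          preimage of \<open>N\<close>.\<close>
        have "family_basis (insert n ?J) ((\<lambda>j. m j u)(n := f s u v)) (M u)"
        proof (rule family_basis_insert[OF bas _ M'M q _ _ sub'[OF u]])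
          show "n \<notin> ?J" using n by simp
          fix c assume "scale c (f s u v) \<in> M' u"
          then have "scale c (f s t v) \<in> N" using True by (simp add: M'_def fut.scale futq)
          then have "c \<noteq> 0 \<Longrightarrow> f s t v \<in> N"
            using subspace_scale[OF N(1), of "scale c (f s t v)" "inverse c"] by simp
          then show "c = 0" using N(3) by blast
        next
          fix w assume w: "w \<in> M u"
          from N(4)[OF F(4)[OF u tT ut w]] obtain c where "f u t w - scale c (f s t v) \<in> N" by blast
          then have "w - scale c (f s u v) \<in> M' u"
            using True w q F(1)[OF u]
            by (simp add: M'_def fut.diff fut.scale futq subspace_diff subspace_scale)
          then show "\<exists>c. w - scale c (f s u v) \<in> M' u" by blast
        qed
        moreover have "{j \<in> insert n J. u \<in> (A(n := B)) j} = insert n ?J" using True n by auto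
        ultimately show ?thesis by (simp only: fm)
      next
        case False
        then have "{j \<in> insert n J. u \<in> (A(n := B)) j} = ?J" using n by auto
        moreover have "M' u = M u" using False by (simp add: M'_def)
        moreover have "family_basis ?J (\<lambda>j. (m(n := \<lambda>u. f s u v)) j u) (M' u)"
          using bas n by (subst family_basis_cong[of _ _ "\<lambda>j. m j u"]) auto
        ultimately show ?thesis by simp
      qed
    next
      fix j u u' assume j: "j \<in> insert n J" and u: "u \<in> (A(n := B)) j" "u' \<in> carrier T" "u \<sqsubseteq>\<^bsub>T\<^esub> u'"
      show "f u u' ((m(n := \<lambda>u. f s u v)) j u) =
          (if u' \<in> (A(n := B)) j then (m(n := \<lambda>u. f s u v)) j u' else 0)"
      proof (cases "j = n")
        case True
        then have uB: "u \<in> carrier T" "s \<sqsubseteq>\<^bsub>T\<^esub> u" using u by (auto simp: B_def)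
        have su': "s \<sqsubseteq>\<^bsub>T\<^esub> u'" by (rule le_trans[OF uB(2) u(3) s(1) uB(1) u(2)])
        have "f u u' (f s u v) = f s u' v" by (rule F(6)[OF s(1) uB(1) u(2) uB(2) u(3) v(1)])
        moreover have "f s u' v = 0" if "u' \<notin> B"
          using that t(2)[of u'] su' u(2) v(1) by (auto simp: U_def B_def)
        ultimately show ?thesis using True by simp
      next
        case False
        then show ?thesis using IH j u unfolding interval_basis_def by auto
      qed
    qed
    then show ?thesis by blast
  qed
qed

end

section \<open>Bidegree one functors on a grid\<close>

text \<open>The join is picked by choice from the least upper bounds; antisymmetry identifies it
  with any verified candidate.\<close>

lemma (in partial_order) join_eqI:
  assumes "x \<in> carrier L" "y \<in> carrier L" "z \<in> carrier L" "x \<sqsubseteq> z" "y \<sqsubseteq> z"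
    and "\<And>w. w \<in> carrier L \<Longrightarrow> x \<sqsubseteq> w \<Longrightarrow> y \<sqsubseteq> w \<Longrightarrow> z \<sqsubseteq> w"
  shows "x \<squnion> y = z"
proof -
  have "least L z (Upper L {x, y})" using assms by (auto simp: least_def Upper_def)
  then show ?thesis unfolding join_def sup_def by (intro some_equality) (auto intro: least_unique)
qed

lemma (in partial_order) meet_eqI:
  assumes "x \<in> carrier L" "y \<in> carrier L" "z \<in> carrier L" "z \<sqsubseteq> x" "z \<sqsubseteq> y"
    and "\<And>w. w \<in> carrier L \<Longrightarrow> w \<sqsubseteq> x \<Longrightarrow> w \<sqsubseteq> y \<Longrightarrow> w \<sqsubseteq> z"
  shows "x \<sqinter> y = z"
proof -
  have "greatest L z (Lower L {x, y})" using assms by (auto simp: greatest_def Lower_def)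
  then show ?thesis unfolding meet_def inf_def by (intro some_equality) (auto intro: greatest_unique)
qed

section \<open>The product order: bottom, top, faces and axes of the grid\<close>

lemma prod_order_simps:
  "carrier (prod_order I T) = (\<Pi>\<^sub>E i\<in>I. carrier (T i))"
  "x \<sqsubseteq>\<^bsub>prod_order I T\<^esub> y \<longleftrightarrow> (\<forall>i\<in>I. x i \<sqsubseteq>\<^bsub>T i\<^esub> y i)"
  by (simp_all add: prod_order_def)

lemma prod_order_partial_order:
  assumes "\<And>i. i \<in> I \<Longrightarrow> partial_order (T i)"
  shows "partial_order (prod_order I T)"
proof -
  have eq: "(.=\<^bsub>prod_order I T\<^esub>) = (=)" by (simp add: prod_order_def)
  show ?thesis
  proof (unfold_locales, unfold eq)
    fix x assume "x \<in> carrier (prod_order I T)"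
    then show "x \<sqsubseteq>\<^bsub>prod_order I T\<^esub> x"
      using assms by (auto intro!: weak_partial_order.le_refl simp: partial_order_def PiE_iff prod_order_simps)
  next
    fix x y assume xy: "x \<sqsubseteq>\<^bsub>prod_order I T\<^esub> y" "y \<sqsubseteq>\<^bsub>prod_order I T\<^esub> x"
      "x \<in> carrier (prod_order I T)" "y \<in> carrier (prod_order I T)"
    show "x = y"
    proof (rule PiE_ext)
      show "x \<in> (\<Pi>\<^sub>E i\<in>I. carrier (T i))" "y \<in> (\<Pi>\<^sub>E i\<in>I. carrier (T i))"
        using xy by (simp_all add: prod_order_simps)
      fix i assume i: "i \<in> I"
      interpret partial_order "T i" by (rule assms[OF i])
      show "x i = y i" using xy i by (intro le_antisym) (auto simp: prod_order_simps)
    qed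
  next
    fix x y z assume xyz: "x \<sqsubseteq>\<^bsub>prod_order I T\<^esub> y" "y \<sqsubseteq>\<^bsub>prod_order I T\<^esub> z"
      "x \<in> carrier (prod_order I T)" "y \<in> carrier (prod_order I T)" "z \<in> carrier (prod_order I T)"
    have "x i \<sqsubseteq>\<^bsub>T i\<^esub> z i" if i: "i \<in> I" for i
    proof -
      interpret partial_order "T i" by (rule assms[OF i])
      show ?thesis using xyz i by (intro le_trans[of "x i" "y i" "z i"]) (auto simp: prod_order_simps)
    qed
    then show "x \<sqsubseteq>\<^bsub>prod_order I T\<^esub> z" by (simp add: prod_order_simps)
  qed simp_all
qed

text \<open>Nonempty factors guarantee a bottom and a top; an empty grid is dealt with separately.
  For empty \<open>I\<close> the grid is a single point without axes.\<close>

locale grid =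
  fixes I :: "'i set" and T :: "'i \<Rightarrow> 'a gorder"
  assumes finI: "finite I"
    and T: "\<And>i. i \<in> I \<Longrightarrow> total_order (T i)"
    and finT: "\<And>i. i \<in> I \<Longrightarrow> finite (carrier (T i))"
    and T_ne: "\<And>i. i \<in> I \<Longrightarrow> carrier (T i) \<noteq> {}"
begin

abbreviation P :: "('i \<Rightarrow> 'a) gorder" where "P \<equiv> prod_order I T"

lemma T_refl: "i \<in> I \<Longrightarrow> t \<in> carrier (T i) \<Longrightarrow> t \<sqsubseteq>\<^bsub>T i\<^esub> t"
  using T by (auto intro!: weak_partial_order.le_refl simp: total_order_def partial_order_def)

lemma partial_order_P: "partial_order P"
  using T by (intro prod_order_partial_order) (simp add: total_order_def)

lemma P_refl: "x \<in> carrier P \<Longrightarrow> x \<sqsubseteq>\<^bsub>P\<^esub> x"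
  using partial_order_P unfolding partial_order_def by (blast intro: weak_partial_order.le_refl)

lemma P_trans:
  assumes "x \<sqsubseteq>\<^bsub>P\<^esub> y" "y \<sqsubseteq>\<^bsub>P\<^esub> z" "x \<in> carrier P" "y \<in> carrier P" "z \<in> carrier P"
  shows "x \<sqsubseteq>\<^bsub>P\<^esub> z"
proof -
  interpret partial_order P by (rule partial_order_P)
  show ?thesis by (rule le_trans[OF assms])
qed

definition bot :: "'i \<Rightarrow> 'a" where
  "bot = (\<lambda>i\<in>I. SOME s. s \<in> carrier (T i) \<and> (\<forall>t\<in>carrier (T i). s \<sqsubseteq>\<^bsub>T i\<^esub> t))"

definition top_pt :: "'i \<Rightarrow> 'a" where
  "top_pt = (\<lambda>i\<in>I. SOME s. s \<in> carrier (T i) \<and> (\<forall>t\<in>carrier (T i). t \<sqsubseteq>\<^bsub>T i\<^esub> s))"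

text \<open>Projection of \<open>x\<close> to the face through the bottom spanned by the coordinates
  in \<open>S\<close>. As \<open>S\<close> grows from the empty set to \<open>I\<close>, it leads
  from the bottom to \<open>x\<close> one axis at a time; the inductions over \<open>S\<close> below
  follow this path.\<close>

definition cut :: "'i set \<Rightarrow> ('i \<Rightarrow> 'a) \<Rightarrow> 'i \<Rightarrow> 'a" where
  "cut S x = (\<lambda>i\<in>I. if i \<in> S then x i else bot i)"

text \<open>The point written \<open>e_i(t)\<close> in the overview; below, \<open>e i\<close> is
  reserved for the end of the axis, \<open>ax i (top_pt i)\<close>.\<close>

definition ax :: "'i \<Rightarrow> 'a \<Rightarrow> 'i \<Rightarrow> 'a" where
  "ax i t = (\<lambda>k\<in>I. if k = i then t else bot k)"

lemma bot: "i \<in> I \<Longrightarrow> bot i \<in> carrier (T i)" "i \<in> I \<Longrightarrow> t \<in> carrier (T i) \<Longrightarrow> bot i \<sqsubseteq>\<^bsub>T i\<^esub> t"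
proof -
  have *: "bot i \<in> carrier (T i) \<and> (\<forall>t\<in>carrier (T i). bot i \<sqsubseteq>\<^bsub>T i\<^esub> t)" if i: "i \<in> I" for i
  proof -
    have "\<exists>s\<in>carrier (T i). \<forall>t\<in>carrier (T i). s \<sqsubseteq>\<^bsub>T i\<^esub> t"
      by (rule total_order_finite_least[OF T[OF i] finT[OF i] T_ne[OF i]]) simp
    then have "\<exists>s. s \<in> carrier (T i) \<and> (\<forall>t\<in>carrier (T i). s \<sqsubseteq>\<^bsub>T i\<^esub> t)" by blast
    from someI_ex[OF this] show ?thesis using i by (simp add: bot_def)
  qed
  show "i \<in> I \<Longrightarrow> bot i \<in> carrier (T i)" "i \<in> I \<Longrightarrow> t \<in> carrier (T i) \<Longrightarrow> bot i \<sqsubseteq>\<^bsub>T i\<^esub> t"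
    using * by blast+
qed

lemma top_pt:
  "i \<in> I \<Longrightarrow> top_pt i \<in> carrier (T i)" "i \<in> I \<Longrightarrow> t \<in> carrier (T i) \<Longrightarrow> t \<sqsubseteq>\<^bsub>T i\<^esub> top_pt i"
proof -
  have *: "top_pt i \<in> carrier (T i) \<and> (\<forall>t\<in>carrier (T i). t \<sqsubseteq>\<^bsub>T i\<^esub> top_pt i)" if i: "i \<in> I" for i
  proof -
    have "\<exists>s\<in>carrier (T i). \<forall>t\<in>carrier (T i). t \<sqsubseteq>\<^bsub>T i\<^esub> s"
      by (rule total_order_finite_greatest[OF T[OF i] finT[OF i] T_ne[OF i]]) simp
    then have "\<exists>s. s \<in> carrier (T i) \<and> (\<forall>t\<in>carrier (T i). t \<sqsubseteq>\<^bsub>T i\<^esub> s)" by blast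
    from someI_ex[OF this] show ?thesis using i by (simp add: top_pt_def)
  qed
  show "i \<in> I \<Longrightarrow> top_pt i \<in> carrier (T i)" "i \<in> I \<Longrightarrow> t \<in> carrier (T i) \<Longrightarrow> t \<sqsubseteq>\<^bsub>T i\<^esub> top_pt i"
    using * by blast+
qed

lemma bot_in [simp]: "bot \<in> carrier P"
  using bot(1) by (auto simp: bot_def prod_order_simps)

lemma top_pt_in [simp]: "top_pt \<in> carrier P"
  using top_pt(1) by (auto simp: top_pt_def prod_order_simps)

lemma bot_le: "x \<in> carrier P \<Longrightarrow> bot \<sqsubseteq>\<^bsub>P\<^esub> x"
  using bot(2) by (auto simp: prod_order_simps)

lemma coord: "x \<in> carrier P \<Longrightarrow> i \<in> I \<Longrightarrow> x i \<in> carrier (T i)"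
  by (auto simp: prod_order_simps)

lemma cut_in: "x \<in> carrier P \<Longrightarrow> cut S x \<in> carrier P"
  using bot(1) by (auto simp: cut_def prod_order_simps)

lemma cut_le:
  assumes "x \<in> carrier P" "S \<subseteq> S'"
  shows "cut S x \<sqsubseteq>\<^bsub>P\<^esub> cut S' x"
  unfolding prod_order_simps(2)
proof
  fix i assume i: "i \<in> I"
  note x = coord[OF assms(1) i]
  show "cut S x i \<sqsubseteq>\<^bsub>T i\<^esub> cut S' x i"
    using i assms(2) T_refl[OF i x] T_refl[OF i bot(1)[OF i]] bot(2)[OF i x] by (auto simp: cut_def)
qed

lemma cut_empty: "cut {} x = bot"
  by (auto simp: cut_def bot_def)

lemma cut_all: "x \<in> carrier P \<Longrightarrow> cut I x = x"
  by (auto simp: prod_order_simps cut_def PiE_iff extensional_def)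

lemma ax_in: "i \<in> I \<Longrightarrow> t \<in> carrier (T i) \<Longrightarrow> ax i t \<in> carrier P"
  using bot(1) by (auto simp: ax_def prod_order_simps)

lemma ax_le: "i \<in> I \<Longrightarrow> s \<sqsubseteq>\<^bsub>T i\<^esub> t \<Longrightarrow> ax i s \<sqsubseteq>\<^bsub>P\<^esub> ax i t"
  using bot(1) T_refl by (auto simp: ax_def prod_order_simps(2))

lemma ax_le_cut:
  assumes "x \<in> carrier P" "i \<in> S"
  shows "ax i (x i) \<sqsubseteq>\<^bsub>P\<^esub> cut S x"
  unfolding prod_order_simps(2)
proof
  fix k assume k: "k \<in> I"
  note x = coord[OF assms(1) k]
  show "ax i (x i) k \<sqsubseteq>\<^bsub>T k\<^esub> cut S x k"
    using k assms(2) T_refl[OF k x] T_refl[OF k bot(1)[OF k]] bot(2)[OF k x]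
    by (auto simp: cut_def ax_def)
qed

lemma ax_le_self: "x \<in> carrier P \<Longrightarrow> i \<in> I \<Longrightarrow> ax i (x i) \<sqsubseteq>\<^bsub>P\<^esub> x"
  using ax_le_cut[of x i I] by (simp add: cut_all)

text \<open>Together with \<open>meet_cut_ax\<close> this exhibits the bicartesian square with
  corners \<open>bot\<close>, \<open>cut S x\<close>, \<open>ax j (x j)\<close> and
  \<open>cut (insert j S) x\<close>. Bidegree one is applied to squares of this kind, so every
  relation obtained comes from the bottom.\<close>

lemma join_cut_ax:
  assumes x: "x \<in> carrier P" and j: "j \<in> I" "j \<notin> S"
  shows "cut S x \<squnion>\<^bsub>P\<^esub> ax j (x j) = cut (insert j S) x"
proof (rule partial_order.join_eqI[OF partial_order_P])
  show "cut S x \<in> carrier P" "ax j (x j) \<in> carrier P" "cut (insert j S) x \<in> carrier P"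
    using cut_in[OF x] ax_in[OF j(1) coord[OF x j(1)]] by simp_all
  show "cut S x \<sqsubseteq>\<^bsub>P\<^esub> cut (insert j S) x" by (rule cut_le[OF x]) auto
  show "ax j (x j) \<sqsubseteq>\<^bsub>P\<^esub> cut (insert j S) x" by (rule ax_le_cut[OF x]) simp
  fix w assume "w \<in> carrier P" "cut S x \<sqsubseteq>\<^bsub>P\<^esub> w" "ax j (x j) \<sqsubseteq>\<^bsub>P\<^esub> w"
  then show "cut (insert j S) x \<sqsubseteq>\<^bsub>P\<^esub> w" using j by (auto simp: prod_order_simps(2) cut_def ax_def split: if_splits)
qed

lemma meet_cut_ax:
  assumes x: "x \<in> carrier P" and j: "j \<in> I" "j \<notin> S"
  shows "cut S x \<sqinter>\<^bsub>P\<^esub> ax j (x j) = bot"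
proof (rule partial_order.meet_eqI[OF partial_order_P])
  show in_P: "cut S x \<in> carrier P" "ax j (x j) \<in> carrier P" "bot \<in> carrier P"
    using cut_in[OF x] ax_in[OF j(1) coord[OF x j(1)]] by simp_all
  show "bot \<sqsubseteq>\<^bsub>P\<^esub> cut S x" "bot \<sqsubseteq>\<^bsub>P\<^esub> ax j (x j)" using bot_le in_P by blast+
  fix w assume w: "w \<in> carrier P" "w \<sqsubseteq>\<^bsub>P\<^esub> cut S x" "w \<sqsubseteq>\<^bsub>P\<^esub> ax j (x j)"
  have "w i \<sqsubseteq>\<^bsub>T i\<^esub> bot i" if "i \<in> I" for i
    using w(2,3) that j by (cases "i = j") (auto simp: prod_order_simps(2) cut_def ax_def)
  then show "w \<sqsubseteq>\<^bsub>P\<^esub> bot" by (simp add: prod_order_simps)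
qed

text \<open>Since \<open>T i\<close> is total, the coordinatewise maximum of two points takes its
  i-th coordinate from one of them, so the cylinder is upward directed whatever zigzags connect
  \<open>A\<close>.\<close>

lemma poset_interval_cylinder:
  assumes i: "i \<in> I" and A: "poset_interval (T i) A"
  shows "poset_interval P {x \<in> carrier P. x i \<in> A}"
proof (rule poset_interval_directedI)
  fix x y z
  assume x: "x \<in> {x \<in> carrier P. x i \<in> A}" and y: "y \<in> {x \<in> carrier P. x i \<in> A}"
    and z: "z \<in> carrier P" "x \<sqsubseteq>\<^bsub>P\<^esub> z" "z \<sqsubseteq>\<^bsub>P\<^esub> y"
  have "x i \<in> A" "y i \<in> A" "x i \<sqsubseteq>\<^bsub>T i\<^esub> z i" "z i \<sqsubseteq>\<^bsub>T i\<^esub> y i"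
    using x y z i by (simp_all add: prod_order_simps(2))
  with A coord[OF z(1) i] have "z i \<in> A" unfolding poset_interval_def by blast
  with z(1) show "z \<in> {x \<in> carrier P. x i \<in> A}" by blast
next
  fix x y assume xy: "x \<in> {x \<in> carrier P. x i \<in> A}" "y \<in> {x \<in> carrier P. x i \<in> A}"
  define z where "z = (\<lambda>k\<in>I. if x k \<sqsubseteq>\<^bsub>T k\<^esub> y k then y k else x k)"
  have le: "x k \<sqsubseteq>\<^bsub>T k\<^esub> z k \<and> y k \<sqsubseteq>\<^bsub>T k\<^esub> z k" if k: "k \<in> I" for k
  proof -
    have "x k \<in> carrier (T k)" "y k \<in> carrier (T k)" using xy coord k by simp_all
    then show ?thesis using T_refl[OF k] total_order.total_order_total[OF T[OF k]] k
      by (simp add: z_def) blast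
  qed
  have "z \<in> carrier P" unfolding prod_order_simps(1)
    using xy coord by (intro PiE_I) (auto simp: z_def)
  moreover have "z i \<in> A" using xy i by (simp add: z_def)
  ultimately show "\<exists>z\<in>{x \<in> carrier P. x i \<in> A}. x \<sqsubseteq>\<^bsub>P\<^esub> z \<and> y \<sqsubseteq>\<^bsub>P\<^esub> z"
    using le by (intro bexI[of _ z]) (simp_all add: prod_order_simps(2))
qed (simp_all add: P_refl)

end

text \<open>Coordinatewise maxima and minima exist, so the joins and meets in the bidegree condition
  are genuine bounds.\<close>

lemma (in grid) lattice_P: "lattice P"
proof -
  have "\<exists>s. least P s (Upper P {x, y})" "\<exists>s. greatest P s (Lower P {x, y})"
    if x: "x \<in> carrier P" and y: "y \<in> carrier P" for x y
  proof -
    define s where "s = (\<lambda>k\<in>I. if x k \<sqsubseteq>\<^bsub>T k\<^esub> y k then y k else x k)"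
    define l where "l = (\<lambda>k\<in>I. if x k \<sqsubseteq>\<^bsub>T k\<^esub> y k then x k else y k)"
    have sl: "x k \<sqsubseteq>\<^bsub>T k\<^esub> s k" "y k \<sqsubseteq>\<^bsub>T k\<^esub> s k" "l k \<sqsubseteq>\<^bsub>T k\<^esub> x k" "l k \<sqsubseteq>\<^bsub>T k\<^esub> y k" if k: "k \<in> I" for k
      using total_order.total_order_total[OF T[OF k] coord[OF x k] coord[OF y k]] k
        T_refl[OF k coord[OF x k]] T_refl[OF k coord[OF y k]]
      by (auto simp: s_def l_def)
    have "s \<in> carrier P" "l \<in> carrier P"
      using coord[OF x] coord[OF y] by (auto simp: s_def l_def prod_order_simps(1))
    then have "least P s (Upper P {x, y})" "greatest P l (Lower P {x, y})"
      using sl x y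
      by (auto simp: least_def Upper_def greatest_def Lower_def prod_order_simps(2) s_def l_def)
    then show "\<exists>s. least P s (Upper P {x, y})" "\<exists>s. greatest P s (Lower P {x, y})" by blast+
  qed
  then show ?thesis
    using partial_order_P
    by (simp add: lattice_def upper_semilattice_def lower_semilattice_def
        upper_semilattice_axioms_def lower_semilattice_axioms_def)
qed

text \<open>Bidegree one in terms of elements. With functoriality, the three conditions on squares
  amount to exactness of \<open>0 -> G m -> G x + G y -> G z -> 0\<close>, where \<open>m\<close>
  and \<open>z\<close> are the meet and the join of \<open>x\<close> and \<open>y\<close>, the first
  map carries a sign in its second entry, and the second map adds.\<close>

locale bidegree_one_functor = grid I T + ambient_space scale
  for I :: "'i set" and T :: "'i \<Rightarrow> 'a gorder" and scale :: "'k::field \<Rightarrow> 'b::ab_group_add \<Rightarrow> 'b" +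
  fixes G :: "('i \<Rightarrow> 'a) \<Rightarrow> 'b set" and \<gamma> :: "('i \<Rightarrow> 'a) \<Rightarrow> ('i \<Rightarrow> 'a) \<Rightarrow> 'b \<Rightarrow> 'b"
  assumes functor_G: "subspace_functor (prod_order I T) G \<gamma>"
    and pushout_gen: "\<And>x y d. x \<in> carrier (prod_order I T) \<Longrightarrow> y \<in> carrier (prod_order I T) \<Longrightarrow>
      d \<in> G (x \<squnion>\<^bsub>prod_order I T\<^esub> y) \<Longrightarrow>
      \<exists>u\<in>G x. \<exists>w\<in>G y. d = \<gamma> x (x \<squnion>\<^bsub>prod_order I T\<^esub> y) u + \<gamma> y (x \<squnion>\<^bsub>prod_order I T\<^esub> y) w"
    and pushout_rel: "\<And>x y u w. x \<in> carrier (prod_order I T) \<Longrightarrow> y \<in> carrier (prod_order I T) \<Longrightarrow>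
      u \<in> G x \<Longrightarrow> w \<in> G y \<Longrightarrow>
      \<gamma> x (x \<squnion>\<^bsub>prod_order I T\<^esub> y) u + \<gamma> y (x \<squnion>\<^bsub>prod_order I T\<^esub> y) w = 0 \<Longrightarrow>
      \<exists>a\<in>G (x \<sqinter>\<^bsub>prod_order I T\<^esub> y). u = \<gamma> (x \<sqinter>\<^bsub>prod_order I T\<^esub> y) x a \<and>
        w = - \<gamma> (x \<sqinter>\<^bsub>prod_order I T\<^esub> y) y a"
    and pullback_inj: "\<And>x y a. x \<in> carrier (prod_order I T) \<Longrightarrow> y \<in> carrier (prod_order I T) \<Longrightarrow>
      a \<in> G (x \<sqinter>\<^bsub>prod_order I T\<^esub> y) \<Longrightarrow> \<gamma> (x \<sqinter>\<^bsub>prod_order I T\<^esub> y) x a = 0 \<Longrightarrow>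
      \<gamma> (x \<sqinter>\<^bsub>prod_order I T\<^esub> y) y a = 0 \<Longrightarrow> a = 0"
begin

section \<open>The value at a point in terms of the values on the axes below it\<close>

lemmas G_subspace = subspace_functorD(1)[OF functor_G]
  and G_finite = subspace_functorD(2)[OF functor_G]
  and lin = subspace_functorD(3)[OF functor_G]
  and maps = subspace_functorD(4)[OF functor_G]
  and map_id = subspace_functorD(5)[OF functor_G]
  and comp = subspace_functorD(6)[OF functor_G]

lemma map_hom:
  assumes "x \<in> carrier P" "y \<in> carrier P" "x \<sqsubseteq>\<^bsub>P\<^esub> y"
  shows "\<gamma> x y 0 = 0" "\<gamma> x y (u + v) = \<gamma> x y u + \<gamma> x y v" "\<gamma> x y (- u) = - \<gamma> x y u"
    "\<gamma> x y (u - v) = \<gamma> x y u - \<gamma> x y v" "\<gamma> x y (scale c u) = scale c (\<gamma> x y u)"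
    "\<gamma> x y (\<Sum>k\<in>S. h k) = (\<Sum>k\<in>S. \<gamma> x y (h k))"
proof -
  interpret l: Vector_Spaces.linear scale scale "\<gamma> x y" by (rule lin[OF assms])
  show "\<gamma> x y 0 = 0" "\<gamma> x y (u + v) = \<gamma> x y u + \<gamma> x y v" "\<gamma> x y (- u) = - \<gamma> x y u"
    "\<gamma> x y (u - v) = \<gamma> x y u - \<gamma> x y v" "\<gamma> x y (scale c u) = scale c (\<gamma> x y u)"
    "\<gamma> x y (\<Sum>k\<in>S. h k) = (\<Sum>k\<in>S. \<gamma> x y (h k))"
    by (simp_all add: l.zero l.add l.neg l.diff l.scale l.sum)
qed

text \<open>Each coordinate adjoined to \<open>S\<close> peels off one axis term, by surjectivity
  onto the value at the join; the remaining vector lives on the smaller face.\<close>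

lemma generated_by_axes:
  assumes x: "x \<in> carrier P" and S: "finite S"
  shows "S \<subseteq> I \<Longrightarrow> v \<in> G (cut S x) \<Longrightarrow> \<exists>c u. c \<in> G bot \<and> (\<forall>i\<in>S. u i \<in> G (ax i (x i))) \<and>
    v = \<gamma> bot (cut S x) c + (\<Sum>i\<in>S. \<gamma> (ax i (x i)) (cut S x) (u i))"
  using S
proof (induction S arbitrary: v rule: finite_induct)
  case empty
  then show ?case using map_id[of bot v] by (intro exI[of _ v]) (simp add: cut_empty)
next
  case (insert j S)
  let ?y = "cut S x" and ?z = "cut (insert j S) x" and ?a = "\<lambda>i. ax i (x i)"
  have j: "j \<in> I" "j \<notin> S" and SI: "S \<subseteq> I" using insert by auto
  have inP: "?y \<in> carrier P" "?z \<in> carrier P" "?a j \<in> carrier P"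
    using cut_in ax_in coord x j by simp_all
  have yz: "?y \<sqsubseteq>\<^bsub>P\<^esub> ?z" by (rule cut_le[OF x]) auto
  obtain w w' where w: "w \<in> G ?y" "w' \<in> G (?a j)" "v = \<gamma> ?y ?z w + \<gamma> (?a j) ?z w'"
    using pushout_gen[OF inP(1,3), of v] insert.prems(2) by (auto simp: join_cut_ax[OF x j])
  from insert.IH[OF SI w(1)] obtain c u where cu: "c \<in> G bot" "\<forall>i\<in>S. u i \<in> G (?a i)"
    "w = \<gamma> bot ?y c + (\<Sum>i\<in>S. \<gamma> (?a i) ?y (u i))" by blast
  have "\<gamma> ?y ?z w = \<gamma> bot ?z c + (\<Sum>i\<in>S. \<gamma> (?a i) ?z (u i))"
  proof -
    have "\<gamma> ?y ?z (\<gamma> bot ?y c) = \<gamma> bot ?z c"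
      by (rule comp[OF bot_in inP(1,2) bot_le[OF inP(1)] yz cu(1)])
    moreover have "\<gamma> ?y ?z (\<gamma> (?a i) ?y (u i)) = \<gamma> (?a i) ?z (u i)" if i: "i \<in> S" for i
    proof (rule comp[OF _ inP(1,2) _ yz])
      show "?a i \<in> carrier P" using ax_in coord x SI i by blast
      show "?a i \<sqsubseteq>\<^bsub>P\<^esub> ?y" by (rule ax_le_cut[OF x i])
      show "u i \<in> G (?a i)" using cu(2) i by blast
    qed
    ultimately show ?thesis by (simp add: cu(3) map_hom[OF inP(1,2) yz])
  qed
  then have "v = \<gamma> bot ?z c + (\<Sum>i\<in>insert j S. \<gamma> (?a i) ?z ((u(j := w')) i))"
  proof -
    have "(\<Sum>i\<in>S. \<gamma> (?a i) ?z ((u(j := w')) i)) = (\<Sum>i\<in>S. \<gamma> (?a i) ?z (u i))"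
      using j by (intro sum.cong) auto
    then show ?thesis using \<open>\<gamma> ?y ?z w = _\<close> w(3) insert.hyps by (simp add: add_ac)
  qed
  moreover have "\<forall>i\<in>insert j S. (u(j := w')) i \<in> G (?a i)" using cu(2) w(2) by simp
  ultimately show ?case using cu(1) by blast
qed

text \<open>Exactness in the middle: a relation on the larger face splits into \<open>w\<close> on
  the smaller face and \<open>u j\<close> on the new axis, and these are, up to sign, the images of
  a common \<open>a\<close> over \<open>bot\<close>. Subtracting \<open>a\<close> from
  \<open>c\<close> leaves a relation on the smaller face.\<close>

lemma relations_from_bot:
  assumes x: "x \<in> carrier P" and S: "finite S"
  shows "S \<subseteq> I \<Longrightarrow> c \<in> G bot \<Longrightarrow> \<forall>i\<in>S. u i \<in> G (ax i (x i)) \<Longrightarrow>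
    \<gamma> bot (cut S x) c + (\<Sum>i\<in>S. \<gamma> (ax i (x i)) (cut S x) (u i)) = 0 \<Longrightarrow>
    \<exists>a. (\<forall>i\<in>S. a i \<in> G bot \<and> u i = \<gamma> bot (ax i (x i)) (a i)) \<and> c + (\<Sum>i\<in>S. a i) = 0"
  using S
\<comment> \<open>The induction hypothesis is applied to \<open>c - a\<close>, so \<open>c\<close>
  has to stay general while \<open>u\<close> is fixed.\<close>
proof (induction S arbitrary: c rule: finite_induct)
  case empty
  then show ?case using map_id[of bot c] by (simp add: cut_empty)
next
  case (insert j S)
  let ?y = "cut S x" and ?z = "cut (insert j S) x" and ?a = "\<lambda>i. ax i (x i)"
  have j: "j \<in> I" "j \<notin> S" and SI: "S \<subseteq> I" using insert by auto
  have inP: "?y \<in> carrier P" "?z \<in> carrier P" "?a j \<in> carrier P"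
    using cut_in ax_in coord x j by simp_all
  have yz: "?y \<sqsubseteq>\<^bsub>P\<^esub> ?z" by (rule cut_le[OF x]) auto
  have by_: "bot \<sqsubseteq>\<^bsub>P\<^esub> ?y" by (rule bot_le[OF inP(1)])
  define w where "w = \<gamma> bot ?y c + (\<Sum>i\<in>S. \<gamma> (?a i) ?y (u i))"
  have aS: "?a i \<in> carrier P" "?a i \<sqsubseteq>\<^bsub>P\<^esub> ?y" "u i \<in> G (?a i)" if "i \<in> S" for i
    using ax_in coord x SI that ax_le_cut[OF x that] insert.prems(3) by blast+
  have wy: "w \<in> G ?y" unfolding w_def
    by (intro subspace_add[OF G_subspace[OF inP(1)]] subspace_sum[OF G_subspace[OF inP(1)]]
        maps[OF bot_in inP(1) by_] insert.prems(2) maps[OF _ inP(1)] aS)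
  have "\<gamma> ?y ?z w = \<gamma> bot ?z c + (\<Sum>i\<in>S. \<gamma> (?a i) ?z (u i))"
  proof -
    have "\<gamma> ?y ?z (\<gamma> bot ?y c) = \<gamma> bot ?z c"
      by (rule comp[OF bot_in inP(1,2) by_ yz insert.prems(2)])
    moreover have "\<gamma> ?y ?z (\<gamma> (?a i) ?y (u i)) = \<gamma> (?a i) ?z (u i)" if i: "i \<in> S" for i
      by (rule comp[OF aS(1)[OF i] inP(1,2) aS(2)[OF i] yz aS(3)[OF i]])
    ultimately show ?thesis by (simp add: w_def map_hom[OF inP(1,2) yz])
  qed
  then have "\<gamma> ?y ?z w + \<gamma> (?a j) ?z (u j) = 0"
    using insert.prems(4) insert.hyps by (simp add: add_ac)
  then obtain a where a: "a \<in> G bot" "w = \<gamma> bot ?y a" "u j = - \<gamma> bot (?a j) a"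
    using pushout_rel[OF inP(1,3) wy, of "u j"] insert.prems(3)
    by (auto simp: join_cut_ax[OF x j] meet_cut_ax[OF x j])
  have "\<gamma> bot ?y (c - a) + (\<Sum>i\<in>S. \<gamma> (?a i) ?y (u i)) = 0"
    using a(2) by (simp add: w_def map_hom[OF bot_in inP(1) by_] algebra_simps)
  moreover have "c - a \<in> G bot" using a(1) insert.prems(2) G_subspace[OF bot_in] subspace_diff by blast
  ultimately obtain a' where a': "\<forall>i\<in>S. a' i \<in> G bot \<and> u i = \<gamma> bot (?a i) (a' i)"
    "c - a + (\<Sum>i\<in>S. a' i) = 0"
    using insert.IH[of "c - a"] SI insert.prems(3) by blast
  \<comment> \<open>The entry at \<open>j\<close> is \<open>- a\<close>, with the sign from
    exactness; in the total sum it accounts for the \<open>a\<close> that was subtracted from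
    \<open>c\<close>.\<close>
  have "\<forall>i\<in>insert j S. (a'(j := - a)) i \<in> G bot \<and> u i = \<gamma> bot (?a i) ((a'(j := - a)) i)"
    using a' a subspace_neg[OF G_subspace[OF bot_in]]
      map_hom(3)[OF bot_in inP(3) bot_le[OF inP(3)]] by auto
  moreover have "c + (\<Sum>i\<in>insert j S. (a'(j := - a)) i) = 0"
  proof -
    have "(\<Sum>i\<in>S. (a'(j := - a)) i) = (\<Sum>i\<in>S. a' i)" using j by (intro sum.cong) auto
    then show ?thesis using a'(2) insert.hyps by (simp add: algebra_simps)
  qed
  ultimately show ?case by blast
qed

text \<open>If the \<open>a i\<close> sum to zero, then \<open>a j\<close> is minus the sum of the
  others. These die on their own axes, hence on the face \<open>cut S x\<close>, so
  \<open>a j\<close> dies there as well as on axis \<open>j\<close>. The two points meet in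
  \<open>bot\<close>, and a vector that dies at both is zero.\<close>

lemma kernels_independent:
  assumes x: "x \<in> carrier P" and S: "finite S"
  shows "S \<subseteq> I \<Longrightarrow> \<forall>i\<in>S. a i \<in> G bot \<and> \<gamma> bot (ax i (x i)) (a i) = 0 \<Longrightarrow> (\<Sum>i\<in>S. a i) = 0 \<Longrightarrow>
    \<forall>i\<in>S. a i = 0"
  using S
proof (induction S rule: finite_induct)
  case (insert j S)
  let ?y = "cut S x" and ?a = "\<lambda>i. ax i (x i)"
  have j: "j \<in> I" "j \<notin> S" and SI: "S \<subseteq> I" using insert by auto
  have inP: "?y \<in> carrier P" "?a j \<in> carrier P" using cut_in ax_in coord x j by simp_all
  have by_: "bot \<sqsubseteq>\<^bsub>P\<^esub> ?y" by (rule bot_le[OF inP(1)])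
  have dies: "\<gamma> bot ?y (a i) = 0" if i: "i \<in> S" for i
  proof -
    have ai: "?a i \<in> carrier P" using ax_in coord x SI i by blast
    have iy: "?a i \<sqsubseteq>\<^bsub>P\<^esub> ?y" by (rule ax_le_cut[OF x i])
    have "\<gamma> bot ?y (a i) = \<gamma> (?a i) ?y (\<gamma> bot (?a i) (a i))"
      using comp[OF bot_in ai inP(1) bot_le[OF ai] iy, of "a i"] insert.prems(2) i by simp
    then show ?thesis using insert.prems(2) i map_hom(1)[OF ai inP(1) iy] by simp
  qed
  have aj: "a j = - (\<Sum>i\<in>S. a i)" using insert.prems(3) insert.hyps by (simp add: eq_neg_iff_add_eq_0)
  have "\<gamma> bot ?y (a j) = 0" by (simp add: aj map_hom[OF bot_in inP(1) by_] dies)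
  then have "a j = 0"
    using pullback_inj[OF inP, of "a j"] insert.prems(2) by (simp add: meet_cut_ax[OF x j])
  moreover from this have "(\<Sum>i\<in>S. a i) = 0" using aj by simp
  then have "\<forall>i\<in>S. a i = 0" using insert.IH[OF SI] insert.prems(2) by blast
  ultimately show ?case by blast
qed simp

text \<open>Labels and intervals do not depend on the point. At each \<open>x\<close> the basis is
  assembled by \<open>family_basis_Sigma\<close> from bases of \<open>C\<close> and of the
  \<open>M i (x i)\<close>, carried up to \<open>x\<close> from the bottom and from the
  axes.\<close>

lemma ex_interval_basis: "\<exists>(J :: nat set) A m. interval_basis P G \<gamma> J A m"
proof -
  define e where "e i = ax i (top_pt i)" for i
  have eP: "e i \<in> carrier P" if "i \<in> I" for i using that ax_in top_pt(1) by (simp add: e_def)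
  have axe: "ax i t \<sqsubseteq>\<^bsub>P\<^esub> e i" if "i \<in> I" "t \<in> carrier (T i)" for i t
    using that ax_le top_pt(2) by (simp add: e_def)
  define K where "K i = {a \<in> G bot. \<gamma> bot (e i) a = 0}" for i
  define KS where "KS = {\<Sum>i\<in>I. a i | a. \<forall>i\<in>I. a i \<in> K i}"
  have K_sub: "local.subspace (K i)" if i: "i \<in> I" for i
    using G_subspace[OF bot_in] map_hom[OF bot_in eP[OF i] bot_le[OF eP[OF i]]]
    by (simp add: K_def local.subspace_def)
  have KS_sub: "local.subspace KS"
    unfolding local.subspace_def
  proof (intro conjI allI ballI)
    show "0 \<in> KS" unfolding KS_def using K_sub subspace_0
      by (intro CollectI exI[of _ "\<lambda>_. 0"]) simp
  next
    fix v w assume "v \<in> KS" "w \<in> KS"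
    then obtain a b where ab: "v = sum a I" "w = sum b I" "\<forall>i\<in>I. a i \<in> K i" "\<forall>i\<in>I. b i \<in> K i"
      by (auto simp: KS_def)
    then show "v + w \<in> KS" unfolding KS_def using subspace_add[OF K_sub]
      by (intro CollectI exI[of _ "\<lambda>i. a i + b i"]) (simp add: sum.distrib)
  next
    fix c v assume "v \<in> KS"
    then obtain a where a: "v = sum a I" "\<forall>i\<in>I. a i \<in> K i" by (auto simp: KS_def)
    then show "scale c v \<in> KS" unfolding KS_def using subspace_scale[OF K_sub]
      by (intro CollectI exI[of _ "\<lambda>i. scale c (a i)"]) (simp add: scale_sum_right)
  qed
  have KS_bot: "KS \<subseteq> G bot"
    using subspace_sum[OF G_subspace[OF bot_in], of I] by (auto simp: KS_def K_def)
  obtain C where C: "local.subspace C" "C \<subseteq> G bot" "C \<inter> KS = {0}"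
    and C_gen: "\<And>w. w \<in> G bot \<Longrightarrow> \<exists>n\<in>C. \<exists>u\<in>KS. w = n + u"
    using subspace_complement[OF G_subspace[OF bot_in] KS_sub KS_bot] by blast
  define Im where "Im i = \<gamma> bot (e i) ` G bot" for i
  have "\<exists>N. local.subspace N \<and> N \<subseteq> G (e i) \<and> N \<inter> Im i = {0} \<and>
      (\<forall>w\<in>G (e i). \<exists>n\<in>N. \<exists>u\<in>Im i. w = n + u)" if i: "i \<in> I" for i
  proof -
    interpret l: Vector_Spaces.linear scale scale "\<gamma> bot (e i)"
      by (rule lin[OF bot_in eP[OF i] bot_le[OF eP[OF i]]])
    have "local.subspace (Im i)"
      unfolding Im_def by (rule l.subspace_image[OF G_subspace[OF bot_in]])
    moreover have "Im i \<subseteq> G (e i)"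
      using maps[OF bot_in eP[OF i] bot_le[OF eP[OF i]]] by (auto simp: Im_def)
    ultimately show ?thesis
      using subspace_complement[OF G_subspace[OF eP[OF i]], of "Im i"] by metis
  qed
  then obtain N where N: "\<And>i. i \<in> I \<Longrightarrow> local.subspace (N i)" "\<And>i. i \<in> I \<Longrightarrow> N i \<inter> Im i = {0}"
    "\<And>i w. i \<in> I \<Longrightarrow> w \<in> G (e i) \<Longrightarrow> \<exists>n\<in>N i. \<exists>u\<in>Im i. w = n + u" by metis
  \<comment> \<open>\<open>M i (bot i)\<close> is \<open>K i\<close> because \<open>N i\<close>
    meets \<open>Im i\<close> only in 0.\<close>
  define M where "M i t = {w \<in> G (ax i t). \<gamma> (ax i t) (e i) w \<in> N i}" for i t
  define f where "f i s t = \<gamma> (ax i s) (ax i t)" for i s t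
  have MG: "M i t \<subseteq> G (ax i t)" for i t by (auto simp: M_def)
  have M_sub: "local.subspace (M i t)" if it: "i \<in> I" "t \<in> carrier (T i)" for i t
    using G_subspace[OF ax_in[OF it]] map_hom[OF ax_in[OF it] eP[OF it(1)] axe[OF it]] N(1)[OF it(1)]
    by (simp add: M_def local.subspace_def)
  have M_functor: "subspace_functor (T i) (M i) (f i)" if i: "i \<in> I" for i
    unfolding subspace_functor_def
  proof (intro conjI ballI impI)
    fix t assume t: "t \<in> carrier (T i)"
    show "local.subspace (M i t)" by (rule M_sub[OF i t])
    show "\<exists>S. finite S \<and> M i t \<subseteq> span S" using G_finite[OF ax_in[OF i t]] MG by blast
    show "f i t t v = v" if "v \<in> M i t" for v
      using map_id[OF ax_in[OF i t]] that by (auto simp: f_def M_def)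
  next
    fix s t assume st: "s \<in> carrier (T i)" "t \<in> carrier (T i)" "s \<sqsubseteq>\<^bsub>T i\<^esub> t"
    note a = ax_in[OF i st(1)] ax_in[OF i st(2)] ax_le[OF i st(3)]
    show "Vector_Spaces.linear scale scale (f i s t)" unfolding f_def by (rule lin[OF a])
    show "f i s t ` M i s \<subseteq> M i t"
      using maps[OF a] comp[OF a(1,2) eP[OF i] a(3) axe[OF i st(2)]] by (auto simp: f_def M_def)
  next
    fix s t u v assume st: "s \<in> carrier (T i)" "t \<in> carrier (T i)" "u \<in> carrier (T i)"
      "s \<sqsubseteq>\<^bsub>T i\<^esub> t \<and> t \<sqsubseteq>\<^bsub>T i\<^esub> u" "v \<in> M i s"
    show "f i t u (f i s t v) = f i s u v"
      unfolding f_def using st MG ax_in[OF i] ax_le[OF i] by (intro comp) auto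
  qed
  have "\<forall>i\<in>I. \<exists>(J :: nat set) A m. interval_basis (T i) (M i) (f i) J A m"
    using chain_interval_basis[OF T finT M_functor] by blast
  then obtain J :: "'i \<Rightarrow> nat set" and A m
    where IB: "\<And>i. i \<in> I \<Longrightarrow> interval_basis (T i) (M i) (f i) (J i) (A i) (m i)" by metis
  obtain J0 :: "nat set" and m0 where J0: "family_basis J0 m0 C"
    using G_finite[OF bot_in] C(2) family_basis_exists[of C] by blast
  have m0: "j \<in> J0 \<Longrightarrow> m0 j \<in> G bot" for j using family_basisD(2)[OF J0] C(2) by blast
  have m: "m i j t \<in> M i t" if "i \<in> I" "t \<in> carrier (T i)" "j \<in> J i" "t \<in> A i j" for i j t
    using IB[OF that(1)] that family_basisD(2)[of "{j \<in> J i. t \<in> A i j}" "\<lambda>j. m i j t" "M i t" j]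
    by (simp add: interval_basis_def)
  \<comment> \<open>\<open>None\<close> labels the constant part and \<open>Some i\<close> the part
    pulled back from the i-th axis; a bar is named by such a label together with a label within that
    part.\<close>
  define L where "L = insert None (Some ` I)"
  define J' where "J' k = (case k of None \<Rightarrow> J0 | Some i \<Rightarrow> J i)" for k
  define A' where "A' p = (case p of (None, j) \<Rightarrow> carrier P
    | (Some i, j) \<Rightarrow> {x \<in> carrier P. x i \<in> A i j})" for p
  define m' where "m' p x = (case p of (None, j) \<Rightarrow> \<gamma> bot x (m0 j)
    | (Some i, j) \<Rightarrow> \<gamma> (ax i (x i)) x (m i j (x i)))" for p x
  have finL: "finite L" using finI by (simp add: L_def)
  have sum_L: "(\<Sum>k\<in>L. h k) = h None + (\<Sum>i\<in>I. h (Some i))" for h :: "'i option \<Rightarrow> 'b"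
  proof -
    have "(\<Sum>k\<in>Some ` I. h k) = (\<Sum>i\<in>I. h (Some i))" by (subst sum.reindex) (auto simp: inj_on_def)
    then show ?thesis using finI by (simp add: L_def)
  qed
  have "interval_basis P G \<gamma> (Sigma L J') A' m'"
    unfolding interval_basis_def
  proof (intro conjI ballI impI)
    show "finite (Sigma L J')"
      using finL family_basisD(1)[OF J0] IB
      by (intro finite_SigmaI) (auto simp: L_def J'_def interval_basis_def)
  next
    fix p assume "p \<in> Sigma L J'"
    then consider j where "p = (None, j)" "j \<in> J0" | i j where "p = (Some i, j)" "i \<in> I" "j \<in> J i"
      by (auto simp: L_def J'_def)
    then show "poset_interval P (A' p)"
    proof cases
      case 1
      have "poset_interval P (carrier P)"
      proof (rule poset_interval_directedI)
        fix x y assume "x \<in> carrier P" "y \<in> carrier P"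
        then show "\<exists>z\<in>carrier P. x \<sqsubseteq>\<^bsub>P\<^esub> z \<and> y \<sqsubseteq>\<^bsub>P\<^esub> z"
          using coord top_pt(2) by (intro bexI[OF _ top_pt_in]) (simp add: prod_order_simps(2))
      qed (simp_all add: P_refl)
      then show ?thesis using 1 by (simp add: A'_def)
    next
      case 2
      then show ?thesis using IB[of i] poset_interval_cylinder[of i "A i j"]
        by (simp add: A'_def interval_basis_def)
    qed
  next
    fix p x y assume p: "p \<in> Sigma L J'" and x: "x \<in> A' p" and y: "y \<in> carrier P" "x \<sqsubseteq>\<^bsub>P\<^esub> y"
    have xP: "x \<in> carrier P" using x by (auto simp: A'_def split: prod.splits option.splits)
    from p consider j where "p = (None, j)" "j \<in> J0" | i j where "p = (Some i, j)" "i \<in> I" "j \<in> J i"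
      by (auto simp: L_def J'_def)
    then show "\<gamma> x y (m' p x) = (if y \<in> A' p then m' p y else 0)"
    proof cases
      case 1
      then show ?thesis using comp[OF bot_in xP y(1) bot_le[OF xP] y(2) m0] y(1)
        by (simp add: A'_def m'_def)
    next
      case 2
      have xi: "x i \<in> A i j" using x 2 by (simp add: A'_def)
      note c = coord[OF xP 2(2)] coord[OF y(1) 2(2)]
      have le: "x i \<sqsubseteq>\<^bsub>T i\<^esub> y i" using y(2) 2(2) by (simp add: prod_order_simps(2))
      note a = ax_in[OF 2(2) c(1)] ax_in[OF 2(2) c(2)] ax_le[OF 2(2) le]
        ax_le_self[OF xP 2(2)] ax_le_self[OF y(1) 2(2)]
      have mG: "m i j (x i) \<in> G (ax i (x i))" using m[OF 2(2) c(1) 2(3) xi] MG by blast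
      \<comment> \<open>The composite through \<open>x\<close> is rerouted along the i-th axis, from
        \<open>x i\<close> to \<open>y i\<close> and then up to \<open>y\<close>, so that the
        interval basis of \<open>M i\<close> decides whether the bar survives.\<close>
      have "\<gamma> x y (\<gamma> (ax i (x i)) x (m i j (x i))) = \<gamma> (ax i (x i)) y (m i j (x i))"
        by (rule comp[OF a(1) xP y(1) a(4) y(2) mG])
      also have "\<dots> = \<gamma> (ax i (y i)) y (f i (x i) (y i) (m i j (x i)))"
        unfolding f_def by (rule comp[OF a(1,2) y(1) a(3,5) mG, symmetric])
      also have "f i (x i) (y i) (m i j (x i)) = (if y i \<in> A i j then m i j (y i) else 0)"
        using IB[OF 2(2)] 2(3) xi c(2) le unfolding interval_basis_def by blast
      finally show ?thesis
        using 2 y(1) map_hom(1)[OF a(2) y(1) a(5)] by (simp add: A'_def m'_def)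
    qed
  next
    fix x assume x: "x \<in> carrier P"
    define Jx where "Jx k = (case k of None \<Rightarrow> J0 | Some i \<Rightarrow> {j \<in> J i. x i \<in> A i j})" for k
    define mx where "mx k = (case k of None \<Rightarrow> m0 | Some i \<Rightarrow> (\<lambda>j. m i j (x i)))" for k
    define W where "W k = (case k of None \<Rightarrow> C | Some i \<Rightarrow> M i (x i))" for k
    define g where "g k = (case k of None \<Rightarrow> \<gamma> bot x | Some i \<Rightarrow> \<gamma> (ax i (x i)) x)" for k
    note xi = coord[OF x] and xx = ax_le_self[OF x] and bx = bot_le[OF x]
    note axx = ax_in[OF _ xi]
    \<comment> \<open>Vectors of \<open>K i\<close> vanish at the end of the axis, and 0 lies in
      \<open>N i\<close>.\<close>
    have K_M: "\<gamma> bot (ax i (x i)) a \<in> M i (x i)" if "i \<in> I" "a \<in> K i" for i a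
    proof -
      note ai = axx[OF that(1) that(1)]
      have aG: "a \<in> G bot" and a0: "\<gamma> bot (e i) a = 0" using that(2) by (auto simp: K_def)
      have "\<gamma> (ax i (x i)) (e i) (\<gamma> bot (ax i (x i)) a) = \<gamma> bot (e i) a"
        by (rule comp[OF bot_in ai eP[OF that(1)] bot_le[OF ai] axe[OF that(1) xi[OF that(1)]] aG])
      then show ?thesis using a0 maps[OF bot_in ai bot_le[OF ai] aG] subspace_0[OF N(1)[OF that(1)]]
        by (simp add: M_def)
    qed
    have "family_basis (Sigma L Jx) (\<lambda>(k, j). g k (mx k j)) (G x)"
    proof (rule family_basis_Sigma[where g = g and m = mx and W = W, OF finL])
      fix k assume k: "k \<in> L"
      show "family_basis (Jx k) (mx k) (W k)"
        using k J0 IB xi by (auto simp: L_def Jx_def mx_def W_def interval_basis_def)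
      show "Vector_Spaces.linear scale scale (g k)"
        using k lin[OF bot_in x bx] lin[OF axx x xx] by (auto simp: L_def g_def)
      show "local.subspace (W k)" using k C(1) M_sub xi by (auto simp: L_def W_def)
      show "g k ` W k \<subseteq> G x"
        using k maps[OF bot_in x bx] C(2) maps[OF axx x xx] MG by (fastforce simp: L_def g_def W_def)
    next
      fix v assume v: "v \<in> G x"
      obtain c u where cu: "c \<in> G bot" "\<forall>i\<in>I. u i \<in> G (ax i (x i))"
        "v = \<gamma> bot x c + (\<Sum>i\<in>I. \<gamma> (ax i (x i)) x (u i))"
        using generated_by_axes[OF x finI subset_refl, of v] v by (auto simp: cut_all[OF x])
      \<comment> \<open>The contribution of the bottom is removed from each axis component: its
        image at the end of the axis is decomposed along \<open>N i\<close> and \<open>Im i\<close>,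
        and a preimage \<open>d\<close> of the second part is transported to the axis and
        subtracted.\<close>
      have "\<exists>d n. d \<in> G bot \<and> n \<in> M i (x i) \<and> u i = n + \<gamma> bot (ax i (x i)) d" if i: "i \<in> I" for i
      proof -
        note ai = axx[OF i i]
        note h = map_hom[OF ai eP[OF i] axe[OF i xi[OF i]]]
        have ui: "u i \<in> G (ax i (x i))" using cu(2) i by blast
        obtain n d where nd: "n \<in> N i" "d \<in> G bot" "\<gamma> (ax i (x i)) (e i) (u i) = n + \<gamma> bot (e i) d"
          using N(3)[OF i maps[OF ai eP[OF i] axe[OF i xi[OF i]] ui]] by (auto simp: Im_def)
        have "\<gamma> (ax i (x i)) (e i) (\<gamma> bot (ax i (x i)) d) = \<gamma> bot (e i) d"
          by (rule comp[OF bot_in ai eP[OF i] bot_le[OF ai] axe[OF i xi[OF i]] nd(2)])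
        then have "u i - \<gamma> bot (ax i (x i)) d \<in> M i (x i)"
          using nd ui maps[OF bot_in ai bot_le[OF ai] nd(2)] subspace_diff[OF G_subspace[OF ai]]
          by (simp add: M_def h)
        then show ?thesis using nd(2)
          by (intro exI[of _ d] exI[of _ "u i - \<gamma> bot (ax i (x i)) d"]) simp
      qed
      then obtain d n where dn: "\<And>i. i \<in> I \<Longrightarrow> d i \<in> G bot" "\<And>i. i \<in> I \<Longrightarrow> n i \<in> M i (x i)"
        "\<And>i. i \<in> I \<Longrightarrow> u i = n i + \<gamma> bot (ax i (x i)) (d i)" by metis
      \<comment> \<open>All contributions of the bottom are collected and decomposed along
        \<open>C\<close> and the \<open>K i\<close>. The \<open>k i\<close> then return to their
        axes, where \<open>K_M\<close> places them in \<open>M i (x i)\<close>.\<close>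
      have "c + (\<Sum>i\<in>I. d i) \<in> G bot"
        using cu(1) dn(1) by (intro subspace_add subspace_sum G_subspace bot_in) auto
      then obtain c0 k where ck: "c0 \<in> C" "\<forall>i\<in>I. k i \<in> K i" "c + (\<Sum>i\<in>I. d i) = c0 + (\<Sum>i\<in>I. k i)"
        using C_gen by (fastforce simp: KS_def)
      have via: "\<gamma> (ax i (x i)) x (\<gamma> bot (ax i (x i)) b) = \<gamma> bot x b" if "i \<in> I" "b \<in> G bot" for i b
        by (rule comp[OF bot_in axx[OF that(1,1)] x bot_le[OF axx[OF that(1,1)]] xx[OF that(1)] that(2)])
      have kG: "k i \<in> G bot" if "i \<in> I" for i using ck(2) that by (auto simp: K_def)
      define w where "w l = (case l of None \<Rightarrow> c0 | Some i \<Rightarrow> n i + \<gamma> bot (ax i (x i)) (k i))" for l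
      have "(\<Sum>l\<in>L. g l (w l)) = \<gamma> bot x c0 + (\<Sum>i\<in>I. \<gamma> (ax i (x i)) x (n i) + \<gamma> bot x (k i))"
        unfolding sum_L using via kG
        by (simp add: g_def w_def map_hom(2)[OF axx x xx])
      also have "\<dots> = \<gamma> bot x (c0 + (\<Sum>i\<in>I. k i)) + (\<Sum>i\<in>I. \<gamma> (ax i (x i)) x (n i))"
        by (simp add: sum.distrib map_hom[OF bot_in x bx])
      also have "\<dots> = \<gamma> bot x c + (\<Sum>i\<in>I. \<gamma> (ax i (x i)) x (n i) + \<gamma> bot x (d i))"
        unfolding ck(3)[symmetric] by (simp add: sum.distrib map_hom[OF bot_in x bx])
      also have "\<dots> = v"
        unfolding cu(3) using via dn by (simp add: map_hom(2)[OF axx x xx])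
      finally have "v = (\<Sum>l\<in>L. g l (w l))" by simp
      moreover have "\<forall>l\<in>L. w l \<in> W l"
        using ck dn(2) K_M M_sub[OF _ xi] subspace_add by (auto simp: L_def w_def W_def)
      ultimately show "\<exists>u. (\<forall>k\<in>L. u k \<in> W k) \<and> v = (\<Sum>k\<in>L. g k (u k))" by blast
    next
      fix u assume u: "\<forall>k\<in>L. u k \<in> W k" and z: "(\<Sum>k\<in>L. g k (u k)) = 0"
      have c: "u None \<in> C" and ui: "\<And>i. i \<in> I \<Longrightarrow> u (Some i) \<in> M i (x i)"
        using u by (auto simp: L_def W_def)
      have "\<gamma> bot x (u None) + (\<Sum>i\<in>I. \<gamma> (ax i (x i)) x (u (Some i))) = 0"
        using z by (simp add: sum_L g_def)
      then obtain a where a: "\<forall>i\<in>I. a i \<in> G bot \<and> u (Some i) = \<gamma> bot (ax i (x i)) (a i)"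
        "u None + (\<Sum>i\<in>I. a i) = 0"
        using relations_from_bot[OF x finI subset_refl, of "u None" "\<lambda>i. u (Some i)"] c C(2) ui MG
        unfolding cut_all[OF x] by blast
      \<comment> \<open>The image of \<open>a i\<close> at the end of the axis lies in both
        \<open>N i\<close> and \<open>Im i\<close>, so it is zero.\<close>
      have aK: "a i \<in> K i" if i: "i \<in> I" for i
      proof -
        have aG: "a i \<in> G bot" using a(1) i by blast
        note ai = axx[OF i i]
        have "\<gamma> bot (e i) (a i) = \<gamma> (ax i (x i)) (e i) (u (Some i))"
          using comp[OF bot_in ai eP[OF i] bot_le[OF ai] axe[OF i xi[OF i]] aG] a(1) i by simp
        then have "\<gamma> bot (e i) (a i) \<in> N i" using ui[OF i] by (simp add: M_def)
        moreover have "\<gamma> bot (e i) (a i) \<in> Im i" using aG by (simp add: Im_def)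
        ultimately show ?thesis using N(2)[OF i] aG by (auto simp: K_def)
      qed
      \<comment> \<open>As minus this sum, \<open>u None\<close> lies in \<open>KS\<close> as well
        as in \<open>C\<close>, and these meet only in 0.\<close>
      have "(\<Sum>i\<in>I. a i) \<in> KS" using aK by (auto simp: KS_def)
      then have "u None \<in> KS" using a(2) subspace_neg[OF KS_sub] by (simp add: add_eq_0_iff2)
      then have u0: "u None = 0" using c C(3) by blast
      \<comment> \<open>Independence is taken at the top point rather than at \<open>x\<close>,
        because its axis points are the ends \<open>e i\<close> that define the
        \<open>K i\<close>.\<close>
      have "\<forall>i\<in>I. a i = 0"
      proof (rule kernels_independent[OF top_pt_in finI subset_refl])
        show "\<forall>i\<in>I. a i \<in> G bot \<and> \<gamma> bot (ax i (top_pt i)) (a i) = 0"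
          using aK by (auto simp: K_def e_def)
        show "sum a I = 0" using a(2) u0 by simp
      qed
      then have "\<forall>i\<in>I. u (Some i) = 0"
        using a(1) map_hom(1)[OF bot_in axx bot_le[OF axx]] by simp
      then show "\<forall>k\<in>L. u k = 0" using u0 by (auto simp: L_def)
    qed
    moreover have "{p \<in> Sigma L J'. x \<in> A' p} = Sigma L Jx"
      using x by (auto simp: L_def J'_def A'_def Jx_def)
    moreover have "(\<lambda>p. m' p x) = (\<lambda>(k, j). g k (mx k j))"
      by (auto simp: fun_eq_iff m'_def g_def mx_def split: option.splits)
    ultimately show "family_basis {p \<in> Sigma L J'. x \<in> A' p} (\<lambda>p. m' p x) (G x)" by simp
  qed
  moreover from this have "finite (Sigma L J')" by (simp add: interval_basis_def)
  then obtain h where "bij_betw h {0..<card (Sigma L J')} (Sigma L J')"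
    using ex_bij_betw_nat_finite by blast
  ultimately show ?thesis using interval_basis_reindex by blast
qed

end

section \<open>Transfer to coordinate spaces\<close>

lemma ambient_space_fun:
  "ambient_space (\<lambda>(c :: 'k::field) (w :: 'v \<Rightarrow> 'k) v. c * w v)"
  by unfold_locales (auto simp: fun_eq_iff algebra_simps)

text \<open>Coordinates with respect to a basis \<open>B\<close> turn \<open>V\<close> into a space
  of functions on the type of its vectors, which serves as ambient space for all points of the grid
  at once. As \<open>\<theta>\<close> accepts every function and ignores its values off
  \<open>B\<close>, its linearity carries no side condition.\<close>

lemma vspace_coordinates:
  fixes V :: "('k::field, 'v) module"
  assumes "vspace V" and fd: "vectorspace.fin_dim class_ring V"
  shows "\<exists>B (\<theta> :: ('v \<Rightarrow> 'k) \<Rightarrow> 'v). finite B \<and> (\<forall>w. \<theta> w \<in> carrier V) \<and>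
    (\<forall>w w'. \<theta> (w + w') = \<theta> w \<oplus>\<^bsub>V\<^esub> \<theta> w') \<and> (\<forall>c w. \<theta> (\<lambda>v. c * w v) = c \<odot>\<^bsub>V\<^esub> \<theta> w) \<and>
    bij_betw \<theta> {w. \<forall>v. v \<notin> B \<longrightarrow> w v = 0} (carrier V)"
proof -
  interpret V: vectorspace class_ring V by (rule assms)
  obtain B where B: "finite B" "V.basis B" using V.finite_basis_exists[OF fd] by blast
  have BV: "B \<subseteq> carrier V" using B(2) by (simp add: V.basis_def)
  have fin: "a \<in> B \<rightarrow> carrier (class_ring :: 'k ring)" for a by simp
  define \<theta> where "\<theta> w = V.lincomb w B" for w
  have unique: "\<exists>!a. a \<in> B \<rightarrow>\<^sub>E carrier (class_ring :: 'k ring) \<and> V.lincomb a B = v"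
    if "v \<in> carrier V" for v
    using V.basis_criterion[OF B(1) BV] B(2) that by blast
  have restr: "\<theta> w = \<theta> w'" if "\<And>v. v \<in> B \<Longrightarrow> w v = w' v" for w w'
    unfolding \<theta>_def by (rule V.lincomb_cong[OF refl BV that fin])
  have in_V: "\<theta> w \<in> carrier V" for w unfolding \<theta>_def by (rule V.lincomb_closed[OF BV fin])
  have "bij_betw \<theta> {w. \<forall>v. v \<notin> B \<longrightarrow> w v = 0} (carrier V)"
  proof (rule bij_betw_imageI)
    show "inj_on \<theta> {w. \<forall>v. v \<notin> B \<longrightarrow> w v = 0}"
    proof (rule inj_onI)
      fix w w' assume w: "w \<in> {w. \<forall>v. v \<notin> B \<longrightarrow> w v = 0}" "w' \<in> {w. \<forall>v. v \<notin> B \<longrightarrow> w v = 0}"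
        and eq: "\<theta> w = \<theta> w'"
      have "V.lincomb (restrict w B) B = \<theta> w" "V.lincomb (restrict w' B) B = \<theta> w"
        using restr[of "restrict w B" w] restr[of "restrict w' B" w'] eq by (simp_all add: \<theta>_def)
      then have *: "restrict w B = restrict w' B"
        using unique[OF in_V[of w]] by (metis (no_types, lifting) UNIV_I restrict_PiE_iff partial_object.select_convs(1))
      show "w = w'"
      proof
        fix v show "w v = w' v"
          using w fun_cong[OF *, of v] by (cases "v \<in> B") auto
      qed
    qed
    show "\<theta> ` {w. \<forall>v. v \<notin> B \<longrightarrow> w v = 0} = carrier V"
    proof
      show "carrier V \<subseteq> \<theta> ` {w. \<forall>v. v \<notin> B \<longrightarrow> w v = 0}"
      proof
        fix v assume "v \<in> carrier V"
        then obtain a where "V.lincomb a B = v" using unique by blast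
        then have "v = \<theta> (\<lambda>v. if v \<in> B then a v else 0)"
          using restr[of a "\<lambda>v. if v \<in> B then a v else 0"] by (simp add: \<theta>_def)
        then show "v \<in> \<theta> ` {w. \<forall>v. v \<notin> B \<longrightarrow> w v = 0}" by auto
      qed
    qed (use in_V in auto)
  qed
  moreover have "\<theta> (w + w') = \<theta> w \<oplus>\<^bsub>V\<^esub> \<theta> w'" for w w'
    using V.lincomb_sum[OF B(1) BV fin fin, of w w'] by (simp add: \<theta>_def plus_fun_def)
  moreover have "\<theta> (\<lambda>v. c * w v) = c \<odot>\<^bsub>V\<^esub> \<theta> w" for c w
    using V.lincomb_smult[OF BV fin, of c w] by (simp add: \<theta>_def)
  ultimately show ?thesis using B(1) in_V by blast
qed

section \<open>Direct sums of interval modules, and inverses of natural isomorphisms\<close>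

lemma vspace_interval_module: "vspace (interval_module S x :: ('k::field, 'k) module)"
proof (rule vspaceI)
  show "abelian_group (interval_module S x :: ('k, 'k) module)"
  proof (rule abelian_groupI)
    fix v :: 'k assume "v \<in> carrier (interval_module S x)"
    then show "\<exists>w\<in>carrier (interval_module S x). w \<oplus>\<^bsub>interval_module S x\<^esub> v = \<zero>\<^bsub>interval_module S x\<^esub>"
      by (intro bexI[of _ "- v"]) (auto simp: interval_module_def split: if_splits)
  qed (auto simp: interval_module_def algebra_simps split: if_splits)
qed (auto simp: interval_module_def algebra_simps split: if_splits)

lemma vspace_module_dsum:
  fixes M :: "'j \<Rightarrow> ('k::field, 'v) module"
  assumes J: "finite J" and M: "\<And>j. j \<in> J \<Longrightarrow> vspace (M j)"
  shows "vspace (module_dsum J M)"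
proof -
  have ag: "abelian_group (M j)" if "j \<in> J" for j
  proof -
    interpret vectorspace class_ring "M j" by (rule M[OF that])
    show ?thesis ..
  qed
  note cl = vspaceD[OF M]
  \<comment> \<open>Over a finite index set the direct sum coincides with the product, so every law
    is checked in each coordinate.\<close>
  have carr: "carrier (module_dsum J M) = (\<Pi>\<^sub>E j\<in>J. carrier (M j))"
    using J by (auto simp: module_dsum_def)
  have simps: "h \<oplus>\<^bsub>module_dsum J M\<^esub> h' = (\<lambda>j\<in>J. h j \<oplus>\<^bsub>M j\<^esub> h' j)"
    "c \<odot>\<^bsub>module_dsum J M\<^esub> h = (\<lambda>j\<in>J. c \<odot>\<^bsub>M j\<^esub> h j)"
    "\<zero>\<^bsub>module_dsum J M\<^esub> = (\<lambda>j\<in>J. \<zero>\<^bsub>M j\<^esub>)" for h h' c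
    by (simp_all add: module_dsum_def)
  show ?thesis
  proof (rule vspaceI)
    show "abelian_group (module_dsum J M)"
    proof (rule abelian_groupI, unfold carr simps)
      fix h assume h: "h \<in> (\<Pi>\<^sub>E j\<in>J. carrier (M j))"
      have "(\<lambda>j\<in>J. \<ominus>\<^bsub>M j\<^esub> h j) \<in> (\<Pi>\<^sub>E j\<in>J. carrier (M j))"
        using h ag by (auto intro!: abelian_group.a_inv_closed)
      moreover have "(\<lambda>j\<in>J. (\<lambda>j\<in>J. \<ominus>\<^bsub>M j\<^esub> h j) j \<oplus>\<^bsub>M j\<^esub> h j) = (\<lambda>j\<in>J. \<zero>\<^bsub>M j\<^esub>)"
        using h ag by (auto intro!: restrict_ext abelian_group.l_neg)
      ultimately show "\<exists>g\<in>\<Pi>\<^sub>E j\<in>J. carrier (M j). (\<lambda>j\<in>J. g j \<oplus>\<^bsub>M j\<^esub> h j) = (\<lambda>j\<in>J. \<zero>\<^bsub>M j\<^esub>)"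
        by blast
    next
      fix h g assume "h \<in> (\<Pi>\<^sub>E j\<in>J. carrier (M j))" "g \<in> (\<Pi>\<^sub>E j\<in>J. carrier (M j))"
      then show "(\<lambda>j\<in>J. h j \<oplus>\<^bsub>M j\<^esub> g j) = (\<lambda>j\<in>J. g j \<oplus>\<^bsub>M j\<^esub> h j)"
        using ag by (auto intro!: restrict_ext abelian_monoid.a_comm simp: abelian_group_def)
    next
      fix h g k assume "h \<in> (\<Pi>\<^sub>E j\<in>J. carrier (M j))" "g \<in> (\<Pi>\<^sub>E j\<in>J. carrier (M j))"
        "k \<in> (\<Pi>\<^sub>E j\<in>J. carrier (M j))"
      then show "(\<lambda>j\<in>J. (\<lambda>j\<in>J. h j \<oplus>\<^bsub>M j\<^esub> g j) j \<oplus>\<^bsub>M j\<^esub> k j) =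
          (\<lambda>j\<in>J. h j \<oplus>\<^bsub>M j\<^esub> (\<lambda>j\<in>J. g j \<oplus>\<^bsub>M j\<^esub> k j) j)"
        using ag by (auto intro!: restrict_ext abelian_monoid.a_assoc simp: abelian_group_def)
    next
      fix h assume h: "h \<in> (\<Pi>\<^sub>E j\<in>J. carrier (M j))"
      show "(\<lambda>j\<in>J. (\<lambda>j\<in>J. \<zero>\<^bsub>M j\<^esub>) j \<oplus>\<^bsub>M j\<^esub> h j) = h"
      proof (rule extensionalityI[of _ J])
        fix j assume j: "j \<in> J"
        then show "(\<lambda>j\<in>J. (\<lambda>j\<in>J. \<zero>\<^bsub>M j\<^esub>) j \<oplus>\<^bsub>M j\<^esub> h j) j = h j"
          using h ag[OF j] by (auto simp: abelian_group_def intro!: abelian_monoid.l_zero)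
      qed (use h in \<open>auto simp: PiE_iff\<close>)
    qed (auto intro!: cl)
  next
    fix h assume h: "h \<in> carrier (module_dsum J M)"
    show "1 \<odot>\<^bsub>module_dsum J M\<^esub> h = h"
      unfolding simps
    proof (rule extensionalityI[of _ J])
      fix j assume j: "j \<in> J"
      then interpret vectorspace class_ring "M j" by (rule M)
      show "(\<lambda>j\<in>J. 1 \<odot>\<^bsub>M j\<^esub> h j) j = h j" using j h smult_one[of "h j"] by (auto simp: carr)
    qed (use h in \<open>auto simp: carr PiE_iff\<close>)
  next
    fix a b h assume h: "h \<in> carrier (module_dsum J M)"
    have "(a + b) \<odot>\<^bsub>M j\<^esub> h j = a \<odot>\<^bsub>M j\<^esub> h j \<oplus>\<^bsub>M j\<^esub> b \<odot>\<^bsub>M j\<^esub> h j \<and>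
        (a * b) \<odot>\<^bsub>M j\<^esub> h j = a \<odot>\<^bsub>M j\<^esub> (b \<odot>\<^bsub>M j\<^esub> h j)" if j: "j \<in> J" for j
    proof -
      interpret vectorspace class_ring "M j" by (rule M[OF j])
      show ?thesis using j h smult_l_distr[of a b "h j"] smult_assoc1[of a b "h j"] by (auto simp: carr)
    qed
    then show "(a + b) \<odot>\<^bsub>module_dsum J M\<^esub> h =
        a \<odot>\<^bsub>module_dsum J M\<^esub> h \<oplus>\<^bsub>module_dsum J M\<^esub> b \<odot>\<^bsub>module_dsum J M\<^esub> h"
      "(a * b) \<odot>\<^bsub>module_dsum J M\<^esub> h = a \<odot>\<^bsub>module_dsum J M\<^esub> (b \<odot>\<^bsub>module_dsum J M\<^esub> h)"
      by (auto simp: simps intro!: restrict_ext)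
  next
    fix a h g assume h: "h \<in> carrier (module_dsum J M)" "g \<in> carrier (module_dsum J M)"
    have "a \<odot>\<^bsub>M j\<^esub> (h j \<oplus>\<^bsub>M j\<^esub> g j) = a \<odot>\<^bsub>M j\<^esub> h j \<oplus>\<^bsub>M j\<^esub> a \<odot>\<^bsub>M j\<^esub> g j" if j: "j \<in> J" for j
    proof -
      interpret vectorspace class_ring "M j" by (rule M[OF j])
      show ?thesis using j h smult_r_distr[of a "h j" "g j"] by (auto simp: carr)
    qed
    then show "a \<odot>\<^bsub>module_dsum J M\<^esub> (h \<oplus>\<^bsub>module_dsum J M\<^esub> g) =
        a \<odot>\<^bsub>module_dsum J M\<^esub> h \<oplus>\<^bsub>module_dsum J M\<^esub> a \<odot>\<^bsub>module_dsum J M\<^esub> g"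
      by (auto simp: simps intro!: restrict_ext)
  qed (auto simp: carr simps intro!: cl)
qed

lemma vlin_inv_into:
  assumes f: "vlin V W f" and bij: "bij_betw f (carrier V) (carrier W)"
  shows "vlin W V (inv_into (carrier V) f)"
proof -
  let ?g = "inv_into (carrier V) f"
  note l = vlinD[OF f] and vs = vspaceD[OF vlinD(1)[OF f]] vspaceD[OF vlinD(2)[OF f]]
  have g: "?g w \<in> carrier V" "f (?g w) = w" if "w \<in> carrier W" for w
    using bij that by (auto simp: bij_betw_def intro: inv_into_into f_inv_into_f)
  have gf: "?g (f v) = v" if "v \<in> carrier V" for v using bij_betw_inv_into_left[OF bij that] .
  show ?thesis
    unfolding vlin_iff
  proof (intro conjI ballI allI)
    fix x y assume "x \<in> carrier W" "y \<in> carrier W"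
    then show "?g (x \<oplus>\<^bsub>W\<^esub> y) = ?g x \<oplus>\<^bsub>V\<^esub> ?g y"
      using gf[of "?g x \<oplus>\<^bsub>V\<^esub> ?g y"] g l vs by simp
  next
    fix c x assume "x \<in> carrier W"
    then show "?g (c \<odot>\<^bsub>W\<^esub> x) = c \<odot>\<^bsub>V\<^esub> ?g x"
      using gf[of "c \<odot>\<^bsub>V\<^esub> ?g x"] g l vs by simp
  qed (use l g in auto)
qed

text \<open>The isomorphism is built out of the direct sum, by forming linear combinations, whereas
  decomposability asks for one into it. The hypothesis \<open>maps\<close> keeps
  \<open>\<gamma>\<close> within the carriers, where \<open>inv_into\<close> inverts
  \<open>\<eta>\<close>.\<close>

lemma vec_functor_iso_sym:
  assumes iso: "vec_functor_iso P G \<gamma> F \<phi>"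
    and maps: "\<And>x y v. x \<in> carrier P \<Longrightarrow> y \<in> carrier P \<Longrightarrow> x \<sqsubseteq>\<^bsub>P\<^esub> y \<Longrightarrow> v \<in> carrier (G x) \<Longrightarrow>
      \<gamma> x y v \<in> carrier (G y)"
  shows "vec_functor_iso P F \<phi> G \<gamma>"
proof -
  from iso obtain \<eta> where lin: "\<And>x. x \<in> carrier P \<Longrightarrow> vlin (G x) (F x) (\<eta> x)"
    and bij: "\<And>x. x \<in> carrier P \<Longrightarrow> bij_betw (\<eta> x) (carrier (G x)) (carrier (F x))"
    and nat: "\<And>x y v. x \<in> carrier P \<Longrightarrow> y \<in> carrier P \<Longrightarrow> x \<sqsubseteq>\<^bsub>P\<^esub> y \<Longrightarrow> v \<in> carrier (G x) \<Longrightarrow>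
      \<eta> y (\<gamma> x y v) = \<phi> x y (\<eta> x v)"
    unfolding vec_functor_iso_def by blast
  let ?\<eta>' = "\<lambda>x. inv_into (carrier (G x)) (\<eta> x)"
  have "?\<eta>' y (\<phi> x y v) = \<gamma> x y (?\<eta>' x v)"
    if xy: "x \<in> carrier P" "y \<in> carrier P" "x \<sqsubseteq>\<^bsub>P\<^esub> y" and v: "v \<in> carrier (F x)" for x y v
  proof -
    have w: "?\<eta>' x v \<in> carrier (G x)" "\<eta> x (?\<eta>' x v) = v"
      using bij[OF xy(1)] v by (auto simp: bij_betw_def intro: inv_into_into f_inv_into_f)
    show ?thesis
      using nat[OF xy w(1)] w(2) bij_betw_inv_into_left[OF bij[OF xy(2)] maps[OF xy w(1)]] by simp
  qed
  then show ?thesis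
    unfolding vec_functor_iso_def
    by (intro exI[of _ ?\<eta>']) (simp add: vlin_inv_into[OF lin bij] bij_betw_inv_into[OF bij])
qed

text \<open>At \<open>x\<close> a vector of the direct sum is a coefficient function on
  \<open>J\<close> that vanishes at every \<open>j\<close> with \<open>x\<close> outside
  \<open>S j\<close>; these functions are the coordinates with respect to the basis formed by the
  remaining \<open>m j\<close>.\<close>

lemma family_basis_bij_betw:
  fixes scale :: "'k::field \<Rightarrow> 'b::ab_group_add \<Rightarrow> 'b" and S :: "'j \<Rightarrow> 'p set"
  assumes "ambient_space scale" and J: "finite J"
    and basis: "ambient_space.family_basis scale {j \<in> J. x \<in> S j} m W"
    and W: "module.subspace scale W"
  shows "bij_betw (\<lambda>h. \<Sum>j\<in>{j \<in> J. x \<in> S j}. scale (h j) (m j))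
    (carrier (module_dsum J (\<lambda>j. interval_module (S j) x))) W"
proof -
  interpret ambient_space scale by (rule assms)
  have carr: "carrier (module_dsum J (\<lambda>j. interval_module (S j) x :: ('k, 'k) module)) =
      {h \<in> extensional J. \<forall>j\<in>J. x \<notin> S j \<longrightarrow> h j = 0}"
    using J by (auto simp: module_dsum_def interval_module_def PiE_iff)
  note b = family_basisD[OF basis]
  show ?thesis
    unfolding carr
  proof (rule bij_betw_imageI)
    show "inj_on (\<lambda>h. \<Sum>j\<in>{j \<in> J. x \<in> S j}. scale (h j) (m j))
        {h \<in> extensional J. \<forall>j\<in>J. x \<notin> S j \<longrightarrow> h j = 0}"
    proof (rule inj_onI)
      fix h h' assume h: "h \<in> {h \<in> extensional J. \<forall>j\<in>J. x \<notin> S j \<longrightarrow> h j = 0}"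
        "h' \<in> {h \<in> extensional J. \<forall>j\<in>J. x \<notin> S j \<longrightarrow> h j = 0}"
        and "(\<Sum>j\<in>{j \<in> J. x \<in> S j}. scale (h j) (m j)) = (\<Sum>j\<in>{j \<in> J. x \<in> S j}. scale (h' j) (m j))"
      then have "(\<Sum>j\<in>{j \<in> J. x \<in> S j}. scale (h j - h' j) (m j)) = 0"
        by (simp add: scale_left_diff_distrib sum_subtractf)
      then have "h j - h' j = 0" if "j \<in> {j \<in> J. x \<in> S j}" for j
        using b(4)[of "\<lambda>j. h j - h' j" j] that by blast
      then have "h j = h' j" if "j \<in> J" for j using h that by (cases "x \<in> S j") auto
      then show "h = h'" using h by (intro extensionalityI[of _ J]) auto
    qed
    show "(\<lambda>h. \<Sum>j\<in>{j \<in> J. x \<in> S j}. scale (h j) (m j)) `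
        {h \<in> extensional J. \<forall>j\<in>J. x \<notin> S j \<longrightarrow> h j = 0} = W"
    proof
      show "W \<subseteq> (\<lambda>h. \<Sum>j\<in>{j \<in> J. x \<in> S j}. scale (h j) (m j)) `
          {h \<in> extensional J. \<forall>j\<in>J. x \<notin> S j \<longrightarrow> h j = 0}"
      proof
        fix w assume "w \<in> W"
        then obtain c where c: "w = (\<Sum>j\<in>{j \<in> J. x \<in> S j}. scale (c j) (m j))" using b(3) by blast
        let ?h = "\<lambda>j\<in>J. if x \<in> S j then c j else 0"
        have "w = (\<Sum>j\<in>{j \<in> J. x \<in> S j}. scale (?h j) (m j))" unfolding c by (rule sum.cong) auto
        then show "w \<in> (\<lambda>h. \<Sum>j\<in>{j \<in> J. x \<in> S j}. scale (h j) (m j)) `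
            {h \<in> extensional J. \<forall>j\<in>J. x \<notin> S j \<longrightarrow> h j = 0}"
          by (intro image_eqI[of _ _ ?h]) auto
      qed
    qed (use b(2) in \<open>auto intro!: subspace_sum[OF W] subspace_scale[OF W]\<close>)
  qed
qed

section \<open>Passage from spaces with carriers to coordinates, and back to the direct sum\<close>

theorem proposition8p10:
  fixes I :: "'i set" and T :: "'i \<Rightarrow> 'a gorder"
    and F :: "('i \<Rightarrow> 'a) \<Rightarrow> ('k::field, 'v) module"
    and \<phi> :: "('i \<Rightarrow> 'a) \<Rightarrow> ('i \<Rightarrow> 'a) \<Rightarrow> 'v \<Rightarrow> 'v"
  assumes "finite I"
    and "\<And>i. i \<in> I \<Longrightarrow> total_order (T i)"
    and "\<And>i. i \<in> I \<Longrightarrow> finite (carrier (T i))"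
    and "vec_functor (prod_order I T) F \<phi>"
    and "pointwise_fin_dim (prod_order I T) F"
    and "bidegree_one (prod_order I T) F \<phi>"
  shows "interval_decomposable (prod_order I T) F \<phi>"
proof (cases "carrier (prod_order I T) = {}")
  \<comment> \<open>An empty grid has no bottom, but all conditions are vacuous there and the empty
    direct sum serves.\<close>
  case True
  then show ?thesis
    unfolding interval_decomposable_def vec_functor_iso_def by (intro exI[of _ "{}"]) simp
next
  case False
  let ?P = "prod_order I T"
  interpret grid I T
    by (rule grid.intro) (use assms(1-3) False in \<open>auto simp: prod_order_simps(1) PiE_eq_empty_iff\<close>)
  interpret P: lattice ?P by (rule lattice_P)
  note F = assms(4)[unfolded vec_functor_def]
  have vs: "\<And>x. x \<in> carrier ?P \<Longrightarrow> vspace (F x)"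
    and lin: "\<And>x y. x \<in> carrier ?P \<Longrightarrow> y \<in> carrier ?P \<Longrightarrow> x \<sqsubseteq>\<^bsub>?P\<^esub> y \<Longrightarrow> vlin (F x) (F y) (\<phi> x y)"
    using F by simp_all
  define scale :: "'k \<Rightarrow> ('v \<Rightarrow> 'k) \<Rightarrow> 'v \<Rightarrow> 'k" where "scale = (\<lambda>c w v. c * w v)"
  interpret ambient_space scale unfolding scale_def by (rule ambient_space_fun)
  \<comment> \<open>The properties of coordinates at one point are bundled so that bases and maps
    can be chosen for all points simultaneously.\<close>
  define Q where "Q x B \<theta> \<longleftrightarrow> finite B \<and> (\<forall>w. \<theta> w \<in> carrier (F x)) \<and>
      (\<forall>w w'. \<theta> (w + w') = \<theta> w \<oplus>\<^bsub>F x\<^esub> \<theta> w') \<and> (\<forall>c w. \<theta> (scale c w) = c \<odot>\<^bsub>F x\<^esub> \<theta> w) \<and>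
      bij_betw \<theta> {w. \<forall>v. v \<notin> B \<longrightarrow> w v = 0} (carrier (F x))" for x B \<theta>
  have "\<forall>x\<in>carrier ?P. \<exists>B \<theta>. Q x B \<theta>"
    unfolding Q_def scale_def using assms(5) vs
    by (intro ballI vspace_coordinates) (simp_all add: pointwise_fin_dim_def)
  then obtain B \<theta> where Q: "\<And>x. x \<in> carrier ?P \<Longrightarrow> Q x (B x) (\<theta> x)" by metis
  have finB: "\<And>x. x \<in> carrier ?P \<Longrightarrow> finite (B x)"
    and \<theta>_in: "\<And>x w. x \<in> carrier ?P \<Longrightarrow> \<theta> x w \<in> carrier (F x)"
    and \<theta>_add: "\<And>x w w'. x \<in> carrier ?P \<Longrightarrow> \<theta> x (w + w') = \<theta> x w \<oplus>\<^bsub>F x\<^esub> \<theta> x w'"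
    and \<theta>_scale: "\<And>x c w. x \<in> carrier ?P \<Longrightarrow> \<theta> x (scale c w) = c \<odot>\<^bsub>F x\<^esub> \<theta> x w"
    and \<theta>_bij: "\<And>x. x \<in> carrier ?P \<Longrightarrow>
      bij_betw (\<theta> x) {w. \<forall>v. v \<notin> B x \<longrightarrow> w v = 0} (carrier (F x))"
    using Q by (simp_all add: Q_def)
  define G where "G x = {w. \<forall>v. v \<notin> B x \<longrightarrow> w v = (0 :: 'k)}" for x
  \<comment> \<open>Conjugation by the coordinates. Since \<open>\<theta> x\<close> is defined and
    linear on all functions, \<open>\<gamma> x y\<close> is linear on the whole ambient space, as
    \<open>subspace_functor\<close> demands.\<close>
  define \<gamma> where "\<gamma> x y w = inv_into (G y) (\<theta> y) (\<phi> x y (\<theta> x w))" for x y w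
  note \<theta>_bij = \<theta>_bij[folded G_def]
  have \<theta>_inj: "w = w'" if "x \<in> carrier ?P" "w \<in> G x" "w' \<in> G x" "\<theta> x w = \<theta> x w'" for x w w'
    using \<theta>_bij[OF that(1)] that by (auto simp: bij_betw_def dest: inj_onD)
  have \<theta>_surj: "\<exists>w\<in>G x. v = \<theta> x w" if "x \<in> carrier ?P" "v \<in> carrier (F x)" for x v
    using \<theta>_bij[OF that(1)] that by (auto simp: bij_betw_def)
  have \<theta>_0: "\<theta> x 0 = \<zero>\<^bsub>F x\<^esub>" if x: "x \<in> carrier ?P" for x
  proof -
    interpret Fx: vectorspace class_ring "F x" by (rule vs[OF x])
    have "scale 0 0 = 0" by simp
    then show ?thesis using \<theta>_scale[OF x, of 0 0] \<theta>_in[OF x, of 0] Fx.lmult_0[of "\<theta> x 0"] by simp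
  qed
  have G_sub: "local.subspace (G x)" for x
    unfolding local.subspace_def G_def by (simp add: scale_def)
  have \<gamma>: "\<gamma> x y w \<in> G y" "\<theta> y (\<gamma> x y w) = \<phi> x y (\<theta> x w)"
    if xy: "x \<in> carrier ?P" "y \<in> carrier ?P" "x \<sqsubseteq>\<^bsub>?P\<^esub> y" for x y w
  proof -
    have "\<phi> x y (\<theta> x w) \<in> \<theta> y ` G y"
      using vlinD(3)[OF lin[OF xy] \<theta>_in[OF xy(1)]] \<theta>_bij[OF xy(2)] by (simp add: bij_betw_def)
    then show "\<gamma> x y w \<in> G y" "\<theta> y (\<gamma> x y w) = \<phi> x y (\<theta> x w)"
      unfolding \<gamma>_def by (rule inv_into_into, rule f_inv_into_f)
  qed
  have fun_G: "subspace_functor ?P G \<gamma>"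
    unfolding subspace_functor_def
  proof (intro conjI ballI impI)
    fix x assume x: "x \<in> carrier ?P"
    show "local.subspace (G x)" by (rule G_sub)
    show "\<exists>S. finite S \<and> G x \<subseteq> span S"
    proof (intro exI conjI subsetI)
      have sum_fun: "(\<Sum>b\<in>A. f b) v = (\<Sum>b\<in>A. f b v)" for A and f :: "'v \<Rightarrow> 'v \<Rightarrow> 'k" and v
        by (induction A rule: infinite_finite_induct) simp_all
      let ?\<delta> = "\<lambda>b v. if v = b then 1 else (0 :: 'k)"
      show "finite (?\<delta> ` B x)" using finB[OF x] by simp
      fix w assume w: "w \<in> G x"
      have "w = (\<Sum>b\<in>B x. scale (w b) (?\<delta> b))"
      proof
        fix v
        have "(\<Sum>b\<in>B x. scale (w b) (?\<delta> b)) v = (\<Sum>b\<in>B x. if v = b then w b else 0)"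
          by (simp add: sum_fun scale_def if_distrib cong: if_cong)
        also have "\<dots> = w v" using w finB[OF x] by (auto simp: G_def)
        finally show "w v = (\<Sum>b\<in>B x. scale (w b) (?\<delta> b)) v" by simp
      qed
      also have "\<dots> \<in> span (?\<delta> ` B x)" by (intro span_sum span_scale span_base) auto
      finally show "w \<in> span (?\<delta> ` B x)" .
    qed
    show "\<gamma> x x w = w" if w: "w \<in> G x" for w
      using \<theta>_inj[OF x \<gamma>(1)[OF x x P_refl[OF x]] w] \<gamma>(2)[OF x x P_refl[OF x]] F x \<theta>_in[OF x] by simp
  next
    fix x y assume xy: "x \<in> carrier ?P" "y \<in> carrier ?P" "x \<sqsubseteq>\<^bsub>?P\<^esub> y"
    note l = vlinD[OF lin[OF xy]] and g = \<gamma>[OF xy] and inj = \<theta>_inj[OF xy(2) \<gamma>(1)[OF xy]]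
    show "\<gamma> x y ` G x \<subseteq> G y" using g by blast
    have add: "\<gamma> x y (u + w) = \<gamma> x y u + \<gamma> x y w" for u w
      by (rule inj) (simp_all add: subspace_add[OF G_sub] g \<theta>_add xy l \<theta>_in)
    have scale: "\<gamma> x y (scale c w) = scale c (\<gamma> x y w)" for c w
      by (rule inj) (simp_all add: subspace_scale[OF G_sub] g \<theta>_scale xy l \<theta>_in)
    show "Vector_Spaces.linear scale scale (\<gamma> x y)"
      using add scale vector_space_axioms by (simp add: Vector_Spaces.linear_iff)
  next
    fix x y z w assume "x \<in> carrier ?P" "y \<in> carrier ?P" "z \<in> carrier ?P"
      "x \<sqsubseteq>\<^bsub>?P\<^esub> y \<and> y \<sqsubseteq>\<^bsub>?P\<^esub> z" "w \<in> G x"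
    then have xyz: "x \<in> carrier ?P" "y \<in> carrier ?P" "z \<in> carrier ?P" "x \<sqsubseteq>\<^bsub>?P\<^esub> y" "y \<sqsubseteq>\<^bsub>?P\<^esub> z"
      by simp_all
    have xz: "x \<sqsubseteq>\<^bsub>?P\<^esub> z" by (rule P_trans[OF xyz(4,5,1-3)])
    have "\<phi> y z (\<phi> x y (\<theta> x w)) = \<phi> x z (\<theta> x w)" using F xyz \<theta>_in[OF xyz(1)] by blast
    then show "\<gamma> y z (\<gamma> x y w) = \<gamma> x z w"
      by (intro \<theta>_inj[OF xyz(3)]) (simp_all add: \<gamma> xyz xz)
  qed
  \<comment> \<open>The universal properties enter through their elementwise forms, read in
    coordinates.\<close>
  interpret bidegree_one_functor I T scale G \<gamma>
  proof unfold_locales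
    show "subspace_functor ?P G \<gamma>" by (rule fun_G)
  next
    fix x y d assume x: "x \<in> carrier ?P" and y: "y \<in> carrier ?P" and d: "d \<in> G (x \<squnion>\<^bsub>?P\<^esub> y)"
    let ?z = "x \<squnion>\<^bsub>?P\<^esub> y"
    have z: "?z \<in> carrier ?P" "x \<sqsubseteq>\<^bsub>?P\<^esub> ?z" "y \<sqsubseteq>\<^bsub>?P\<^esub> ?z"
      using x y by (simp_all add: P.join_left P.join_right)
    have "pushout_square TYPE('v \<times> 'v) (F (x \<sqinter>\<^bsub>?P\<^esub> y)) (F x) (F y) (F ?z)
        (\<phi> (x \<sqinter>\<^bsub>?P\<^esub> y) x) (\<phi> (x \<sqinter>\<^bsub>?P\<^esub> y) y) (\<phi> x ?z) (\<phi> y ?z)"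
      using assms(6) x y unfolding bidegree_one_def codegree_one_def by blast
    from pushout_square_elementwise(1)[OF this \<theta>_in[OF z(1)], of d]
    obtain b c where bc: "b \<in> carrier (F x)" "c \<in> carrier (F y)"
      "\<theta> ?z d = \<phi> x ?z b \<oplus>\<^bsub>F ?z\<^esub> \<phi> y ?z c" by blast
    obtain u w where uw: "u \<in> G x" "b = \<theta> x u" "w \<in> G y" "c = \<theta> y w"
      using \<theta>_surj[OF x bc(1)] \<theta>_surj[OF y bc(2)] by blast
    have "d = \<gamma> x ?z u + \<gamma> y ?z w"
      by (rule \<theta>_inj[OF z(1) d])
        (simp_all add: subspace_add[OF G_sub] \<gamma> x y z \<theta>_add bc(3) uw(2,4))
    then show "\<exists>u\<in>G x. \<exists>w\<in>G y. d = \<gamma> x ?z u + \<gamma> y ?z w" using uw(1,3) by blast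
  next
    fix x y u w assume x: "x \<in> carrier ?P" and y: "y \<in> carrier ?P" and u: "u \<in> G x" and w: "w \<in> G y"
      and 0: "\<gamma> x (x \<squnion>\<^bsub>?P\<^esub> y) u + \<gamma> y (x \<squnion>\<^bsub>?P\<^esub> y) w = 0"
    let ?z = "x \<squnion>\<^bsub>?P\<^esub> y" and ?m = "x \<sqinter>\<^bsub>?P\<^esub> y"
    have z: "?z \<in> carrier ?P" "x \<sqsubseteq>\<^bsub>?P\<^esub> ?z" "y \<sqsubseteq>\<^bsub>?P\<^esub> ?z"
      using x y by (simp_all add: P.join_left P.join_right)
    have m: "?m \<in> carrier ?P" "?m \<sqsubseteq>\<^bsub>?P\<^esub> x" "?m \<sqsubseteq>\<^bsub>?P\<^esub> y"
      using x y by (simp_all add: P.meet_left P.meet_right)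
    have "pushout_square TYPE('v \<times> 'v) (F ?m) (F x) (F y) (F ?z) (\<phi> ?m x) (\<phi> ?m y) (\<phi> x ?z) (\<phi> y ?z)"
      using assms(6) x y unfolding bidegree_one_def codegree_one_def by blast
    moreover have "\<phi> x ?z (\<theta> x u) \<oplus>\<^bsub>F ?z\<^esub> \<phi> y ?z (\<theta> y w) = \<zero>\<^bsub>F ?z\<^esub>"
      using \<theta>_add[OF z(1), of "\<gamma> x ?z u" "\<gamma> y ?z w"] 0 by (simp add: \<gamma> x y z \<theta>_0)
    ultimately obtain a where a: "a \<in> carrier (F ?m)" "\<theta> x u = \<phi> ?m x a"
      "\<theta> y w = (-1) \<odot>\<^bsub>F y\<^esub> \<phi> ?m y a"
      using pushout_square_elementwise(2)[OF _ \<theta>_in[OF x] \<theta>_in[OF y]] by blast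
    obtain a' where a': "a' \<in> G ?m" "a = \<theta> ?m a'" using \<theta>_surj[OF m(1) a(1)] by blast
    have "u = \<gamma> ?m x a'" by (rule \<theta>_inj[OF x u]) (simp_all add: \<gamma> m x a(2) a'(2))
    moreover have "w = scale (-1) (\<gamma> ?m y a')"
      by (rule \<theta>_inj[OF y w]) (simp_all add: subspace_scale[OF G_sub] \<gamma> m y a(3) a'(2) \<theta>_scale
        del: scale_minus_left)
    ultimately show "\<exists>a\<in>G ?m. u = \<gamma> ?m x a \<and> w = - \<gamma> ?m y a" using a'(1) by auto
  next
    fix x y a assume x: "x \<in> carrier ?P" and y: "y \<in> carrier ?P" and a: "a \<in> G (x \<sqinter>\<^bsub>?P\<^esub> y)"
      and 0: "\<gamma> (x \<sqinter>\<^bsub>?P\<^esub> y) x a = 0" "\<gamma> (x \<sqinter>\<^bsub>?P\<^esub> y) y a = 0"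
    let ?z = "x \<squnion>\<^bsub>?P\<^esub> y" and ?m = "x \<sqinter>\<^bsub>?P\<^esub> y"
    have m: "?m \<in> carrier ?P" "?m \<sqsubseteq>\<^bsub>?P\<^esub> x" "?m \<sqsubseteq>\<^bsub>?P\<^esub> y"
      using x y by (simp_all add: P.meet_left P.meet_right)
    have z: "?z \<in> carrier ?P" "x \<sqsubseteq>\<^bsub>?P\<^esub> ?z" "y \<sqsubseteq>\<^bsub>?P\<^esub> ?z"
      using x y by (simp_all add: P.join_left P.join_right)
    note l = vlinD(6)[OF lin]
    have "pullback_square TYPE('v \<times> 'v) (F ?m) (F x) (F y) (F ?z) (\<phi> ?m x) (\<phi> ?m y) (\<phi> x ?z) (\<phi> y ?z)"
      using assms(6) x y unfolding bidegree_one_def degree_one_def by blast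
    \<comment> \<open>Uniqueness is applied to lifts of the pair of zero vectors: both 0 and
      \<open>\<theta> ?m a\<close> are such lifts.\<close>
    from pullback_square_elementwise[OF this vspaceD(1)[OF vs[OF x]] vspaceD(1)[OF vs[OF y]]]
    have "\<exists>!a. a \<in> carrier (F ?m) \<and> \<phi> ?m x a = \<zero>\<^bsub>F x\<^esub> \<and> \<phi> ?m y a = \<zero>\<^bsub>F y\<^esub>"
      by (simp add: l x y z)
    moreover have "\<phi> ?m x (\<theta> ?m a) = \<zero>\<^bsub>F x\<^esub>" "\<phi> ?m y (\<theta> ?m a) = \<zero>\<^bsub>F y\<^esub>"
      using \<gamma>(2)[OF m(1) x m(2), of a] \<gamma>(2)[OF m(1) y m(3), of a] 0 \<theta>_0 x y by simp_all
    ultimately have "\<theta> ?m a = \<zero>\<^bsub>F ?m\<^esub>"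
      using \<theta>_in[OF m(1)] vspaceD(1)[OF vs[OF m(1)]] l[OF m(1) x m(2)] l[OF m(1) y m(3)] by blast
    then show "a = 0"
      using \<theta>_inj[OF m(1) a subspace_0[OF G_sub]] \<theta>_0[OF m(1)] by simp
  qed
  obtain J :: "nat set" and S m where IB: "interval_basis ?P G \<gamma> J S m"
    using ex_interval_basis by blast
  then have J: "finite J" and S: "\<forall>j\<in>J. poset_interval ?P (S j)"
    and basis: "\<And>x. x \<in> carrier ?P \<Longrightarrow> family_basis {j\<in>J. x \<in> S j} (\<lambda>j. m j x) (G x)"
    and nat: "\<And>j x y. j \<in> J \<Longrightarrow> x \<in> S j \<Longrightarrow> y \<in> carrier ?P \<Longrightarrow> x \<sqsubseteq>\<^bsub>?P\<^esub> y \<Longrightarrow>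
      \<gamma> x y (m j x) = (if y \<in> S j then m j y else 0)"
    unfolding interval_basis_def by blast+
  let ?D = "\<lambda>x. module_dsum J (\<lambda>j. interval_module (S j) x) :: ('k, nat \<Rightarrow> 'k) module"
  let ?d = "\<lambda>x y. map_dsum J (\<lambda>j. interval_map (S j) x y) :: (nat \<Rightarrow> 'k) \<Rightarrow> nat \<Rightarrow> 'k"
  define R where "R x h = (\<Sum>j\<in>{j \<in> J. x \<in> S j}. scale (h j) (m j x))" for x h
  have vsD: "vspace (?D x)" for x by (intro vspace_module_dsum J vspace_interval_module)
  have carr: "carrier (?D x) = {h \<in> extensional J. \<forall>j\<in>J. x \<notin> S j \<longrightarrow> h j = 0}" for x
    using J by (auto simp: module_dsum_def interval_module_def PiE_iff)
  have R_bij: "bij_betw (R x) (carrier (?D x)) (G x)" if x: "x \<in> carrier ?P" for x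
    unfolding R_def
    by (rule family_basis_bij_betw[OF ambient_space_axioms J basis[OF x] G_sub])
  have R_add: "R x (h \<oplus>\<^bsub>?D x\<^esub> h') = R x h + R x h'" for x h h'
    by (simp add: R_def module_dsum_def interval_module_def scale_left_distrib sum.distrib)
  have R_scale: "R x (c \<odot>\<^bsub>?D x\<^esub> h) = scale c (R x h)" for x c h
    by (simp add: R_def module_dsum_def interval_module_def scale_sum_right)
  have R_nat: "R y (?d x y h) = \<gamma> x y (R x h)"
    if xy: "x \<in> carrier ?P" "y \<in> carrier ?P" "x \<sqsubseteq>\<^bsub>?P\<^esub> y" for x y h
  proof -
    interpret l: Vector_Spaces.linear scale scale "\<gamma> x y" by (rule subspace_functorD(3)[OF fun_G xy])
    \<comment> \<open>Both sides become sums over all of \<open>J\<close>, extended by zero, in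
      which a term survives only if \<open>x\<close> and \<open>y\<close> both lie in
      \<open>S j\<close>.\<close>
    have "R y (?d x y h) = (\<Sum>j\<in>J. if y \<in> S j then scale (?d x y h j) (m j y) else 0)"
      using J unfolding R_def by (rule sum.inter_filter)
    also have "\<dots> = (\<Sum>j\<in>J. if x \<in> S j then scale (h j) (\<gamma> x y (m j x)) else 0)"
      by (rule sum.cong) (simp_all add: map_dsum_def interval_map_def nat[OF _ _ xy(2,3)])
    also have "\<dots> = \<gamma> x y (R x h)"
      using J unfolding R_def l.sum l.scale by (rule sum.inter_filter[symmetric])
    finally show ?thesis .
  qed
  have "vec_functor_iso ?P ?D ?d F \<phi>"
    unfolding vec_functor_iso_def
  proof (intro exI[of _ "\<lambda>x h. \<theta> x (R x h)"] conjI ballI impI)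
    fix x assume x: "x \<in> carrier ?P"
    show "vlin (?D x) (F x) (\<lambda>h. \<theta> x (R x h))"
      unfolding vlin_iff
      using vsD vs[OF x] \<theta>_in[OF x] by (simp add: R_add R_scale \<theta>_add[OF x] \<theta>_scale[OF x])
    show "bij_betw (\<lambda>h. \<theta> x (R x h)) (carrier (?D x)) (carrier (F x))"
      using bij_betw_trans[OF R_bij[OF x] \<theta>_bij[OF x]] by (simp add: comp_def)
  next
    fix x y h assume "x \<in> carrier ?P" "y \<in> carrier ?P" "x \<sqsubseteq>\<^bsub>?P\<^esub> y"
    then show "\<theta> y (R y (?d x y h)) = \<phi> x y (\<theta> x (R x h))" by (simp add: R_nat \<gamma>)
  qed
  then have "vec_functor_iso ?P F \<phi> ?D ?d"
    by (rule vec_functor_iso_sym) (auto simp: carr map_dsum_def interval_map_def)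
  then show ?thesis using S unfolding interval_decomposable_def by blast
qed

end
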